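(* Let $V\in L^\infty_{\rm loc}(\mathbb{R}^d)$ be an a.e. non-negative potential such that, for some $\eta>0$ and some constant $C_1>0$, $V(x)\leqslant C_1e^{\eta|x|}$ for a.e. $x$, and such that $e^{-tL}$ has exponential decay of some order $\delta>0$, i.e. $\|e^{-tL}(\mathbf 1)\|_\infty\leqslant C_2e^{-\delta t}$ for all $t>0$ with some constant $C_2>0$. Let $0<a<\delta^{1/2}(2d)^{-1/2}\eta^{-1}$, take $b>a$ and let $$c=\min\left(\frac{b-a}{8b},\frac{\delta a}{4b}\right).$$ If there are a compact set $F\subset\mathbb{R}^d$ and a constant $C_3>0$ such that $K_c^a(V)(x)\leqslant C_3$ and $I^b(V)(x)\leqslant C_3$ for a.e. $x\notin F$, then $R_V^a$ is bounded on $L^1(\mathbb{R}^d)$.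
   Context: The Schrödinger operator $L=-\frac12\Delta+V$ is the positive self-adjoint operator on $L^2(\mathbb{R}^d)$ associated with the closed form $Q(u,v)=\int\frac12\langle\nabla u,\nabla v\rangle+Vu\overline v$ with domain $\{f\in L^2:\nabla f\in L^2,\ V^{1/2}f\in L^2\}$. Its semigroup is given by the Feynman–Kac formula $e^{-tL}f(x)=\mathbb{E}_x[e^{-\int_0^tV(X_s)ds}f(X_t)]$, $X$ standard $d$-dimensional Brownian motion (generator $\frac12\Delta$) started at $x$; this formula is taken as the definition of $e^{-tL}f$ for $f\in L^\infty$, in particular for the constant function $\mathbf 1$. For $a>0$ and a non-negative $f\in L^1$ define, for a.e. $x$, $R_V^af(x)=V^a(x)\cdot\frac1{\Gamma(a)}\int_0^\infty e^{-tL}f(x)\,t^{a-1}\,dt\in[0,\infty]$. $R_V^a$ is bounded on $L^1$ if there is $C>0$ such that $\|R_V^af\|_1\leqslant C\|f\|_1$ for all non-negative simple functions $f$ supported in a compact subset of $\mathbb{R}^d$. $V(x)$ denotes the value at $x$ of a fixed representative of $V$, and $B(x,r)$ is the closed Euclidean ball. For $u\geqslant1$ put $$\rho_x(u)=\sup\{r\geqslant0: V(x)/u\leqslant V(y)\text{ for a.e. }y\in B(x,r)\},\qquad \sigma_x(u)=\sup\{r\geqslant0: V(y)\leqslant uV(x)\text{ for a.e. }y\in B(x,r)\},$$ both in $[0,\infty]$. For $a,b,c>0$, $$I^b(V)(x)=\int_1^{\max(1,V(x))}s^{b-1}e^{-\rho_x(s)^2/(4d)}\,ds,\qquad K_c^a(V)(x)=\min(1,V(x)^a)\int_1^\infty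 e^{-c\sigma_x(s)}s^{a-1}\,ds,$$ where exponentials of $-\infty$ are $0$ and the usual convention $0\cdot\infty=0$ is used. *)

theory Defs
  imports "HOL-Probability.Probability"
begin

text \<open>Standard Brownian motion on a Euclidean space (generator half the Laplacian), started at the
  origin and indexed by the times \<open>t \<ge> 0\<close>; the process started at \<open>x\<close> is \<open>x + X t\<close>.\<close>

locale brownian_motion = prob_space M
  for M :: "'w measure" +
  fixes X :: "real \<Rightarrow> 'w \<Rightarrow> 'a::euclidean_space"
  assumes measurable_X: "\<And>t. 0 \<le> t \<Longrightarrow> random_variable borel (X t)"
    and start_X: "\<And>\<omega>. \<omega> \<in> space M \<Longrightarrow> X 0 \<omega> = 0"
    and continuous_X: "\<And>\<omega>. \<omega> \<in> space M \<Longrightarrow> continuous_on {0..} (\<lambda>t. X t \<omega>)"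
    and increments_indep: "\<And>t n. 0 \<le> t 0 \<Longrightarrow> (\<forall>i<n. t i < t (Suc i)) \<Longrightarrow>
      indep_vars (\<lambda>_. borel) (\<lambda>i \<omega>. X (t (Suc i)) \<omega> - X (t i) \<omega>) {..<n}"
    and increments_normal: "\<And>s t. 0 \<le> s \<Longrightarrow> s < t \<Longrightarrow>
      distributed M lborel (\<lambda>\<omega>. X t \<omega> - X s \<omega>)
        (\<lambda>z. ennreal (\<Prod>e\<in>Basis. normal_density 0 (sqrt (t - s)) (z \<bullet> e)))"

definition exp_neg :: "ennreal \<Rightarrow> ennreal" where
  "exp_neg z = (if z = \<infinity> then 0 else ennreal (exp (- enn2real z)))"

text \<open>The Feynman--Kac formula for \<open>e\<^sup>-\<^sup>t\<^sup>L f (x)\<close> with \<open>L = -\<Delta>/2 + V\<close>, where \<open>V\<close> is a.e. non-negative and \<open>f\<close> is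
  non-negative. Integrals of non-negative functions are taken in \<open>[0,\<infinity>]\<close> throughout; for \<open>t > 0\<close> the
  value does not depend on the representatives of \<open>V\<close> and \<open>f\<close>, since the occupation time of a null
  set vanishes almost surely and the law of \<open>X t\<close> has a density.\<close>

definition schroedinger_semigroup ::
  "'w measure \<Rightarrow> (real \<Rightarrow> 'w \<Rightarrow> 'a) \<Rightarrow> ('a \<Rightarrow> real) \<Rightarrow> real \<Rightarrow> ('a \<Rightarrow> real) \<Rightarrow> 'a::euclidean_space \<Rightarrow> ennreal"
where
  "schroedinger_semigroup M X V t f x =
    (\<integral>\<^sup>+\<omega>. exp_neg (\<integral>\<^sup>+s\<in>{0..t}. ennreal (V (x + X s \<omega>)) \<partial>lborel) * ennreal (f (x + X t \<omega>)) \<partial>M)"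

definition exponential_decay ::
  "'w measure \<Rightarrow> (real \<Rightarrow> 'w \<Rightarrow> 'a::euclidean_space) \<Rightarrow> ('a \<Rightarrow> real) \<Rightarrow> real \<Rightarrow> bool"
where
  "exponential_decay M X V \<delta> \<longleftrightarrow> (\<exists>C>0. \<forall>t>0. AE x in lebesgue.
    schroedinger_semigroup M X V t (\<lambda>_. 1) x \<le> ennreal (C * exp (- \<delta> * t)))"

definition riesz_transform ::
  "'w measure \<Rightarrow> (real \<Rightarrow> 'w \<Rightarrow> 'a) \<Rightarrow> ('a \<Rightarrow> real) \<Rightarrow> real \<Rightarrow> ('a \<Rightarrow> real) \<Rightarrow> 'a::euclidean_space \<Rightarrow> ennreal"
where
  "riesz_transform M X V a f x = ennreal (V x powr a) * (ennreal (1 / Gamma a) *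
    (\<integral>\<^sup>+t\<in>{0<..}. schroedinger_semigroup M X V t f x * ennreal (t powr (a - 1)) \<partial>lborel))"

definition riesz_bounded_L1 ::
  "'w measure \<Rightarrow> (real \<Rightarrow> 'w \<Rightarrow> 'a::euclidean_space) \<Rightarrow> ('a \<Rightarrow> real) \<Rightarrow> real \<Rightarrow> bool"
where
  "riesz_bounded_L1 M X V a \<longleftrightarrow> (\<exists>C>0. \<forall>f::'a \<Rightarrow> real.
    simple_function lebesgue f \<and> (\<forall>x. 0 \<le> f x) \<and> (\<exists>K. compact K \<and> (\<forall>x. x \<notin> K \<longrightarrow> f x = 0)) \<longrightarrow>
    (\<integral>\<^sup>+x. riesz_transform M X V a f x \<partial>lebesgue) \<le> ennreal C * (\<integral>\<^sup>+x. ennreal (f x) \<partial>lebesgue))"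

definition Linf_loc :: "('a::euclidean_space \<Rightarrow> real) \<Rightarrow> bool" where
  "Linf_loc V \<longleftrightarrow> V \<in> borel_measurable lebesgue \<and>
    (\<forall>K. compact K \<longrightarrow> (\<exists>C. AE x in lebesgue. x \<in> K \<longrightarrow> \<bar>V x\<bar> \<le> C))"

definition rho :: "('a::euclidean_space \<Rightarrow> real) \<Rightarrow> 'a \<Rightarrow> real \<Rightarrow> ennreal" where
  "rho V x u = (SUP r\<in>{r. 0 \<le> r \<and> (AE y in lebesgue. y \<in> cball x r \<longrightarrow> V x / u \<le> V y)}. ennreal r)"

definition sigma_rad :: "('a::euclidean_space \<Rightarrow> real) \<Rightarrow> 'a \<Rightarrow> real \<Rightarrow> ennreal" where
  "sigma_rad V x u = (SUP r\<in>{r. 0 \<le> r \<and> (AE y in lebesgue. y \<in> cball x r \<longrightarrow> V y \<le> u * V x)}. ennreal r)"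

definition I_fun :: "real \<Rightarrow> ('a::euclidean_space \<Rightarrow> real) \<Rightarrow> 'a \<Rightarrow> ennreal" where
  "I_fun b V x = (\<integral>\<^sup>+s\<in>{1..max 1 (V x)}. ennreal (s powr (b - 1)) *
    exp_neg ((rho V x s)\<^sup>2 / ennreal (4 * real DIM('a))) \<partial>lborel)"

definition K_fun :: "real \<Rightarrow> real \<Rightarrow> ('a::euclidean_space \<Rightarrow> real) \<Rightarrow> 'a \<Rightarrow> ennreal" where
  "K_fun c a V x = ennreal (min 1 (V x powr a)) *
    (\<integral>\<^sup>+s\<in>{1..}. exp_neg (ennreal c * sigma_rad V x s) * ennreal (s powr (a - 1)) \<partial>lborel)"

end

theory Submission
  imports Defs
begin

text \<open>Since the semigroup is symmetric, \<open>R\<^sub>V\<^sup>a\<close> is bounded on \<open>L\<^sup>1\<close> as soon as \<open>L\<^sup>-\<^sup>a(V\<^sup>a)\<close>, that is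
  \<open>1/\<Gamma>(a) \<integral> t\<^sup>a\<^sup>-\<^sup>1 e\<^sup>-\<^sup>t\<^sup>L(V\<^sup>a) dt\<close>, is essentially bounded. Symmetry and the Markov property both come from the
  uniqueness of the law of Brownian motion, applied to the time-reversed process and to the process
  restarted independently at a fixed time.

  For \<open>x\<close> in a compact set, the exponential growth of \<open>V\<close> is absorbed by the decay
  \<open>e\<^sup>-\<^sup>\<delta>\<^sup>t\<close> through Young's inequality and Gaussian exponential moments. Away from a compact set,
  write \<open>V(X\<^sub>t)\<^sup>a\<close> as an integral over level sets: \<open>V(x + X\<^sub>t) > s w\<close> forces \<open>X\<^sub>t\<close> to leave
  the ball on which \<open>V \<le> s w\<close>, so with \<open>\<theta> = (a + b)/(2b)\<close> this event contributes at most
  \<open>(e\<^sup>-\<^sup>t\<^sup>L1)\<^sup>\<theta> P(\<bar>X\<^sub>t\<bar> > r)\<^sup>1\<^sup>-\<^sup>\<theta>\<close>, and \<open>K\<close> controls the sum over \<open>s\<close>.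
  If \<open>V(x) \<le> 1\<close>, the decay of \<open>e\<^sup>-\<^sup>t\<^sup>L1\<close> finishes the argument. If \<open>V(x) > 1\<close>, Jensen's
  inequality and the bound on \<open>I\<^sup>b(V)(x)\<close> give \<open>e\<^sup>-\<^sup>t\<^sup>L1(x) \<lesssim> (t V(x))\<^sup>-\<^sup>b\<^sup>'\<close> for \<open>t \<le> 1\<close> and some
  \<open>b' < b\<close>, which compensates the factor \<open>V(x)\<^sup>a\<close>. If \<open>V(x) = 0\<close>, then \<open>K\<close> carries no
  information at \<open>x\<close> (it is \<open>0\<close>); one uses instead a point \<open>y\<close> at bounded distance with
  \<open>V(y) > 0\<close>, which exists by the exponential decay and at which \<open>V(y)\<close> is bounded because of \<open>I\<^sup>b(V)(y)\<close>.\<close>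

subsection \<open>Brownian motion on a time interval and uniqueness of its law\<close>

text \<open>The constant \<open>c\<close> comes from one inequality, \<open>c * r \<le> \<theta> *
  \<delta> * t / 2 + (1 - \<theta>) * r\<^sup>2 / (4 * t)\<close>: the Gaussian term pays if
  \<open>t \<le> r\<close>, the linear one if \<open>r < t\<close>. This asks for \<open>c\<close>
  below \<open>(1 - \<theta>) / 4\<close> and \<open>\<theta> * \<delta> / 2\<close>; with the
  chosen \<theta> the former is (b - a)/(8b) and the latter is at least \<delta>a/(4b). The same
  \<theta> has \<theta>b = (a + b)/2 > a, which leaves room for the loss from b to b' when a power
  of \<open>t * V x\<close> with exponent -\<theta>b' must be integrable against
  \<open>t powr (a - 1)\<close> at infinity. On compact sets the requirement is
  \<open>2 * (a * \<eta>)\<^sup>2 < \<delta>\<close>: the mean of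
  \<open>exp (2 * a * \<eta> * norm (X t))\<close> grows with rate
  \<open>2 * (a * \<eta>)\<^sup>2\<close>, and Young's inequality sets it against the decay rate
  \<delta>. Brownian motion is given by axioms on increments and paths only, so functionals of whole
  paths must be shown measurable, and determined by the law, before symmetry or the Markov property
  can be stated for them.\<close>

definition gauss_density :: "real \<Rightarrow> 'a::euclidean_space \<Rightarrow> real" where
  "gauss_density r z = (\<Prod>e\<in>Basis. normal_density 0 (sqrt r) (z \<bullet> e))"

definition heat :: "real \<Rightarrow> ('a::euclidean_space \<Rightarrow> ennreal) \<Rightarrow> 'a \<Rightarrow> ennreal" where
  "heat r h x = (\<integral>\<^sup>+z. ennreal (gauss_density r z) * h (x + z) \<partial>lborel)"

lemma gauss_density_nonneg: "0 \<le> gauss_density r z"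
  by (simp add: gauss_density_def prod_nonneg)

lemma gauss_density_minus: "gauss_density r (- z) = gauss_density r z"
  by (simp add: gauss_density_def normal_density_def)

lemma borel_measurable_gauss_density [measurable]: "gauss_density r \<in> borel_measurable borel"
  unfolding gauss_density_def by measurable

lemma borel_measurable_heat [measurable]:
  assumes [measurable]: "h \<in> borel_measurable borel"
  shows "heat r h \<in> borel_measurable borel"
  unfolding heat_def by measurable

text \<open>A finite horizon \<open>T\<close> is built in because time reversal makes sense only on
  \<open>{0..T}\<close>. Path continuity is left out: the law on the product sigma-algebra is
  determined by the start and the increments, and continuity enters later, for functionals of the
  whole path.\<close>

locale brownian_until = prob_space M
  for M :: "'w measure" +
  fixes Y :: "real \<Rightarrow> 'w \<Rightarrow> 'a::euclidean_space" and T :: real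
  assumes T_nonneg: "0 \<le> T"
    and measurable_Y: "\<And>t. 0 \<le> t \<Longrightarrow> t \<le> T \<Longrightarrow> random_variable borel (Y t)"
    and start_Y: "\<And>\<omega>. \<omega> \<in> space M \<Longrightarrow> Y 0 \<omega> = 0"
    and increments_indep_Y: "\<And>t n. 0 \<le> t 0 \<Longrightarrow> (\<And>i. i < n \<Longrightarrow> t i < t (Suc i)) \<Longrightarrow> t n \<le> T \<Longrightarrow>
      indep_vars (\<lambda>_. borel) (\<lambda>i \<omega>. Y (t (Suc i)) \<omega> - Y (t i) \<omega>) {..<n}"
    and increments_normal_Y: "\<And>s t. 0 \<le> s \<Longrightarrow> s < t \<Longrightarrow> t \<le> T \<Longrightarrow>
      distributed M lborel (\<lambda>\<omega>. Y t \<omega> - Y s \<omega>) (\<lambda>z. ennreal (gauss_density (t - s) z))"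

lemma (in brownian_motion) brownian_until: "0 \<le> T \<Longrightarrow> brownian_until M X T"
  by unfold_locales
    (auto simp: measurable_X start_X gauss_density_def intro!: increments_indep increments_normal)

text \<open>The positions up to time \<open>s\<close> are sums of increments over a grid ending at
  \<open>s\<close>, and the increment from \<open>s\<close> to \<open>t\<close> is independent of
  these; integrating it against its Gaussian density turns \<open>g\<close> into
  \<open>heat (t - s) g\<close>.\<close>

lemma (in brownian_until) nn_integral_peel_last:
  fixes h :: "real \<Rightarrow> 'a \<Rightarrow> ennreal"
  assumes J: "finite J" "J \<subseteq> {0..s}" and s: "0 \<le> s" "s < t" "t \<le> T"
    and h: "\<And>j. j \<in> J \<Longrightarrow> h j \<in> borel_measurable borel"
    and g [measurable]: "g \<in> borel_measurable borel"
  shows "(\<integral>\<^sup>+\<omega>. (\<Prod>j\<in>J. h j (Y j \<omega>)) * g (Y t \<omega>) \<partial>M)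
    = (\<integral>\<^sup>+\<omega>. (\<Prod>j\<in>J. h j (Y j \<omega>)) * heat (t - s) g (Y s \<omega>) \<partial>M)"
proof -
  \<comment> \<open>\<open>0\<close> is inserted so that the increments telescope from
    \<open>Y 0 = 0\<close>, and \<open>s\<close> so that the grid ends there:
    \<open>J \<subseteq> {0..s}\<close> makes \<open>s\<close> its last entry, and the next
    increment runs exactly from \<open>s\<close> to \<open>t\<close>.\<close>
  define L where "L = sorted_list_of_set (insert 0 (insert s J))"
  define n where "n = length L - 1"
  define u where "u i = (if i \<le> n then L ! i else t)" for i
  define D where "D i \<omega> = Y (u (Suc i)) \<omega> - Y (u i) \<omega>" for i \<omega>
  have setL: "set L = insert 0 (insert s J)" unfolding L_def using J by (intro set_sorted_list_of_set) auto
  have srt: "sorted_wrt (<) L" unfolding L_def by (simp add: strict_sorted_iff)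
  have ne: "L \<noteq> []" using setL by auto
  have len: "length L = Suc n" unfolding n_def using ne by (cases L) auto
  have mono: "i < j \<Longrightarrow> j \<le> n \<Longrightarrow> L ! i < L ! j" for i j
    using srt len by (simp add: sorted_wrt_iff_nth_less)
  have memL: "i \<le> n \<Longrightarrow> L ! i \<in> insert 0 (insert s J)" for i
    using len setL[symmetric] by simp
  have L0: "L ! 0 = 0"
  proof -
    obtain i where i: "i \<le> n" "L ! i = 0" using setL len by (metis in_set_conv_nth insertI1 less_Suc_eq_le)
    have "L ! 0 \<ge> 0" using memL[of 0] J s by auto
    then show ?thesis using i mono[of 0 i] by (cases i) auto
  qed
  have Ln: "L ! n = s"
  proof -
    obtain i where i: "i \<le> n" "L ! i = s"
      using setL len by (metis in_set_conv_nth insertI1 insertI2 less_Suc_eq_le)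
    have "L ! n \<le> s" using memL[of n] J s by auto
    then show ?thesis using i mono[of i n] by (cases "i = n") auto
  qed
  have u0: "u 0 = 0" and un: "u n = s" and uS: "u (Suc n) = t" by (simp_all add: u_def L0 Ln)
  have umono: "u i < u (Suc i)" if "i < Suc n" for i
    using that mono[of i "Suc i"] Ln s by (cases "i = n") (auto simp: u_def)
  have ubd: "0 \<le> u i \<and> u i \<le> T" if "i \<le> Suc n" for i
    using that memL[of i] J(2) s by (cases "i = Suc n") (auto simp: u_def)
  have mY [measurable]: "random_variable borel (Y (u i))" if "i \<le> Suc n" for i
    using measurable_Y ubd that by blast
  have ind: "indep_vars (\<lambda>_. borel) D {..<Suc n}"
    unfolding D_def using umono u0 uS s by (intro increments_indep_Y) auto
  \<comment> \<open>The increments are grouped into two independent vectors: \<open>U\<close>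
    collects the first \<open>n\<close>, and \<open>E\<close> the last one, kept as a one-coordinate
    family because independence is obtained for restrictions to disjoint index sets.\<close>
  let ?P = "PiM {..<n} (\<lambda>_. borel :: 'a measure)"
  define U where "U \<omega> = restrict (\<lambda>i. D i \<omega>) {..<n}" for \<omega>
  let ?Q = "PiM {n} (\<lambda>_. borel :: 'a measure)"
  define E where "E \<omega> = restrict (\<lambda>i. D i \<omega>) {n}" for \<omega>
  have iv: "indep_var ?P U ?Q E"
    unfolding U_def E_def by (rule indep_var_restrict[OF ind]) auto
  have mU [measurable]: "U \<in> measurable M ?P" and mE [measurable]: "E \<in> measurable M ?Q"
    using iv by (auto dest: indep_var_rv1 indep_var_rv2)
  have mD [measurable]: "D n \<in> borel_measurable M"
    using ind by (simp add: indep_vars_def)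
  have En: "E \<omega> n = D n \<omega>" for \<omega> by (simp add: E_def)
  have joint: "distr M ?P U \<Otimes>\<^sub>M distr M ?Q E = distr M (?P \<Otimes>\<^sub>M ?Q) (\<lambda>\<omega>. (U \<omega>, E \<omega>))"
    using iv by (simp add: indep_var_distribution_eq)
  have tel: "Y (u k) \<omega> = (\<Sum>i<k. D i \<omega>)" if "\<omega> \<in> space M" for k \<omega>
    unfolding D_def using that by (simp add: sum_lessThan_telescope[of "\<lambda>i. Y (u i) \<omega>"] u0 start_Y)
  have telU: "Y (u k) \<omega> = (\<Sum>i<k. U \<omega> i)" if "\<omega> \<in> space M" "k \<le> n" for k \<omega>
    using that by (simp add: tel U_def)
  have "\<forall>j\<in>J. \<exists>k\<le>n. j = u k"
    using setL len unfolding u_def by (metis in_set_conv_nth insertI2 less_Suc_eq_le)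
  then obtain k where k: "\<And>j. j \<in> J \<Longrightarrow> k j \<le> n \<and> j = u (k j)" by metis
  define H where "H q = (\<Prod>j\<in>J. h j (\<Sum>i<k j. q i))" for q
  have mH [measurable]: "H \<in> borel_measurable ?P"
    unfolding H_def
  proof (intro borel_measurable_prod_ennreal)
    fix j assume j: "j \<in> J"
    have "(\<lambda>q. \<Sum>i<k j. q i) \<in> borel_measurable ?P"
      using k[OF j] by (intro borel_measurable_sum measurable_component_singleton) auto
    then show "(\<lambda>q. h j (\<Sum>i<k j. q i)) \<in> borel_measurable ?P"
      using h[OF j] by (rule measurable_compose)
  qed
  have HU: "H (U \<omega>) = (\<Prod>j\<in>J. h j (Y j \<omega>))" if "\<omega> \<in> space M" for \<omega>
    unfolding H_def
  proof (rule prod.cong[OF refl])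
    fix j assume "j \<in> J"
    with k[of j] telU[OF that, of "k j"] show "h j (\<Sum>i<k j. U \<omega> i) = h j (Y j \<omega>)" by simp
  qed
  have mS [measurable]: "(\<lambda>q. \<Sum>i<n. q i) \<in> borel_measurable ?P"
    by (intro borel_measurable_sum measurable_component_singleton) auto
  interpret E: prob_space "distr M ?Q E" by (rule prob_space_distr) simp
  have dens: "distr M lborel (D n) = density lborel (\<lambda>z. ennreal (gauss_density (t - s) z))"
    using increments_normal_Y[of s t] s
    by (simp add: D_def[abs_def] un uS distributed_distr_eq_density)
  have dD: "distr M borel (D n) = density lborel (\<lambda>z. ennreal (gauss_density (t - s) z))"
    by (subst dens[symmetric]) (rule distr_cong, auto)
  have "(\<integral>\<^sup>+\<omega>. (\<Prod>j\<in>J. h j (Y j \<omega>)) * g (Y t \<omega>) \<partial>M)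
      = (\<integral>\<^sup>+\<omega>. H (U \<omega>) * g ((\<Sum>i<n. U \<omega> i) + D n \<omega>) \<partial>M)"
  proof (rule nn_integral_cong)
    fix \<omega> assume \<omega>: "\<omega> \<in> space M"
    have "Y t \<omega> = (\<Sum>i<n. U \<omega> i) + D n \<omega>"
      using tel[OF \<omega>, of "Suc n"] by (simp add: uS U_def)
    then show "(\<Prod>j\<in>J. h j (Y j \<omega>)) * g (Y t \<omega>) = H (U \<omega>) * g ((\<Sum>i<n. U \<omega> i) + D n \<omega>)"
      by (simp add: HU \<omega>)
  qed
  also have "\<dots> = (\<integral>\<^sup>+p. H (fst p) * g ((\<Sum>i<n. fst p i) + snd p n) \<partial>distr M (?P \<Otimes>\<^sub>M ?Q) (\<lambda>\<omega>. (U \<omega>, E \<omega>)))"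
    by (subst nn_integral_distr) (auto simp: En)
  also have "\<dots> = (\<integral>\<^sup>+q. \<integral>\<^sup>+d. H q * g ((\<Sum>i<n. q i) + d n) \<partial>distr M ?Q E \<partial>distr M ?P U)"
    unfolding joint[symmetric] by (subst E.nn_integral_fst[symmetric]) auto
  also have "\<dots> = (\<integral>\<^sup>+q. \<integral>\<^sup>+z. H q * g ((\<Sum>i<n. q i) + z) \<partial>distr M borel (D n) \<partial>distr M ?P U)"
    by (simp add: nn_integral_distr En)
  also have "\<dots> = (\<integral>\<^sup>+q. H q * heat (t - s) g (\<Sum>i<n. q i) \<partial>distr M ?P U)"
    unfolding heat_def dD by (simp add: nn_integral_cmult nn_integral_density)
  also have "\<dots> = (\<integral>\<^sup>+\<omega>. H (U \<omega>) * heat (t - s) g (\<Sum>i<n. U \<omega> i) \<partial>M)"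
    by (subst nn_integral_distr) auto
  also have "\<dots> = (\<integral>\<^sup>+\<omega>. (\<Prod>j\<in>J. h j (Y j \<omega>)) * heat (t - s) g (Y s \<omega>) \<partial>M)"
    using HU telU[OF _ order_refl] by (intro nn_integral_cong) (simp add: un)
  finally show ?thesis .
qed

lemma (in brownian_until) nn_integral_start: "(\<integral>\<^sup>+\<omega>. g (Y 0 \<omega>) \<partial>M) = g 0"
proof -
  have "(\<integral>\<^sup>+\<omega>. g (Y 0 \<omega>) \<partial>M) = (\<integral>\<^sup>+\<omega>. g 0 \<partial>M)"
    by (intro nn_integral_cong) (simp add: start_Y)
  then show ?thesis by (simp add: emeasure_space_1)
qed

lemma (in brownian_until) nn_integral_marginal:
  assumes "0 < t" "t \<le> T" "g \<in> borel_measurable borel"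
  shows "(\<integral>\<^sup>+\<omega>. g (Y t \<omega>) \<partial>M) = heat t g 0"
  using nn_integral_peel_last[of "{}" 0 t "\<lambda>_. g" g] nn_integral_start[of "heat t g"] assms by simp

text \<open>Induction on the latest time. Peeling it off changes only the test function at the
  preceding time, which absorbs the heat factor; hence \<open>h\<close> is general in the induction.
  A single remaining time gives a value of \<open>heat\<close> at the origin, in which the process
  no longer occurs.\<close>

lemma nn_integral_fdd_unique:
  fixes h :: "real \<Rightarrow> 'a::euclidean_space \<Rightarrow> ennreal"
  assumes Y: "brownian_until M Y T" and Y': "brownian_until M' Y' T"
    and "finite J" "J \<subseteq> {0..T}" "\<And>j. h j \<in> borel_measurable borel"
  shows "(\<integral>\<^sup>+\<omega>. (\<Prod>j\<in>J. h j (Y j \<omega>)) \<partial>M) = (\<integral>\<^sup>+\<omega>. (\<Prod>j\<in>J. h j (Y' j \<omega>)) \<partial>M')"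
  using assms(3-)
proof (induction J arbitrary: h rule: finite_linorder_max_induct)
  case empty
  interpret A: brownian_until M Y T by fact
  interpret B: brownian_until M' Y' T by fact
  show ?case by (simp add: A.emeasure_space_1 B.emeasure_space_1)
next
  case (insert t J)
  interpret A: brownian_until M Y T by fact
  interpret B: brownian_until M' Y' T by fact
  note [measurable] = insert.prems(2)
  have tJ: "t \<notin> J" using insert.hyps by auto
  have bd: "0 \<le> t" "t \<le> T" "J \<subseteq> {0..T}" using insert.prems by auto
  show ?case
  proof (cases "J = {}")
    case True
    have "(\<integral>\<^sup>+\<omega>. h t (Y t \<omega>) \<partial>M) = (\<integral>\<^sup>+\<omega>. h t (Y' t \<omega>) \<partial>M')"
      using bd A.nn_integral_start[of "h 0"] B.nn_integral_start[of "h 0"]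
        A.nn_integral_marginal[of t "h t"] B.nn_integral_marginal[of t "h t"]
      by (cases "t = 0") auto
    then show ?thesis by (simp add: True)
  next
    case False
    define s where "s = Max J"
    have sJ: "s \<in> J" using False insert.hyps by (simp add: s_def)
    moreover from this have "0 \<le> s" using bd by auto
    ultimately have s: "s \<in> J" "J \<subseteq> {0..s}" "0 \<le> s" "s < t"
      using insert.hyps bd by (auto simp: s_def intro!: Max_ge)
    define h' where "h' = h(s := \<lambda>x. h s x * heat (t - s) (h t) x)"
    have h': "h' j \<in> borel_measurable borel" for j by (simp add: h'_def)
    have fold: "(\<Prod>j\<in>J. h j (y j)) * heat (t - s) (h t) (y s) = (\<Prod>j\<in>J. h' j (y j))" for y
    proof -
      have "(\<Prod>j\<in>J - {s}. h j (y j)) = (\<Prod>j\<in>J - {s}. h' j (y j))"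
        by (intro prod.cong) (auto simp: h'_def)
      then show ?thesis
        using insert.hyps s by (simp add: prod.remove[of J s] h'_def mult_ac)
    qed
    have "(\<integral>\<^sup>+\<omega>. (\<Prod>j\<in>insert t J. h j (Y j \<omega>)) \<partial>M) = (\<integral>\<^sup>+\<omega>. (\<Prod>j\<in>J. h j (Y j \<omega>)) * h t (Y t \<omega>) \<partial>M)"
      using insert.hyps tJ by (simp add: mult_ac)
    also have "\<dots> = (\<integral>\<^sup>+\<omega>. (\<Prod>j\<in>J. h' j (Y j \<omega>)) \<partial>M)"
      using A.nn_integral_peel_last[of J s t h "h t"] s bd insert.hyps fold[of "\<lambda>j. Y j \<omega>" for \<omega>] by simp
    also have "\<dots> = (\<integral>\<^sup>+\<omega>. (\<Prod>j\<in>J. h' j (Y' j \<omega>)) \<partial>M')"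
      by (rule insert.IH) (use bd h' in auto)
    also have "\<dots> = (\<integral>\<^sup>+\<omega>. (\<Prod>j\<in>J. h j (Y' j \<omega>)) * h t (Y' t \<omega>) \<partial>M')"
      using B.nn_integral_peel_last[of J s t h "h t"] s bd insert.hyps fold[of "\<lambda>j. Y' j \<omega>" for \<omega>] by simp
    also have "\<dots> = (\<integral>\<^sup>+\<omega>. (\<Prod>j\<in>insert t J. h j (Y' j \<omega>)) \<partial>M')"
      using insert.hyps tJ by (simp add: mult_ac)
    finally show ?thesis .
  qed
qed

text \<open>Finite-dimensional cylinders generate the product sigma-algebra and are closed under
  intersection, and the indicator of a cylinder is a product of functions of single coordinates, so
  equal expectations of such products suffice.\<close>

lemma distr_PiM_eqI:
  fixes Y :: "'i \<Rightarrow> 'w \<Rightarrow> 'a::topological_space" and Y' :: "'i \<Rightarrow> 'v \<Rightarrow> 'a"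
  assumes "prob_space M" and "prob_space M'"
    and Y: "\<And>t. t \<in> I \<Longrightarrow> Y t \<in> borel_measurable M"
    and Y': "\<And>t. t \<in> I \<Longrightarrow> Y' t \<in> borel_measurable M'"
    and eq: "\<And>J (h :: 'i \<Rightarrow> 'a \<Rightarrow> ennreal). finite J \<Longrightarrow> J \<subseteq> I \<Longrightarrow> (\<And>j. h j \<in> borel_measurable borel) \<Longrightarrow>
      (\<integral>\<^sup>+\<omega>. (\<Prod>j\<in>J. h j (Y j \<omega>)) \<partial>M) = (\<integral>\<^sup>+\<omega>. (\<Prod>j\<in>J. h j (Y' j \<omega>)) \<partial>M')"
  shows "distr M (PiM I (\<lambda>_. borel)) (\<lambda>\<omega>. \<lambda>t\<in>I. Y t \<omega>) = distr M' (PiM I (\<lambda>_. borel)) (\<lambda>\<omega>. \<lambda>t\<in>I. Y' t \<omega>)"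
    (is "distr M ?P ?y = distr M' ?P ?y'")
proof (rule measure_eqI_PiM_infinite)
  interpret A: prob_space M by fact
  interpret B: prob_space M' by fact
  have my: "?y \<in> measurable M ?P" by (intro measurable_restrict Y)
  have my': "?y' \<in> measurable M' ?P" by (intro measurable_restrict Y')
  show "finite_measure (distr M ?P ?y)"
    using A.prob_space_distr[OF my] by (rule prob_space.finite_measure)
  fix A :: "'i \<Rightarrow> 'a set" and J :: "'i set"
  assume J: "finite J" "J \<subseteq> I" and A: "\<And>i. i \<in> J \<Longrightarrow> A i \<in> sets borel"
  define h :: "'i \<Rightarrow> 'a \<Rightarrow> ennreal" where "h j = (if j \<in> J then indicator (A j) else (\<lambda>_. 0))" for j
  have hm: "h j \<in> borel_measurable borel" for j using A by (simp add: h_def)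
  let ?C = "prod_emb I (\<lambda>_. borel) J (Pi\<^sub>E J A)"
  have C: "?C \<in> sets ?P" using J A by (intro sets_PiM_I) auto
  have ind: "indicator ?C (\<lambda>t\<in>I. y t) = (\<Prod>j\<in>J. h j (y j))" for y
  proof -
    have "(\<lambda>t\<in>I. y t) \<in> ?C \<longleftrightarrow> (\<forall>j\<in>J. y j \<in> A j)"
      using J by (auto simp: prod_emb_def PiE_iff)
    moreover have "(\<Prod>j\<in>J. h j (y j)) = (if \<forall>j\<in>J. y j \<in> A j then 1 else 0)"
      using J by (auto simp: h_def indicator_def prod.neutral)
    ultimately show ?thesis by (simp add: indicator_def)
  qed
  have "emeasure (distr M ?P ?y) ?C = (\<integral>\<^sup>+q. indicator ?C q \<partial>distr M ?P ?y)"
    using C by simp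
  also have "\<dots> = (\<integral>\<^sup>+\<omega>. indicator ?C (?y \<omega>) \<partial>M)"
    using C by (intro nn_integral_distr my) auto
  also have "\<dots> = (\<integral>\<^sup>+\<omega>. indicator ?C (?y' \<omega>) \<partial>M')"
    unfolding ind by (rule eq[OF J hm])
  also have "\<dots> = (\<integral>\<^sup>+q. indicator ?C q \<partial>distr M' ?P ?y')"
    using C by (intro nn_integral_distr[symmetric] my') auto
  also have "\<dots> = emeasure (distr M' ?P ?y') ?C"
    using C by simp
  finally show "emeasure (distr M ?P ?y) ?C = emeasure (distr M' ?P ?y') ?C" .
qed (simp_all add: assms)

lemma brownian_until_law_unique:
  assumes "brownian_until M Y T" "brownian_until M' Y' T"
  shows "distr M (PiM {0..T} (\<lambda>_. borel)) (\<lambda>\<omega>. \<lambda>t\<in>{0..T}. Y t \<omega>)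
    = distr M' (PiM {0..T} (\<lambda>_. borel)) (\<lambda>\<omega>. \<lambda>t\<in>{0..T}. Y' t \<omega>)"
proof (rule distr_PiM_eqI)
  interpret A: brownian_until M Y T by fact
  interpret B: brownian_until M' Y' T by fact
  show "prob_space M" "prob_space M'" by unfold_locales
  show "Y t \<in> borel_measurable M" "Y' t \<in> borel_measurable M'" if "t \<in> {0..T}" for t
    using that A.measurable_Y B.measurable_Y by auto
qed (rule nn_integral_fdd_unique[OF assms], auto)

section \<open>Time reversal of Brownian motion\<close>

lemma (in prob_space) indep_vars_reindex:
  assumes "indep_vars M' X (f ` I)" and inj: "inj_on f I"
  shows "indep_vars (\<lambda>i. M' (f i)) (\<lambda>i. X (f i)) I"
  unfolding indep_vars_def2 indep_sets_def
proof (intro conjI ballI allI impI)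
  let ?F = "\<lambda>i. {X i -` A \<inter> space M |A. A \<in> sets (M' i)}"
  have X: "\<And>i. i \<in> I \<Longrightarrow> random_variable (M' (f i)) (X (f i))"
    and ind: "\<And>J A. J \<subseteq> f ` I \<Longrightarrow> J \<noteq> {} \<Longrightarrow> finite J \<Longrightarrow> A \<in> Pi J ?F \<Longrightarrow>
      prob (\<Inter>j\<in>J. A j) = (\<Prod>j\<in>J. prob (A j))"
    using assms(1) unfolding indep_vars_def2 indep_sets_def by auto
  show "random_variable (M' (f i)) (X (f i))" "?F (f i) \<subseteq> events" if "i \<in> I" for i
    using X[OF that] by (auto simp: measurable_sets)
  fix J A assume J: "J \<subseteq> I" "J \<noteq> {}" "finite J" and A: "A \<in> Pi J (\<lambda>i. ?F (f i))"
  let ?g = "inv_into I f"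
  have g: "?g (f j) = j" if "j \<in> J" for j using that J inj by auto
  have "prob (\<Inter>j\<in>f ` J. A (?g j)) = (\<Prod>j\<in>f ` J. prob (A (?g j)))"
  proof (rule ind)
    show "(\<lambda>j. A (?g j)) \<in> Pi (f ` J) ?F"
    proof
      fix i assume "i \<in> f ` J"
      then obtain j where "j \<in> J" "i = f j" by auto
      then show "A (?g i) \<in> ?F i" using A g[of j] by (auto simp: Pi_iff)
    qed
  qed (use J in auto)
  moreover have "(\<Prod>j\<in>f ` J. prob (A (?g j))) = (\<Prod>j\<in>J. prob (A j))"
    using inj_on_subset[OF inj J(1)] by (simp add: prod.reindex g cong: prod.cong)
  ultimately show "prob (\<Inter>j\<in>J. A j) = (\<Prod>j\<in>J. prob (A j))"
    by (simp add: g cong: INF_cong_simp)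
qed

text \<open>An increment of the reversed process is minus the increment of \<open>X\<close> over the
  reflected interval. Centred Gaussian densities are even, and reversing the order of the increments
  only relabels an independent family, which is what \<open>indep_vars_reindex\<close> serves
  for.\<close>

lemma (in brownian_motion) brownian_until_time_reversal:
  assumes T: "0 \<le> T"
  shows "brownian_until M (\<lambda>s \<omega>. X (T - s) \<omega> - X T \<omega>) T"
proof
  show "random_variable borel (\<lambda>\<omega>. X (T - t) \<omega> - X T \<omega>)" if "0 \<le> t" "t \<le> T" for t
    using that T measurable_X[of T] measurable_X[of "T - t"] by auto
  show "distributed M lborel (\<lambda>\<omega>. X (T - t) \<omega> - X T \<omega> - (X (T - s) \<omega> - X T \<omega>))
      (\<lambda>z. ennreal (gauss_density (t - s) z))" if st: "0 \<le> s" "s < t" "t \<le> T" for s t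
  proof -
    have d: "distributed M lborel (\<lambda>\<omega>. X (T - s) \<omega> - X (T - t) \<omega>) (\<lambda>z. ennreal (gauss_density (t - s) z))"
      using increments_normal[of "T - t" "T - s"] st by (simp add: gauss_density_def)
    have m [measurable]: "(\<lambda>\<omega>. X (T - s) \<omega> - X (T - t) \<omega>) \<in> borel_measurable M"
      using distributed_measurable[OF d] by simp
    have "distr M lborel (\<lambda>\<omega>. X (T - t) \<omega> - X (T - s) \<omega>)
        = distr (distr M lborel (\<lambda>\<omega>. X (T - s) \<omega> - X (T - t) \<omega>)) lborel uminus"
      by (subst distr_distr) (auto simp: comp_def)
    also have "\<dots> = distr (density lborel (\<lambda>z. ennreal (gauss_density (t - s) z))) lborel uminus"
      by (simp add: distributed_distr_eq_density[OF d])
    also have "\<dots> = density (distr lborel lborel uminus) (\<lambda>z. ennreal (gauss_density (t - s) z))"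
    proof (subst density_distr)
      show "distr (density lborel (\<lambda>z. ennreal (gauss_density (t - s) z))) lborel uminus =
        distr (density lborel (\<lambda>x. ennreal (gauss_density (t - s) (- x)))) lborel uminus"
        by (simp add: gauss_density_minus)
    qed auto
    also have "distr lborel lborel uminus = (lborel :: 'a measure)"
    proof -
      have "(distr lborel lborel uminus :: 'a measure) = distr lborel borel uminus"
        by (rule distr_cong) auto
      then show ?thesis
        using lborel_affine_euclidean[where c="\<lambda>_. -1" and t="0::'a"]
        by (simp add: sum_negf euclidean_representation density_1)
    qed
    finally show ?thesis
      using m by (auto simp: distributed_def gauss_density_nonneg
        intro!: measurable_compose[OF m, of uminus lborel, simplified])
  qed
  show "indep_vars (\<lambda>_. borel) (\<lambda>i \<omega>. X (T - t (Suc i)) \<omega> - X T \<omega> - (X (T - t i) \<omega> - X T \<omega>)) {..<n}"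
    if t: "0 \<le> t 0" "\<And>i. i < n \<Longrightarrow> t i < t (Suc i)" "t n \<le> T" for t :: "nat \<Rightarrow> real" and n
  proof -
    define u where "u i = T - t (n - i)" for i
    have "indep_vars (\<lambda>_. borel) (\<lambda>i \<omega>. X (u (Suc i)) \<omega> - X (u i) \<omega>) {..<n}"
    proof (rule increments_indep)
      show "\<forall>i<n. u i < u (Suc i)"
      proof safe
        fix i assume "i < n"
        then show "u i < u (Suc i)" using t(2)[of "n - Suc i"] by (simp add: u_def Suc_diff_Suc)
      qed
    qed (use t in \<open>simp add: u_def\<close>)
    then have "indep_vars (\<lambda>_. borel) (\<lambda>i \<omega>. X (u (Suc i)) \<omega> - X (u i) \<omega>) ((\<lambda>i. n - Suc i) ` {..<n})"
      by (rule indep_vars_subset) auto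
    then have "indep_vars (\<lambda>_. borel) (\<lambda>i \<omega>. X (u (Suc (n - Suc i))) \<omega> - X (u (n - Suc i)) \<omega>) {..<n}"
      by (rule indep_vars_reindex) (auto intro!: inj_onI)
    then have "indep_vars (\<lambda>_. borel) (\<lambda>i \<omega>. - (X (u (Suc (n - Suc i))) \<omega> - X (u (n - Suc i)) \<omega>)) {..<n}"
      by (rule indep_vars_compose2) auto
    then show ?thesis
      by (rule indep_vars_cong[THEN iffD1, rotated -1]) (auto simp: u_def Suc_diff_Suc)
  qed
qed (use T in auto)

subsection \<open>Functionals of the path and the Markov property\<close>

text \<open>Rounding is downwards so that the approximations of a time in \<open>{0..T}\<close>
  never leave \<open>{0..T}\<close>, not even near \<open>T\<close>, beyond which a path on
  \<open>{0..T}\<close> has no values.\<close>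

definition dyadic_floor :: "nat \<Rightarrow> real \<Rightarrow> real" where
  "dyadic_floor n s = of_int \<lfloor>2 ^ n * s\<rfloor> / 2 ^ n"

lemma dyadic_floor_le: "dyadic_floor n s \<le> s"
  by (simp add: dyadic_floor_def field_simps)

lemma dyadic_floor_nonneg: "0 \<le> s \<Longrightarrow> 0 \<le> dyadic_floor n s"
  by (simp add: dyadic_floor_def)

lemma dyadic_floor_tendsto: "(\<lambda>n. dyadic_floor n s) \<longlonglongrightarrow> s"
proof (rule tendsto_sandwich)
  show "\<forall>\<^sub>F n in sequentially. s - (1/2) ^ n \<le> dyadic_floor n s"
  proof (rule always_eventually, safe)
    fix n
    have "2 ^ n * s - 1 \<le> of_int \<lfloor>2 ^ n * s\<rfloor>" by linarith
    then have "(2 ^ n * s - 1) / 2 ^ n \<le> dyadic_floor n s"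
      unfolding dyadic_floor_def by (intro divide_right_mono) auto
    then show "s - (1/2) ^ n \<le> dyadic_floor n s" by (simp add: field_simps power_one_over)
  qed
  show "(\<lambda>n. s - (1/2) ^ n) \<longlonglongrightarrow> s"
    by (auto intro!: tendsto_eq_intros LIMSEQ_power_zero)
qed (use dyadic_floor_le in auto)

text \<open>A continuous path is recovered from its values at dyadic times, of which there are countably many;
  this makes evaluation at a variable time jointly measurable.\<close>

definition path_at :: "(real \<Rightarrow> 'a::t2_space) \<Rightarrow> real \<Rightarrow> 'a" where
  "path_at q s = lim (\<lambda>n. q (dyadic_floor n s))"

lemma path_at_eq:
  assumes "continuous_on {0..T} q" "0 \<le> s" "s \<le> T"
  shows "path_at q s = q s"
  unfolding path_at_def
proof (rule limI, rule continuous_on_tendsto_compose[OF assms(1)])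
  show "\<forall>\<^sub>F n in sequentially. dyadic_floor n s \<in> {0..T}"
    using assms dyadic_floor_le[of _ s] dyadic_floor_nonneg[of s]
    by (auto intro!: always_eventually intro: order_trans)
qed (use assms dyadic_floor_tendsto in auto)

text \<open>At a fixed dyadic level the rounded time takes countably many values, so the composed
  map is measurable piece by piece; the limit over the levels stays measurable, also where the
  sequence does not converge.\<close>

lemma borel_measurable_path_at:
  fixes Y :: "real \<Rightarrow> 'w \<Rightarrow> 'a::euclidean_space"
  assumes Y: "\<And>r. r \<in> I \<Longrightarrow> Y r \<in> borel_measurable N"
    and [measurable]: "\<tau> \<in> borel_measurable N"
    and I: "\<And>\<omega> n. \<omega> \<in> space N \<Longrightarrow> dyadic_floor n (\<tau> \<omega>) \<in> I"
  shows "(\<lambda>\<omega>. path_at (\<lambda>r. Y r \<omega>) (\<tau> \<omega>)) \<in> borel_measurable N"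
  unfolding path_at_def
proof (rule borel_measurable_lim_metric)
  fix n
  let ?D = "I \<inter> range (\<lambda>k::int. of_int k / 2 ^ n)"
  have c: "countable ?D" by auto
  have d [measurable]: "(\<lambda>\<omega>. dyadic_floor n (\<tau> \<omega>)) \<in> borel_measurable N"
    unfolding dyadic_floor_def by measurable
  have "(\<lambda>\<omega>. dyadic_floor n (\<tau> \<omega>)) \<in> measurable N (count_space ?D)"
    unfolding measurable_count_space_eq_countable[OF c]
  proof (intro conjI ballI)
    show "(\<lambda>\<omega>. dyadic_floor n (\<tau> \<omega>)) \<in> space N \<rightarrow> ?D"
      using I by (auto simp: dyadic_floor_def)
    show "(\<lambda>\<omega>. dyadic_floor n (\<tau> \<omega>)) -` {a} \<inter> space N \<in> sets N" for a
      by (rule measurable_sets[OF d]) auto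
  qed
  then show "(\<lambda>\<omega>. Y (dyadic_floor n (\<tau> \<omega>)) \<omega>) \<in> borel_measurable N"
    by (rule measurable_compose_countable'[rotated]) (use c Y in auto)
qed

lemma borel_measurable_exp_neg [measurable]: "exp_neg \<in> borel_measurable borel"
  unfolding exp_neg_def[abs_def] by measurable

lemma exp_neg_ennreal: "0 \<le> z \<Longrightarrow> exp_neg (ennreal z) = ennreal (exp (- z))"
  by (simp add: exp_neg_def)

lemma exp_neg_0 [simp]: "exp_neg 0 = 1"
  by (simp add: exp_neg_def)

lemma exp_neg_top [simp]: "exp_neg \<top> = 0"
  by (simp add: exp_neg_def)

lemma exp_neg_le_1: "exp_neg z \<le> 1"
  by (cases z) (simp_all add: exp_neg_ennreal)

lemma exp_neg_add: "exp_neg (y + z) = exp_neg y * exp_neg z"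
  by (cases y; cases z)
    (simp_all add: exp_neg_ennreal exp_diff exp_minus field_simps flip: ennreal_plus ennreal_mult)

lemma exp_neg_antimono: "y \<le> z \<Longrightarrow> exp_neg z \<le> exp_neg y"
  by (cases y; cases z) (simp_all add: exp_neg_ennreal top_unique)

text \<open>Equality of laws on the product sigma-algebra speaks only of functionals measurable
  there, while the occupation integral reads uncountably many times. It is therefore replaced by a
  version through \<open>path_at\<close>, which agrees with it along continuous paths.\<close>

lemma nn_integral_exp_neg_law:
  fixes Y :: "real \<Rightarrow> 'w \<Rightarrow> 'a::euclidean_space" and Y' :: "real \<Rightarrow> 'v \<Rightarrow> 'a"
  assumes law: "distr M (PiM {0..T} (\<lambda>_. borel)) (\<lambda>\<omega>. \<lambda>t\<in>{0..T}. Y t \<omega>)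
      = distr M' (PiM {0..T} (\<lambda>_. borel)) (\<lambda>\<omega>. \<lambda>t\<in>{0..T}. Y' t \<omega>)"
    and T: "0 \<le> T"
    and Y: "\<And>t. t \<in> {0..T} \<Longrightarrow> Y t \<in> borel_measurable M"
    and Y': "\<And>t. t \<in> {0..T} \<Longrightarrow> Y' t \<in> borel_measurable M'"
    and contY: "\<And>\<omega>. \<omega> \<in> space M \<Longrightarrow> continuous_on {0..T} (\<lambda>t. Y t \<omega>)"
    and contY': "\<And>\<omega>. \<omega> \<in> space M' \<Longrightarrow> continuous_on {0..T} (\<lambda>t. Y' t \<omega>)"
    and [measurable]: "v \<in> borel_measurable borel" "g \<in> borel_measurable borel"
  shows "(\<integral>\<^sup>+\<omega>. exp_neg (\<integral>\<^sup>+s\<in>{0..T}. v (Y s \<omega>) \<partial>lborel) * g (Y T \<omega>) \<partial>M)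
    = (\<integral>\<^sup>+\<omega>. exp_neg (\<integral>\<^sup>+s\<in>{0..T}. v (Y' s \<omega>) \<partial>lborel) * g (Y' T \<omega>) \<partial>M')"
proof -
  let ?P = "PiM {0..T} (\<lambda>_. borel :: 'a measure)"
  \<comment> \<open>The clamp \<open>max 0 (min T s)\<close> keeps the evaluated time in
    \<open>{0..T}\<close> for all real \<open>s\<close>; inside the interval it changes
    nothing.\<close>
  define G where "G q = exp_neg (\<integral>\<^sup>+s\<in>{0..T}. v (path_at q (max 0 (min T s))) \<partial>lborel) * g (q T)" for q
  have [measurable]: "(\<lambda>p. path_at (fst p) (max 0 (min T (snd p)))) \<in> borel_measurable (?P \<Otimes>\<^sub>M lborel)"
  proof (rule borel_measurable_path_at)
    fix p :: "(real \<Rightarrow> 'a) \<times> real" and n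
    show "dyadic_floor n (max 0 (min T (snd p))) \<in> {0..T}"
      using dyadic_floor_le[of n "max 0 (min T (snd p))"] dyadic_floor_nonneg[of "max 0 (min T (snd p))" n] T
      by auto
  next
    fix t assume "t \<in> {0..T}"
    then show "(\<lambda>p. fst p t) \<in> borel_measurable (?P \<Otimes>\<^sub>M lborel)" by measurable
  qed measurable
  have [measurable]: "(\<lambda>q. q T) \<in> borel_measurable ?P"
    using T by (intro measurable_component_singleton) auto
  have G [measurable]: "G \<in> borel_measurable ?P"
    unfolding G_def by measurable
  have Gq: "G (\<lambda>t\<in>{0..T}. y t) = exp_neg (\<integral>\<^sup>+s\<in>{0..T}. v (y s) \<partial>lborel) * g (y T)"
    if "continuous_on {0..T} y" for y
  proof -
    have "continuous_on {0..T} (\<lambda>t\<in>{0..T}. y t)"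
      using that by (subst continuous_on_cong[OF refl, where g=y]) auto
    then have *: "path_at (\<lambda>t\<in>{0..T}. y t) s = y s" if "s \<in> {0..T}" for s
      using that path_at_eq[of T "\<lambda>t\<in>{0..T}. y t" s] by auto
    have "(\<integral>\<^sup>+s\<in>{0..T}. v (path_at (\<lambda>t\<in>{0..T}. y t) (max 0 (min T s))) \<partial>lborel)
        = (\<integral>\<^sup>+s\<in>{0..T}. v (y s) \<partial>lborel)"
      by (rule nn_integral_cong) (auto simp: * indicator_def)
    then show ?thesis using T by (simp add: G_def)
  qed
  have "(\<integral>\<^sup>+\<omega>. exp_neg (\<integral>\<^sup>+s\<in>{0..T}. v (Y s \<omega>) \<partial>lborel) * g (Y T \<omega>) \<partial>M)
      = (\<integral>\<^sup>+\<omega>. G (\<lambda>t\<in>{0..T}. Y t \<omega>) \<partial>M)"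
    by (rule nn_integral_cong) (simp add: Gq contY)
  also have "\<dots> = (\<integral>\<^sup>+q. G q \<partial>distr M ?P (\<lambda>\<omega>. \<lambda>t\<in>{0..T}. Y t \<omega>))"
    by (intro nn_integral_distr[symmetric] measurable_restrict Y) (simp_all add: G)
  also have "\<dots> = (\<integral>\<^sup>+\<omega>. G (\<lambda>t\<in>{0..T}. Y' t \<omega>) \<partial>M')"
    unfolding law by (intro nn_integral_distr measurable_restrict Y') (simp_all add: G)
  also have "\<dots> = (\<integral>\<^sup>+\<omega>. exp_neg (\<integral>\<^sup>+s\<in>{0..T}. v (Y' s \<omega>) \<partial>lborel) * g (Y' T \<omega>) \<partial>M')"
    by (rule nn_integral_cong) (simp add: Gq contY')
  finally show ?thesis .
qed

lemma heat_translate: "heat r (\<lambda>x. h (y + x)) z = heat r h (y + z)"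
  by (simp add: heat_def add.assoc)

section \<open>Restarting the path at a fixed time with an independent copy\<close>

context brownian_motion
begin

lemma borel_measurable_X_at:
  assumes [measurable]: "\<tau> \<in> borel_measurable N" "\<phi> \<in> measurable N M"
    and \<tau>: "\<And>p. p \<in> space N \<Longrightarrow> 0 \<le> \<tau> p"
  shows "(\<lambda>p. X (\<tau> p) (\<phi> p)) \<in> borel_measurable N"
proof -
  have "(\<lambda>p. path_at (\<lambda>r. X r (\<phi> p)) (\<tau> p)) \<in> borel_measurable N"
    by (rule borel_measurable_path_at[where I="{0..}"])
      (use measurable_compose[OF assms(2) measurable_X] \<tau> dyadic_floor_nonneg in auto)
  then show ?thesis
  proof (rule measurable_cong[THEN iffD1, rotated])
    fix p assume p: "p \<in> space N"
    then have "continuous_on {0..\<tau> p} (\<lambda>r. X r (\<phi> p))"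
      by (intro continuous_on_subset[OF continuous_X[OF measurable_space[OF assms(2) p]]]) auto
    from path_at_eq[OF this] show "path_at (\<lambda>r. X r (\<phi> p)) (\<tau> p) = X (\<tau> p) (\<phi> p)"
      using \<tau>[OF p] by simp
  qed
qed

text \<open>This is the Markov property at time \<open>r\<close> for finitely many times. The latest
  time of \<open>K\<close> is peeled off on both sides: on the left from \<open>X\<close>, on the
  right from the independent copy that starts at \<open>X r\<close>. As \<open>heat\<close> commutes
  with translations, both peelings produce the same factor.\<close>

lemma nn_integral_fdd_split:
  fixes h :: "real \<Rightarrow> 'a \<Rightarrow> ennreal"
  assumes J: "finite J" "J \<subseteq> {0..r}" "r \<in> J"
    and K: "finite K" "K \<subseteq> {r<..}" and h: "\<And>j. h j \<in> borel_measurable borel"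
  shows "(\<integral>\<^sup>+\<omega>. (\<Prod>j\<in>J. h j (X j \<omega>)) * (\<Prod>j\<in>K. h j (X j \<omega>)) \<partial>M)
    = (\<integral>\<^sup>+\<omega>. (\<Prod>j\<in>J. h j (X j \<omega>)) * (\<integral>\<^sup>+\<omega>'. (\<Prod>j\<in>K. h j (X r \<omega> + X (j - r) \<omega>')) \<partial>M) \<partial>M)"
  using K h
proof (induction K arbitrary: h rule: finite_linorder_max_induct)
  case empty
  show ?case by (simp add: emeasure_space_1)
next
  case (insert t K)
  note [measurable] = insert.prems(2)
  have r: "0 \<le> r" "r < t" "t \<notin> K" "0 \<le> t" using J insert.hyps insert.prems by auto
  have disj: "J \<inter> K = {}" using J insert.prems by force
  \<comment> \<open>The preceding time; it is \<open>r\<close> itself when \<open>K\<close> is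
    empty, and then the heat factor sits at the restarting point, where the copy is still at
    \<open>0\<close>.\<close>
  define s where "s = Max (insert r K)"
  have s: "s \<in> insert r K" unfolding s_def using insert.hyps by (intro Max_in) auto
  have sK: "insert r K \<subseteq> {r..s}"
    using insert.hyps insert.prems by (auto simp: s_def)
  have st: "r \<le> s" "s < t" "0 \<le> s" using s sK r insert.hyps by auto
  have JK: "J \<union> K \<subseteq> {0..s}" using J sK st by force
  have inner: "(\<integral>\<^sup>+\<omega>. (\<Prod>j\<in>K. h j (y + X (j - r) \<omega>)) * h t (y + X (t - r) \<omega>) \<partial>M)
      = (\<integral>\<^sup>+\<omega>. (\<Prod>j\<in>K. h j (y + X (j - r) \<omega>)) * heat (t - s) (h t) (y + X (s - r) \<omega>) \<partial>M)" for y
  proof -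
    interpret B: brownian_until M X "t - r" by (rule brownian_until) (use r in auto)
    have inj: "inj_on (\<lambda>j. j - r) K" by (auto intro: inj_onI)
    have "(\<integral>\<^sup>+\<omega>. (\<Prod>j\<in>(\<lambda>j. j - r) ` K. h (j + r) (y + X j \<omega>)) * h t (y + X (t - r) \<omega>) \<partial>M)
      = (\<integral>\<^sup>+\<omega>. (\<Prod>j\<in>(\<lambda>j. j - r) ` K. h (j + r) (y + X j \<omega>)) * heat ((t - r) - (s - r)) (\<lambda>x. h t (y + x)) (X (s - r) \<omega>) \<partial>M)"
      by (rule B.nn_integral_peel_last[where h="\<lambda>j x. h (j + r) (y + x)" and g="\<lambda>x. h t (y + x)"])
        (use insert.hyps st sK in \<open>auto\<close>)
    then show ?thesis by (simp add: prod.reindex[OF inj] heat_translate)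
  qed
  interpret B: brownian_until M X t by (rule brownian_until) (use r in auto)
  have "(\<integral>\<^sup>+\<omega>. (\<Prod>j\<in>J. h j (X j \<omega>)) * (\<Prod>j\<in>insert t K. h j (X j \<omega>)) \<partial>M)
      = (\<integral>\<^sup>+\<omega>. (\<Prod>j\<in>J \<union> K. h j (X j \<omega>)) * h t (X t \<omega>) \<partial>M)"
    using insert.hyps r J disj by (simp add: prod.union_disjoint mult_ac)
  also have "\<dots> = (\<integral>\<^sup>+\<omega>. (\<Prod>j\<in>J \<union> K. h j (X j \<omega>)) * heat (t - s) (h t) (X s \<omega>) \<partial>M)"
    by (rule B.nn_integral_peel_last) (use insert.hyps J JK st in auto)
  also have "\<dots> = (\<integral>\<^sup>+\<omega>. (\<Prod>j\<in>J. h j (X j \<omega>)) *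
      (\<integral>\<^sup>+\<omega>'. (\<Prod>j\<in>K. h j (X r \<omega> + X (j - r) \<omega>')) * heat (t - s) (h t) (X r \<omega> + X (s - r) \<omega>') \<partial>M) \<partial>M)"
  proof (cases "K = {}")
    case True
    have "(\<integral>\<^sup>+\<omega>'. heat (t - r) (h t) (x + X 0 \<omega>') \<partial>M) = (\<integral>\<^sup>+\<omega>'. heat (t - r) (h t) x \<partial>M)" for x
      by (intro nn_integral_cong) (simp add: start_X)
    then show ?thesis using True s by (simp add: emeasure_space_1)
  next
    case False
    have sK': "s \<in> K"
      using False sK s insert.prems insert.hyps by (metis Max_ge Max_in atLeastAtMost_iff finite_insert greaterThan_iff insert_iff less_le_not_le s_def subset_iff ex_in_conv)
    have sJ: "s \<notin> J" using disj sK' by auto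
    define h' where "h' = h(s := \<lambda>x. h s x * heat (t - s) (h t) x)"
    have h': "h' j \<in> borel_measurable borel" for j by (simp add: h'_def)
    have fold: "(\<Prod>j\<in>K. h j (y j)) * heat (t - s) (h t) (y s) = (\<Prod>j\<in>K. h' j (y j))" for y
    proof -
      have "(\<Prod>j\<in>K - {s}. h j (y j)) = (\<Prod>j\<in>K - {s}. h' j (y j))"
        by (intro prod.cong) (auto simp: h'_def)
      then show ?thesis
        using insert.hyps sK' by (simp add: prod.remove[of K s] h'_def mult_ac)
    qed
    have hJ: "(\<Prod>j\<in>J. h j (y j)) = (\<Prod>j\<in>J. h' j (y j))" for y
      using sJ by (intro prod.cong) (auto simp: h'_def)
    have "(\<integral>\<^sup>+\<omega>. (\<Prod>j\<in>J \<union> K. h j (X j \<omega>)) * heat (t - s) (h t) (X s \<omega>) \<partial>M)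
        = (\<integral>\<^sup>+\<omega>. (\<Prod>j\<in>J. h' j (X j \<omega>)) * (\<Prod>j\<in>K. h' j (X j \<omega>)) \<partial>M)"
      using insert.hyps J disj
      by (simp add: prod.union_disjoint mult.assoc fold[of "\<lambda>j. X j \<omega>" for \<omega>] hJ[of "\<lambda>j. X j \<omega>" for \<omega>])
    also have "\<dots> = (\<integral>\<^sup>+\<omega>. (\<Prod>j\<in>J. h' j (X j \<omega>)) * (\<integral>\<^sup>+\<omega>'. (\<Prod>j\<in>K. h' j (X r \<omega> + X (j - r) \<omega>')) \<partial>M) \<partial>M)"
      by (rule insert.IH) (use insert.prems h' in auto)
    finally show ?thesis
      by (simp add: fold[of "\<lambda>j. x + X (j - r) \<omega>" for x \<omega>] hJ[of "\<lambda>j. X j \<omega>" for \<omega>])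
  qed
  also have "\<dots> = (\<integral>\<^sup>+\<omega>. (\<Prod>j\<in>J. h j (X j \<omega>)) *
      (\<integral>\<^sup>+\<omega>'. (\<Prod>j\<in>insert t K. h j (X r \<omega> + X (j - r) \<omega>')) \<partial>M) \<partial>M)"
    using insert.hyps r by (simp add: inner[symmetric] mult.commute)
  finally show ?case .
qed

definition restart :: "real \<Rightarrow> real \<Rightarrow> 'w \<times> 'w \<Rightarrow> 'a" where
  "restart r s p = (if s \<le> r then X s (fst p) else X r (fst p) + X (s - r) (snd p))"

lemma borel_measurable_restart:
  assumes "0 \<le> r" "0 \<le> s"
  shows "restart r s \<in> borel_measurable (M \<Otimes>\<^sub>M M)"
proof -
  note [measurable] = measurable_X[OF assms(1)] measurable_X[OF assms(2)]
  have [measurable]: "s > r \<Longrightarrow> X (s - r) \<in> borel_measurable M" by (rule measurable_X) simp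
  show ?thesis unfolding restart_def[abs_def] by (cases "s \<le> r") simp_all
qed

lemma restart_law:
  assumes r: "0 \<le> r"
  shows "distr M (PiM {0..T} (\<lambda>_. borel)) (\<lambda>\<omega>. \<lambda>t\<in>{0..T}. X t \<omega>)
    = distr (M \<Otimes>\<^sub>M M) (PiM {0..T} (\<lambda>_. borel)) (\<lambda>p. \<lambda>t\<in>{0..T}. restart r t p)"
proof (rule distr_PiM_eqI)
  interpret PP: pair_prob_space M M ..
  show "prob_space M" "prob_space (M \<Otimes>\<^sub>M M)" by unfold_locales
  show "X t \<in> borel_measurable M" "restart r t \<in> borel_measurable (M \<Otimes>\<^sub>M M)" if "t \<in> {0..T}" for t
    using that measurable_X borel_measurable_restart[OF r] by auto
  fix J and h :: "real \<Rightarrow> 'a \<Rightarrow> ennreal"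
  assume J: "finite J" "J \<subseteq> {0..T}" and h [measurable]: "\<And>j. h j \<in> borel_measurable borel"
  \<comment> \<open>The split requires \<open>r\<close> among the earlier times; the factor
    \<open>1\<close> that \<open>h'\<close> puts at times outside \<open>J\<close> makes its
    insertion harmless.\<close>
  define J0 where "J0 = insert r (J \<inter> {0..r})"
  define K where "K = J \<inter> {r<..}"
  define h' where "h' j = (if j \<in> J then h j else (\<lambda>_. 1))" for j
  have h' [measurable]: "h' j \<in> borel_measurable borel" for j by (simp add: h'_def)
  have fin: "finite J0" "finite K" using J by (auto simp: J0_def K_def)
  have split: "(\<Prod>j\<in>J. h j (y j)) = (\<Prod>j\<in>J0. h' j (y j)) * (\<Prod>j\<in>K. h' j (y j))" for y
  proof -
    have "(\<Prod>j\<in>J. h j (y j)) = (\<Prod>j\<in>J. h' j (y j))" by (simp add: h'_def)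
    also have "\<dots> = (\<Prod>j\<in>J0 \<union> K. h' j (y j))"
      by (rule prod.mono_neutral_left) (use fin J r in \<open>auto simp: J0_def K_def h'_def\<close>)
    also have "\<dots> = (\<Prod>j\<in>J0. h' j (y j)) * (\<Prod>j\<in>K. h' j (y j))"
      by (rule prod.union_disjoint) (use fin in \<open>auto simp: J0_def K_def\<close>)
    finally show ?thesis .
  qed
  have [measurable]: "j \<in> J0 \<Longrightarrow> X j \<in> borel_measurable M" for j
    using r by (auto simp: J0_def intro!: measurable_X)
  have [measurable]: "X r \<in> borel_measurable M" using r by (rule measurable_X)
  have [measurable]: "j \<in> K \<Longrightarrow> X (j - r) \<in> borel_measurable M" for j
    by (auto simp: K_def intro!: measurable_X)
  have "(\<integral>\<^sup>+\<omega>. (\<Prod>j\<in>J. h j (X j \<omega>)) \<partial>M)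
      = (\<integral>\<^sup>+\<omega>. (\<Prod>j\<in>J0. h' j (X j \<omega>)) * (\<integral>\<^sup>+\<omega>'. (\<Prod>j\<in>K. h' j (X r \<omega> + X (j - r) \<omega>')) \<partial>M) \<partial>M)"
    unfolding split[of "\<lambda>j. X j \<omega>" for \<omega>]
    by (rule nn_integral_fdd_split) (use fin r h' in \<open>auto simp: J0_def K_def\<close>)
  also have "\<dots> = (\<integral>\<^sup>+\<omega>. \<integral>\<^sup>+\<omega>'. (\<Prod>j\<in>J0. h' j (X j \<omega>)) * (\<Prod>j\<in>K. h' j (X r \<omega> + X (j - r) \<omega>')) \<partial>M \<partial>M)"
    by (intro nn_integral_cong nn_integral_cmult[symmetric]) measurable
  also have "\<dots> = (\<integral>\<^sup>+\<omega>. \<integral>\<^sup>+\<omega>'. (\<Prod>j\<in>J. h j (restart r j (\<omega>, \<omega>'))) \<partial>M \<partial>M)"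
  proof (intro nn_integral_cong)
    fix \<omega> \<omega>'
    have "(\<Prod>j\<in>J0. h' j (X j \<omega>)) = (\<Prod>j\<in>J0. h' j (restart r j (\<omega>, \<omega>')))"
      "(\<Prod>j\<in>K. h' j (X r \<omega> + X (j - r) \<omega>')) = (\<Prod>j\<in>K. h' j (restart r j (\<omega>, \<omega>')))"
      by (auto simp: J0_def K_def restart_def intro!: prod.cong)
    then show "(\<Prod>j\<in>J0. h' j (X j \<omega>)) * (\<Prod>j\<in>K. h' j (X r \<omega> + X (j - r) \<omega>'))
        = (\<Prod>j\<in>J. h j (restart r j (\<omega>, \<omega>')))"
      by (simp add: split)
  qed
  also have "\<dots> = (\<integral>\<^sup>+p. (\<Prod>j\<in>J. h j (restart r j p)) \<partial>(M \<Otimes>\<^sub>M M))"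
    using J borel_measurable_restart[OF r]
    by (intro nn_integral_fst borel_measurable_prod_ennreal measurable_compose[OF _ h]) auto
  finally show "(\<integral>\<^sup>+\<omega>. (\<Prod>j\<in>J. h j (X j \<omega>)) \<partial>M) = (\<integral>\<^sup>+p. (\<Prod>j\<in>J. h j (restart r j p)) \<partial>(M \<Otimes>\<^sub>M M))" .
qed

lemma continuous_on_restart:
  assumes "0 \<le> r" "p \<in> space (M \<Otimes>\<^sub>M M)"
  shows "continuous_on {0..T} (\<lambda>s. restart r s p)"
proof -
  have p: "fst p \<in> space M" "snd p \<in> space M" using assms by (auto simp: space_pair_measure)
  have 1: "continuous_on {0..T} (\<lambda>s. X (max 0 (min r s)) (fst p))"
    by (rule continuous_on_compose2[OF continuous_X[OF p(1)]]) (auto intro!: continuous_intros)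
  have 2: "continuous_on {0..T} (\<lambda>s. X (max 0 (s - r)) (snd p))"
    by (rule continuous_on_compose2[OF continuous_X[OF p(2)]]) (auto intro!: continuous_intros)
  have "restart r s p = X (max 0 (min r s)) (fst p) + X (max 0 (s - r)) (snd p)" if "s \<in> {0..T}" for s
    using that assms(1) start_X[OF p(2)] by (auto simp: restart_def max_def min_def)
  then show ?thesis
    using continuous_on_add[OF 1 2] by (subst continuous_on_cong[OF refl]) auto
qed

end

subsection \<open>The Feynman--Kac semigroup\<close>

lemma nn_integral_lborel_translate:
  fixes f :: "'a::euclidean_space \<Rightarrow> ennreal"
  assumes [measurable]: "f \<in> borel_measurable borel"
  shows "(\<integral>\<^sup>+x. f (c + x) \<partial>lborel) = (\<integral>\<^sup>+x. f x \<partial>lborel)"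
proof -
  have "(\<integral>\<^sup>+x. f x \<partial>lborel) = (\<integral>\<^sup>+x. f x \<partial>distr lborel borel ((+) c))"
    by (simp add: lborel_distr_plus)
  also have "\<dots> = (\<integral>\<^sup>+x. f (c + x) \<partial>lborel)"
    by (rule nn_integral_distr) auto
  finally show ?thesis ..
qed

text \<open>Jensen's inequality for the uniform distribution on \<open>{0..t}\<close>: the mean of
  \<open>t * w\<close> there is the integral \<open>\<alpha>\<close> in the exponent. It is proved
  with the tangent of \<open>exp (- y)\<close> at \<open>y = \<alpha>\<close>, integrated over the
  interval.\<close>

lemma exp_neg_nn_integral_le:
  assumes [measurable]: "w \<in> borel_measurable lborel" and t: "0 < t"
  shows "ennreal t * exp_neg (\<integral>\<^sup>+s\<in>{0..t}. w s \<partial>lborel) \<le> (\<integral>\<^sup>+s\<in>{0..t}. exp_neg (ennreal t * w s) \<partial>lborel)"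
    (is "_ * exp_neg ?A \<le> ?R")
proof (cases ?A)
  case (real \<alpha>)
  have tangent: "ennreal (exp (- \<alpha>) * (1 + \<alpha>)) \<le> exp_neg z + ennreal (exp (- \<alpha>)) * z" for z
  proof (cases z)
    case (real y)
    have "exp (- \<alpha>) * (1 + (\<alpha> - y)) \<le> exp (- \<alpha>) * exp (\<alpha> - y)"
      by (intro mult_left_mono exp_ge_add_one_self) auto
    also have "\<dots> = exp (- y)" by (simp flip: exp_add)
    finally have "exp (- \<alpha>) * (1 + \<alpha>) \<le> exp (- y) + exp (- \<alpha>) * y" by (simp add: algebra_simps)
    then show ?thesis using real by (simp add: exp_neg_ennreal flip: ennreal_plus ennreal_mult)
  qed (simp add: ennreal_mult_top)
  have "(\<integral>\<^sup>+s\<in>{0..t}. ennreal (exp (- \<alpha>) * (1 + \<alpha>)) \<partial>lborel)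
      \<le> (\<integral>\<^sup>+s\<in>{0..t}. (exp_neg (ennreal t * w s) + ennreal (exp (- \<alpha>)) * (ennreal t * w s)) \<partial>lborel)"
    by (intro nn_integral_mono mult_right_mono tangent) auto
  also have "\<dots> = (\<integral>\<^sup>+s. exp_neg (ennreal t * w s) * indicator {0..t} s
        + ennreal (exp (- \<alpha>)) * (ennreal t * (w s * indicator {0..t} s)) \<partial>lborel)"
    by (intro nn_integral_cong) (simp split: split_indicator)
  also have "\<dots> = ?R + ennreal (exp (- \<alpha>)) * (ennreal t * ?A)"
    by (simp add: nn_integral_add nn_integral_cmult)
  finally have "ennreal (exp (- \<alpha>) * (1 + \<alpha>)) * ennreal t \<le> ?R + ennreal (exp (- \<alpha>)) * (ennreal t * ?A)"
    using t by (simp add: nn_integral_cmult_indicator)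
  moreover have "ennreal (exp (- \<alpha>) * (1 + \<alpha>)) * ennreal t
      = ennreal t * exp_neg ?A + ennreal (exp (- \<alpha>)) * (ennreal t * ?A)"
    unfolding real(2) using t real(1)
    by (simp add: exp_neg_ennreal algebra_simps flip: ennreal_plus ennreal_mult)
  ultimately have "ennreal (exp (- \<alpha>)) * (ennreal t * ?A) + ennreal t * exp_neg ?A
      \<le> ennreal (exp (- \<alpha>)) * (ennreal t * ?A) + ?R" by (simp add: add.commute)
  moreover have "ennreal (exp (- \<alpha>)) * (ennreal t * ?A) \<noteq> \<top>"
    using real by (simp add: ennreal_mult_eq_top_iff)
  ultimately show ?thesis by (simp add: ennreal_add_left_cancel_le)
qed simp

context brownian_motion
begin

text \<open>\<open>f\<close> takes values in \<open>ennreal\<close> so that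
  \<open>feynman_kac v u f\<close> can be inserted for it in the semigroup property.\<close>

definition feynman_kac :: "('a \<Rightarrow> ennreal) \<Rightarrow> real \<Rightarrow> ('a \<Rightarrow> ennreal) \<Rightarrow> 'a \<Rightarrow> ennreal" where
  "feynman_kac v t f x =
    (\<integral>\<^sup>+\<omega>. exp_neg (\<integral>\<^sup>+s\<in>{0..t}. v (x + X s \<omega>) \<partial>lborel) * f (x + X t \<omega>) \<partial>M)"

lemma schroedinger_semigroup_eq_feynman_kac:
  "schroedinger_semigroup M X V t f = feynman_kac (\<lambda>x. ennreal (V x)) t (\<lambda>x. ennreal (f x))"
  by (simp add: schroedinger_semigroup_def feynman_kac_def fun_eq_iff)

text \<open>Horizon, path and starting point may all depend on the parameter \<open>p\<close>; in
  the proof of symmetry the starting point is \<open>x - X T \<omega>\<close>.\<close>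

lemma borel_measurable_occupation:
  assumes [measurable]: "\<tau> \<in> borel_measurable N" "\<phi> \<in> measurable N M" "\<xi> \<in> borel_measurable N"
    "v \<in> borel_measurable borel"
  shows "(\<lambda>p. \<integral>\<^sup>+s\<in>{0..\<tau> p}. v (\<xi> p + X s (\<phi> p)) \<partial>lborel) \<in> borel_measurable N"
proof -
  have [measurable]: "(\<lambda>p. X (max 0 (snd p)) (\<phi> (fst p))) \<in> borel_measurable (N \<Otimes>\<^sub>M lborel)"
    by (rule borel_measurable_X_at) auto
  have "(\<lambda>p. \<integral>\<^sup>+s. (if 0 \<le> s \<and> s \<le> \<tau> p then v (\<xi> p + X (max 0 s) (\<phi> p)) else 0) \<partial>lborel) \<in> borel_measurable N"
    by measurable
  also have "(\<lambda>p. \<integral>\<^sup>+s. (if 0 \<le> s \<and> s \<le> \<tau> p then v (\<xi> p + X (max 0 s) (\<phi> p)) else 0) \<partial>lborel)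
      = (\<lambda>p. \<integral>\<^sup>+s\<in>{0..\<tau> p}. v (\<xi> p + X s (\<phi> p)) \<partial>lborel)"
    by (intro ext nn_integral_cong) (auto simp: indicator_def)
  finally show ?thesis .
qed

lemma borel_measurable_feynman_kac:
  assumes [measurable]: "\<tau> \<in> borel_measurable N" "\<xi> \<in> borel_measurable N"
    "v \<in> borel_measurable borel" "f \<in> borel_measurable borel"
    and \<tau>: "\<And>p. p \<in> space N \<Longrightarrow> 0 \<le> \<tau> p"
  shows "(\<lambda>p. feynman_kac v (\<tau> p) f (\<xi> p)) \<in> borel_measurable N"
proof -
  have [measurable]: "(\<lambda>p. X (\<tau> (fst p)) (snd p)) \<in> borel_measurable (N \<Otimes>\<^sub>M M)"
    by (rule borel_measurable_X_at) (auto simp: space_pair_measure \<tau>)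
  have [measurable]: "(\<lambda>p. \<integral>\<^sup>+s\<in>{0..\<tau> (fst p)}. v (\<xi> (fst p) + X s (snd p)) \<partial>lborel) \<in> borel_measurable (N \<Otimes>\<^sub>M M)"
    by (rule borel_measurable_occupation) auto
  have "(\<lambda>p. exp_neg (\<integral>\<^sup>+s\<in>{0..\<tau> (fst p)}. v (\<xi> (fst p) + X s (snd p)) \<partial>lborel) *
      f (\<xi> (fst p) + X (\<tau> (fst p)) (snd p))) \<in> borel_measurable (N \<Otimes>\<^sub>M M)"
    by measurable
  then show ?thesis
    unfolding feynman_kac_def by (intro borel_measurable_nn_integral) (simp add: split_beta')
qed

text \<open>For a fixed path, translating \<open>x\<close> by \<open>X T\<close> makes the endpoint
  the integration variable. Seen backwards from this endpoint the path is \<open>x\<close> plus the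
  reversed process \<open>?Y\<close>, whose law up to \<open>T\<close> is that of \<open>X\<close>;
  the occupation integral does not notice the direction of time.\<close>

lemma feynman_kac_symmetric:
  assumes T: "0 \<le> T" and [measurable]: "v \<in> borel_measurable borel"
    "f \<in> borel_measurable borel" "g \<in> borel_measurable borel"
  shows "(\<integral>\<^sup>+x. g x * feynman_kac v T f x \<partial>lborel) = (\<integral>\<^sup>+x. f x * feynman_kac v T g x \<partial>lborel)"
proof -
  interpret P: pair_sigma_finite "lborel :: 'a measure" M ..
  let ?Z = "\<lambda>x \<omega>. exp_neg (\<integral>\<^sup>+s\<in>{0..T}. v (x + X s \<omega>) \<partial>lborel)"
  let ?Y = "\<lambda>s \<omega>. X (T - s) \<omega> - X T \<omega>"
  have [measurable]: "X T \<in> borel_measurable M" using T by (rule measurable_X)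
  have [measurable]: "(\<lambda>p. \<integral>\<^sup>+s\<in>{0..T}. v (fst p + X s (snd p)) \<partial>lborel) \<in> borel_measurable (lborel \<Otimes>\<^sub>M M)"
    by (rule borel_measurable_occupation) auto
  have [measurable]: "(\<lambda>\<omega>. \<integral>\<^sup>+s\<in>{0..T}. v (x + X s \<omega>) \<partial>lborel) \<in> borel_measurable M" for x
    by (rule borel_measurable_occupation) auto
  have meas [measurable]: "(\<lambda>(x, \<omega>). g x * (?Z x \<omega> * f (x + X T \<omega>))) \<in> borel_measurable (lborel \<Otimes>\<^sub>M M)"
    unfolding split_beta' by measurable
  have meas' [measurable]: "(\<lambda>(x, \<omega>). f x * (?Z (x - X T \<omega>) \<omega> * g (x - X T \<omega>))) \<in> borel_measurable (lborel \<Otimes>\<^sub>M M)"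
  proof -
    have [measurable]: "(\<lambda>p. \<integral>\<^sup>+s\<in>{0..T}. v ((fst p - X T (snd p)) + X s (snd p)) \<partial>lborel) \<in> borel_measurable (lborel \<Otimes>\<^sub>M M)"
      by (rule borel_measurable_occupation) auto
    show ?thesis unfolding split_beta' by measurable
  qed
  have "(\<integral>\<^sup>+x. g x * feynman_kac v T f x \<partial>lborel) = (\<integral>\<^sup>+x. \<integral>\<^sup>+\<omega>. g x * (?Z x \<omega> * f (x + X T \<omega>)) \<partial>M \<partial>lborel)"
    unfolding feynman_kac_def by (intro nn_integral_cong nn_integral_cmult[symmetric]) measurable
  also have "\<dots> = (\<integral>\<^sup>+\<omega>. \<integral>\<^sup>+x. g x * (?Z x \<omega> * f (x + X T \<omega>)) \<partial>lborel \<partial>M)"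
    by (rule P.Fubini'[symmetric, OF meas])
  also have "\<dots> = (\<integral>\<^sup>+\<omega>. \<integral>\<^sup>+x. f x * (?Z (x - X T \<omega>) \<omega> * g (x - X T \<omega>)) \<partial>lborel \<partial>M)"
  proof (rule nn_integral_cong)
    fix \<omega> assume [measurable]: "\<omega> \<in> space M"
    have [measurable]: "(\<lambda>x. \<integral>\<^sup>+s\<in>{0..T}. v ((x - X T \<omega>) + X s \<omega>) \<partial>lborel) \<in> borel_measurable borel"
      by (rule borel_measurable_occupation) auto
    have m: "(\<lambda>x. f x * (?Z (x - X T \<omega>) \<omega> * g (x - X T \<omega>))) \<in> borel_measurable borel"
      by measurable
    show "(\<integral>\<^sup>+x. g x * (?Z x \<omega> * f (x + X T \<omega>)) \<partial>lborel) = (\<integral>\<^sup>+x. f x * (?Z (x - X T \<omega>) \<omega> * g (x - X T \<omega>)) \<partial>lborel)"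
      by (subst nn_integral_lborel_translate[OF m, of "X T \<omega>", symmetric])
        (auto intro!: nn_integral_cong simp: mult_ac add.commute)
  qed
  also have "\<dots> = (\<integral>\<^sup>+x. \<integral>\<^sup>+\<omega>. f x * (?Z (x - X T \<omega>) \<omega> * g (x - X T \<omega>)) \<partial>M \<partial>lborel)"
    by (rule P.Fubini'[OF meas'])
  also have "\<dots> = (\<integral>\<^sup>+x. f x * feynman_kac v T g x \<partial>lborel)"
  proof (rule nn_integral_cong)
    fix x
    \<comment> \<open>Substitution of \<open>T - s\<close> for \<open>s\<close> in the occupation
      integral. The new endpoint uses \<open>X 0 = 0\<close>, which gives
      \<open>?Y T = - X T\<close>.\<close>
    have Z: "?Z (x - X T \<omega>) \<omega> * g (x - X T \<omega>) = exp_neg (\<integral>\<^sup>+s\<in>{0..T}. v (x + ?Y s \<omega>) \<partial>lborel) * g (x + ?Y T \<omega>)"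
      if \<omega>: "\<omega> \<in> space M" for \<omega>
    proof -
      have [measurable]: "(\<lambda>s. X (max 0 s) \<omega>) \<in> borel_measurable borel"
        using \<omega> by (intro borel_measurable_X_at) auto
      have m: "(\<lambda>s. v (x - X T \<omega> + X s \<omega>) * indicator {0..T} s) \<in> borel_measurable borel"
        by (rule measurable_cong[THEN iffD1, of _ "\<lambda>s. v (x - X T \<omega> + X (max 0 s) \<omega>) * indicator {0..T} s"])
          (auto simp: indicator_def)
      have "(\<integral>\<^sup>+s\<in>{0..T}. v (x - X T \<omega> + X s \<omega>) \<partial>lborel) = (\<integral>\<^sup>+s\<in>{0..T}. v (x + ?Y s \<omega>) \<partial>lborel)"
        by (subst nn_integral_real_affine[OF m, of "-1" T])
          (auto intro!: nn_integral_cong simp: indicator_def algebra_simps)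
      then show ?thesis using start_X[OF \<omega>] by simp
    qed
    have "(\<integral>\<^sup>+\<omega>. f x * (?Z (x - X T \<omega>) \<omega> * g (x - X T \<omega>)) \<partial>M)
        = f x * (\<integral>\<^sup>+\<omega>. ?Z (x - X T \<omega>) \<omega> * g (x - X T \<omega>) \<partial>M)"
    proof (rule nn_integral_cmult)
      have [measurable]: "(\<lambda>\<omega>. \<integral>\<^sup>+s\<in>{0..T}. v ((x - X T \<omega>) + X s \<omega>) \<partial>lborel) \<in> borel_measurable M"
        by (rule borel_measurable_occupation) auto
      show "(\<lambda>\<omega>. ?Z (x - X T \<omega>) \<omega> * g (x - X T \<omega>)) \<in> borel_measurable M" by measurable
    qed
    also have "(\<integral>\<^sup>+\<omega>. ?Z (x - X T \<omega>) \<omega> * g (x - X T \<omega>) \<partial>M)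
        = (\<integral>\<^sup>+\<omega>. exp_neg (\<integral>\<^sup>+s\<in>{0..T}. v (x + ?Y s \<omega>) \<partial>lborel) * g (x + ?Y T \<omega>) \<partial>M)"
      by (rule nn_integral_cong) (rule Z)
    also have "\<dots> = feynman_kac v T g x"
      unfolding feynman_kac_def
    proof (rule nn_integral_exp_neg_law[where v="\<lambda>y. v (x + y)" and g="\<lambda>y. g (x + y)"])
      show "distr M (PiM {0..T} (\<lambda>_. borel)) (\<lambda>\<omega>. \<lambda>t\<in>{0..T}. ?Y t \<omega>)
          = distr M (PiM {0..T} (\<lambda>_. borel)) (\<lambda>\<omega>. \<lambda>t\<in>{0..T}. X t \<omega>)"
        by (rule brownian_until_law_unique[OF brownian_until_time_reversal[OF T] brownian_until[OF T]])
      show "continuous_on {0..T} (\<lambda>t. ?Y t \<omega>)" if "\<omega> \<in> space M" for \<omega>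
        by (intro continuous_intros continuous_on_compose2[OF continuous_X[OF that]]) auto
      show "continuous_on {0..T} (\<lambda>t. X t \<omega>)" if "\<omega> \<in> space M" for \<omega>
        by (rule continuous_on_subset[OF continuous_X[OF that]]) auto
      show "?Y t \<in> borel_measurable M" "X t \<in> borel_measurable M" if "t \<in> {0..T}" for t
        using that measurable_X[of t] measurable_X[of "T - t"] by auto
    qed (use T in auto)
    finally show "(\<integral>\<^sup>+\<omega>. f x * (?Z (x - X T \<omega>) \<omega> * g (x - X T \<omega>)) \<partial>M) = f x * feynman_kac v T g x" .
  qed
  finally show ?thesis .
qed

section \<open>Semigroup property\<close>

lemma occupation_restart:
  assumes r: "0 \<le> r" "0 \<le> u" and \<omega>: "\<omega> \<in> space M" "\<omega>' \<in> space M"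
    and [measurable]: "v \<in> borel_measurable borel"
  shows "(\<integral>\<^sup>+s\<in>{0..r + u}. v (restart r s (\<omega>, \<omega>')) \<partial>lborel)
    = (\<integral>\<^sup>+s\<in>{0..r}. v (X s \<omega>) \<partial>lborel) + (\<integral>\<^sup>+s\<in>{0..u}. v (X r \<omega> + X s \<omega>') \<partial>lborel)"
proof -
  let ?a = "\<lambda>s. v (X s \<omega>) * indicator {0..r} s"
  let ?b = "\<lambda>s. v (X r \<omega> + X (s - r) \<omega>') * indicator {r<..r + u} s"
  have mX [measurable]: "(\<lambda>s. X (max 0 s) \<omega>) \<in> borel_measurable borel" "(\<lambda>s. X (max 0 s) \<omega>') \<in> borel_measurable borel"
    using \<omega> by (auto intro!: borel_measurable_X_at)
  have a: "?a \<in> borel_measurable borel"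
    by (rule measurable_cong[THEN iffD1, of _ "\<lambda>s. v (X (max 0 s) \<omega>) * indicator {0..r} s"]) (auto simp: indicator_def)
  have b: "?b \<in> borel_measurable borel"
    by (rule measurable_cong[THEN iffD1, of _ "\<lambda>s. v (X r \<omega> + X (max 0 (s - r)) \<omega>') * indicator {r<..r + u} s"])
      (auto simp: indicator_def)
  have "(\<integral>\<^sup>+s\<in>{0..r + u}. v (restart r s (\<omega>, \<omega>')) \<partial>lborel) = (\<integral>\<^sup>+s. ?a s + ?b s \<partial>lborel)"
    using r by (intro nn_integral_cong) (auto simp: restart_def indicator_def)
  also have "\<dots> = (\<integral>\<^sup>+s. ?a s \<partial>lborel) + (\<integral>\<^sup>+s. ?b s \<partial>lborel)"
    using a b by (intro nn_integral_add) auto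
  also have "(\<integral>\<^sup>+s. ?b s \<partial>lborel) = (\<integral>\<^sup>+s. v (X r \<omega> + X s \<omega>') * indicator {0<..u} s \<partial>lborel)"
    by (subst nn_integral_real_affine[OF b, of 1 r]) (auto intro!: nn_integral_cong simp: indicator_def)
  also have "\<dots> = (\<integral>\<^sup>+s\<in>{0..u}. v (X r \<omega> + X s \<omega>') \<partial>lborel)"
    using AE_lborel_singleton[of "0::real"] by (intro nn_integral_cong_AE) (auto simp: indicator_def)
  finally show ?thesis .
qed

text \<open>Along the restarted path the occupation integral over \<open>{0..r + u}\<close> splits
  into one of the first path and one of the second, started at \<open>x + X r\<close>; integrating
  over the second path first leaves \<open>feynman_kac v u f\<close> at that point.\<close>

lemma feynman_kac_semigroup:
  assumes r: "0 \<le> r" "0 \<le> u" and [measurable]: "v \<in> borel_measurable borel" "f \<in> borel_measurable borel"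
  shows "feynman_kac v (r + u) f x = feynman_kac v r (feynman_kac v u f) x"
proof -
  interpret PP: pair_prob_space M M ..
  have [measurable]: "X r \<in> borel_measurable M" "X u \<in> borel_measurable M" using r by (auto intro: measurable_X)
  have [measurable]: "(\<lambda>p. \<integral>\<^sup>+s\<in>{0..u}. v (x + X r (fst p) + X s (snd p)) \<partial>lborel) \<in> borel_measurable (M \<Otimes>\<^sub>M M)"
    "(\<lambda>p. \<integral>\<^sup>+s\<in>{0..r}. v (x + X s (fst p)) \<partial>lborel) \<in> borel_measurable (M \<Otimes>\<^sub>M M)"
    by (rule borel_measurable_occupation; measurable)+
  have [measurable]: "(\<lambda>\<omega>'. \<integral>\<^sup>+s\<in>{0..u}. v (y + X s \<omega>') \<partial>lborel) \<in> borel_measurable M" for y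
    by (rule borel_measurable_occupation; measurable)
  let ?G = "\<lambda>p. exp_neg (\<integral>\<^sup>+s\<in>{0..r}. v (x + X s (fst p)) \<partial>lborel) *
    (exp_neg (\<integral>\<^sup>+s\<in>{0..u}. v (x + X r (fst p) + X s (snd p)) \<partial>lborel) * f (x + X r (fst p) + X u (snd p)))"
  have "feynman_kac v (r + u) f x
      = (\<integral>\<^sup>+p. exp_neg (\<integral>\<^sup>+s\<in>{0..r + u}. v (x + restart r s p) \<partial>lborel) * f (x + restart r (r + u) p) \<partial>(M \<Otimes>\<^sub>M M))"
    unfolding feynman_kac_def
  proof (rule nn_integral_exp_neg_law[where v="\<lambda>y. v (x + y)" and g="\<lambda>y. f (x + y)", OF restart_law[OF r(1)]])
    show "continuous_on {0..r + u} (\<lambda>t. X t \<omega>)" if "\<omega> \<in> space M" for \<omega>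
      using continuous_on_subset[OF continuous_X[OF that], of "{0..r + u}"] by auto
  qed (use r measurable_X borel_measurable_restart[OF r(1)] continuous_on_restart[OF r(1)] in auto)
  also have "\<dots> = (\<integral>\<^sup>+p. ?G p \<partial>(M \<Otimes>\<^sub>M M))"
  proof (rule nn_integral_cong)
    fix p assume "p \<in> space (M \<Otimes>\<^sub>M M)"
    then obtain \<omega> \<omega>' where p: "p = (\<omega>, \<omega>')" "\<omega> \<in> space M" "\<omega>' \<in> space M"
      by (auto simp: space_pair_measure)
    have "restart r (r + u) p = X r \<omega> + X u \<omega>'"
      \<comment> \<open>\<open>u = 0\<close> is separate because at time \<open>r\<close> the
        definition of \<open>restart\<close> still takes the first path.\<close>
      using p r start_X[of \<omega>'] by (cases "u = 0") (auto simp: restart_def)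
    then show "exp_neg (\<integral>\<^sup>+s\<in>{0..r + u}. v (x + restart r s p) \<partial>lborel) * f (x + restart r (r + u) p) = ?G p"
      using occupation_restart[OF r p(2,3), of "\<lambda>y. v (x + y)"] p(1)
      by (simp add: exp_neg_add mult.assoc add.assoc)
  qed
  also have "\<dots> = (\<integral>\<^sup>+\<omega>. \<integral>\<^sup>+\<omega>'. ?G (\<omega>, \<omega>') \<partial>M \<partial>M)"
    by (rule nn_integral_fst[symmetric]) measurable
  also have "\<dots> = feynman_kac v r (feynman_kac v u f) x"
    unfolding feynman_kac_def by (intro nn_integral_cong) (simp add: nn_integral_cmult)
  finally show ?thesis .
qed

end

subsection \<open>Gaussian estimates\<close>

text \<open>Tilting by \<open>exp (\<kappa> * z\<^sup>2 / (2 * t))\<close> changes the variance from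
  \<open>t\<close> to \<open>t / (1 - \<kappa>)\<close>, and the prefactor is the quotient of the
  normalising constants; Gaussian exponential moments are thereby reduced to a total mass.\<close>

lemma normal_density_times_exp:
  assumes "0 < t" "\<kappa> < 1"
  shows "normal_density 0 (sqrt t) z * exp (\<kappa> * z\<^sup>2 / (2 * t))
    = 1 / sqrt (1 - \<kappa>) * normal_density 0 (sqrt (t / (1 - \<kappa>))) z"
proof -
  have "exp (- z\<^sup>2 / (2 * t)) * exp (\<kappa> * z\<^sup>2 / (2 * t)) = exp (- z\<^sup>2 / (2 * (t / (1 - \<kappa>))))"
    using assms by (simp add: field_simps flip: exp_add)
  moreover have "sqrt (1 - \<kappa>) * sqrt (2 * pi * (t / (1 - \<kappa>))) = sqrt (2 * pi * t)"
    using assms by (simp flip: real_sqrt_mult)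
  ultimately show ?thesis
    using assms by (simp add: normal_density_def mult.assoc del: real_sqrt_mult)
qed

lemma gauss_density_times_exp:
  assumes "0 < t" "\<kappa> < 1"
  shows "gauss_density t (z :: 'a::euclidean_space) * exp (\<kappa> * (norm z)\<^sup>2 / (2 * t))
    = (1 / sqrt (1 - \<kappa>)) ^ DIM('a) * gauss_density (t / (1 - \<kappa>)) z"
proof -
  have "(norm z)\<^sup>2 = (\<Sum>e\<in>Basis. (z \<bullet> e)\<^sup>2)"
    unfolding power2_norm_eq_inner by (subst euclidean_inner) (simp add: power2_eq_square)
  then have "\<kappa> * (norm z)\<^sup>2 / (2 * t) = (\<Sum>e\<in>Basis. \<kappa> * (z \<bullet> e)\<^sup>2 / (2 * t))"
    by (simp add: sum_distrib_left sum_divide_distrib)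
  then have "exp (\<kappa> * (norm z)\<^sup>2 / (2 * t)) = (\<Prod>e\<in>Basis. exp (\<kappa> * (z \<bullet> e)\<^sup>2 / (2 * t)))"
    by (simp add: exp_sum)
  then have "gauss_density t z * exp (\<kappa> * (norm z)\<^sup>2 / (2 * t))
      = (\<Prod>e\<in>Basis. 1 / sqrt (1 - \<kappa>) * normal_density 0 (sqrt (t / (1 - \<kappa>))) (z \<bullet> e))"
    by (simp only: gauss_density_def prod.distrib[symmetric] normal_density_times_exp[OF assms])
  then show ?thesis by (simp only: prod.distrib gauss_density_def prod_constant)
qed

context brownian_motion
begin

lemma nn_integral_X:
  assumes "0 < t" and [measurable]: "h \<in> borel_measurable borel"
  shows "(\<integral>\<^sup>+\<omega>. h (X t \<omega>) \<partial>M) = (\<integral>\<^sup>+z. ennreal (gauss_density t z) * h z \<partial>lborel)"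
proof -
  interpret B: brownian_until M X t by (rule brownian_until) (use assms in auto)
  show ?thesis using B.nn_integral_marginal[of t h] assms by (simp add: heat_def)
qed

lemma nn_integral_gauss_density:
  assumes "0 < t"
  shows "(\<integral>\<^sup>+z. ennreal (gauss_density t (z :: 'a)) \<partial>lborel) = 1"
  using nn_integral_X[of t "\<lambda>_. 1"] assms by (simp add: emeasure_space_1)

lemma nn_integral_exp_norm_sq:
  assumes t: "0 < t" and \<kappa>: "\<kappa> < 1"
  shows "(\<integral>\<^sup>+\<omega>. ennreal (exp (\<kappa> * (norm (X t \<omega>))\<^sup>2 / (2 * t))) \<partial>M) = ennreal ((1 / sqrt (1 - \<kappa>)) ^ DIM('a))"
proof -
  have "(\<lambda>z :: 'a. ennreal (exp (\<kappa> * (norm z)\<^sup>2 / (2 * t)))) \<in> borel_measurable borel"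
    by measurable
  from nn_integral_X[OF t this]
  have "(\<integral>\<^sup>+\<omega>. ennreal (exp (\<kappa> * (norm (X t \<omega>))\<^sup>2 / (2 * t))) \<partial>M)
      = (\<integral>\<^sup>+(z::'a). ennreal (gauss_density t z) * ennreal (exp (\<kappa> * (norm z)\<^sup>2 / (2 * t))) \<partial>lborel)" .
  also have "\<dots> = (\<integral>\<^sup>+(z::'a). ennreal ((1 / sqrt (1 - \<kappa>)) ^ DIM('a)) * ennreal (gauss_density (t / (1 - \<kappa>)) z) \<partial>lborel)"
    by (intro nn_integral_cong) (simp add: gauss_density_times_exp[OF t \<kappa>] gauss_density_nonneg flip: ennreal_mult'')
  also have "\<dots> = ennreal ((1 / sqrt (1 - \<kappa>)) ^ DIM('a))"
    using nn_integral_gauss_density[of "t / (1 - \<kappa>)"] t \<kappa> by (simp add: nn_integral_cmult)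
  finally show ?thesis .
qed

text \<open>Chernoff's bound with the exponential moment for \<open>\<kappa> = 1/2\<close>, whose
  value is \<open>sqrt 2 ^ DIM('a)\<close>.\<close>

lemma tail_X:
  assumes t: "0 < t" and r: "0 \<le> r"
  shows "(\<integral>\<^sup>+\<omega>. indicator {r<..} (norm (X t \<omega>)) \<partial>M) \<le> ennreal (sqrt 2 ^ DIM('a) * exp (- r\<^sup>2 / (4 * t)))"
proof -
  have [measurable]: "X t \<in> borel_measurable M" using t by (intro measurable_X) auto
  have "(\<integral>\<^sup>+\<omega>. indicator {r<..} (norm (X t \<omega>)) \<partial>M)
      \<le> (\<integral>\<^sup>+\<omega>. ennreal (exp (- r\<^sup>2 / (4 * t))) * ennreal (exp ((1/2) * (norm (X t \<omega>))\<^sup>2 / (2 * t))) \<partial>M)"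
  proof (rule nn_integral_mono)
    fix \<omega>
    show "indicator {r<..} (norm (X t \<omega>)) \<le> ennreal (exp (- r\<^sup>2 / (4 * t))) * ennreal (exp ((1/2) * (norm (X t \<omega>))\<^sup>2 / (2 * t)))"
    proof (cases "r < norm (X t \<omega>)")
      case True
      then have "r\<^sup>2 \<le> (norm (X t \<omega>))\<^sup>2" using r by (intro power_mono) auto
      then have "1 \<le> exp (- r\<^sup>2 / (4 * t)) * exp ((1/2) * (norm (X t \<omega>))\<^sup>2 / (2 * t))"
        using t by (simp add: field_simps flip: exp_add)
      then show ?thesis using True by (simp flip: ennreal_mult)
    qed simp
  qed
  also have "\<dots> = ennreal (exp (- r\<^sup>2 / (4 * t))) * ennreal ((1 / sqrt (1 - 1/2)) ^ DIM('a))"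
    using nn_integral_exp_norm_sq[of t "1/2"] t by (subst nn_integral_cmult) auto
  also have "\<dots> = ennreal (sqrt 2 ^ DIM('a) * exp (- r\<^sup>2 / (4 * t)))"
    by (simp add: real_sqrt_divide mult.commute flip: ennreal_mult)
  finally show ?thesis .
qed

lemma AE_X_notin:
  assumes N: "N \<in> null_sets lborel" and t: "0 < t"
  shows "AE \<omega> in M. x + X t \<omega> \<notin> N"
proof -
  have [measurable]: "X t \<in> borel_measurable M" using t by (intro measurable_X) auto
  have [measurable]: "N \<in> sets borel" using N by auto
  have "(\<integral>\<^sup>+z. indicator N (x + z) \<partial>lborel) = (0::ennreal)"
    using nn_integral_lborel_translate[of "indicator N" x] null_setsD1[OF N] by simp
  then have "AE z in lborel. indicator N (x + z) = (0::ennreal)"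
    by (subst (asm) nn_integral_0_iff_AE) auto
  then have "(\<integral>\<^sup>+z. ennreal (gauss_density t z) * indicator N (x + z) \<partial>lborel) = 0"
    by (subst nn_integral_0_iff_AE) auto
  then have "(\<integral>\<^sup>+\<omega>. indicator N (x + X t \<omega>) \<partial>M) = 0"
    using nn_integral_X[OF t, of "\<lambda>z. indicator N (x + z)"] by simp
  then have "AE \<omega> in M. indicator N (x + X t \<omega>) = (0::ennreal)"
    by (subst (asm) nn_integral_0_iff_AE) auto
  then show ?thesis by (auto simp: indicator_def elim!: eventually_mono)
qed

text \<open>Fubini turns the fact for each fixed time into one for almost every time along almost
  every path; so the occupation integral does not depend on the representative of the potential.
  Time \<open>0\<close> is left out because the starting point is deterministic.\<close>

lemma AE_occupation_notin:
  assumes N: "N \<in> null_sets lborel"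
  shows "AE \<omega> in M. AE s in lborel. 0 < s \<longrightarrow> x + X s \<omega> \<notin> N"
proof -
  interpret P: pair_sigma_finite M "lborel :: real measure" ..
  have [measurable]: "N \<in> sets borel" using N by auto
  have mX [measurable]: "(\<lambda>p. X (max 0 (snd p)) (fst p)) \<in> borel_measurable (M \<Otimes>\<^sub>M lborel)"
    by (rule borel_measurable_X_at) auto
  have "{p \<in> space (M \<Otimes>\<^sub>M lborel). 0 < snd p \<longrightarrow> x + X (max 0 (snd p)) (fst p) \<notin> N} \<in> sets (M \<Otimes>\<^sub>M lborel)"
    by measurable
  moreover have "AE s in lborel. AE \<omega> in M. 0 < s \<longrightarrow> x + X (max 0 s) \<omega> \<notin> N"
  proof (rule AE_I2)
    fix s :: real
    show "AE \<omega> in M. 0 < s \<longrightarrow> x + X (max 0 s) \<omega> \<notin> N"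
      using AE_X_notin[OF N, of s x] by (cases "0 < s") auto
  qed
  ultimately have "AE \<omega> in M. AE s in lborel. 0 < s \<longrightarrow> x + X (max 0 s) \<omega> \<notin> N"
    using P.AE_commute[where P="\<lambda>\<omega> s. 0 < s \<longrightarrow> x + X (max 0 s) \<omega> \<notin> N"] by simp
  then show ?thesis
    by (rule eventually_mono) (auto elim!: eventually_mono simp: max_def)
qed

lemma feynman_kac_cong_AE:
  assumes v: "AE y in lborel. v y = v' y" and f: "AE y in lborel. f y = f' y" and t: "0 < t"
  shows "feynman_kac v t f x = feynman_kac v' t f' x"
proof -
  from AE_conjI[OF v f] have "AE y in lborel. v y = v' y \<and> f y = f' y" by simp
  then obtain N where N: "\<And>y. y \<notin> N \<Longrightarrow> v y = v' y \<and> f y = f' y" and null: "N \<in> null_sets lborel"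
    by (rule AE_E3) auto
  have "AE \<omega> in M. exp_neg (\<integral>\<^sup>+s\<in>{0..t}. v (x + X s \<omega>) \<partial>lborel) * f (x + X t \<omega>)
      = exp_neg (\<integral>\<^sup>+s\<in>{0..t}. v' (x + X s \<omega>) \<partial>lborel) * f' (x + X t \<omega>)"
    using AE_X_notin[OF null t, of x] AE_occupation_notin[OF null, of x]
  proof eventually_elim
    case (elim \<omega>)
    have "AE s in lborel. v (x + X s \<omega>) * indicator {0..t} s = v' (x + X s \<omega>) * indicator {0..t} s"
      using elim(2) AE_lborel_singleton[of "0::real"]
    proof eventually_elim
      case (elim s)
      then show ?case using N[of "x + X s \<omega>"] by (cases "0 < s") (auto simp: indicator_def)
    qed
    then have "(\<integral>\<^sup>+s\<in>{0..t}. v (x + X s \<omega>) \<partial>lborel) = (\<integral>\<^sup>+s\<in>{0..t}. v' (x + X s \<omega>) \<partial>lborel)"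
      by (rule nn_integral_cong_AE)
    then show ?case using N[OF elim(1)] by simp
  qed
  then show ?thesis unfolding feynman_kac_def by (rule nn_integral_cong_AE)
qed

lemma feynman_kac_mono_AE:
  assumes f: "AE y in lborel. f y \<le> f' y" and t: "0 < t"
  shows "feynman_kac v t f x \<le> feynman_kac v t f' x"
proof -
  obtain N where N: "\<And>y. y \<notin> N \<Longrightarrow> f y \<le> f' y" and null: "N \<in> null_sets lborel"
    using f by (rule AE_E3) auto
  have "AE \<omega> in M. f (x + X t \<omega>) \<le> f' (x + X t \<omega>)"
    using AE_X_notin[OF null t, of x] by (rule eventually_mono) (use N in auto)
  then show ?thesis unfolding feynman_kac_def
    by (intro nn_integral_mono_AE) (auto elim!: eventually_mono intro: mult_left_mono)
qed

lemma feynman_kac_le: "feynman_kac v t f x \<le> (\<integral>\<^sup>+\<omega>. f (x + X t \<omega>) \<partial>M)"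
  unfolding feynman_kac_def
  by (intro nn_integral_mono) (use mult_right_mono[OF exp_neg_le_1] in fastforce)

lemma feynman_kac_1_le_1: "feynman_kac v t (\<lambda>_. 1) x \<le> 1"
proof -
  have "feynman_kac v t (\<lambda>_. 1) x \<le> (\<integral>\<^sup>+\<omega>. 1 \<partial>M)"
    unfolding feynman_kac_def by (intro nn_integral_mono) (simp add: exp_neg_le_1)
  then show ?thesis by (simp add: emeasure_space_1)
qed

lemma feynman_kac_antimono_time:
  assumes "s \<le> t"
  shows "feynman_kac v t (\<lambda>_. 1) x \<le> feynman_kac v s (\<lambda>_. 1) x"
  unfolding feynman_kac_def using assms
  by (intro nn_integral_mono mult_right_mono exp_neg_antimono)
    (auto intro!: mult_left_mono simp: indicator_def)

text \<open>Jensen's inequality in time reduces the occupation integral to the position at single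
  times \<open>s \<le> t\<close>: in the ball the weight is at most \<open>exp (- t * m)\<close>,
  and being outside at time \<open>s\<close> is a Gaussian tail event. Thus tails of
  \<open>X s\<close> take the place of a maximal inequality for the path.\<close>

lemma feynman_kac_1_le_of_lower_bound:
  assumes m: "AE y in lborel. y \<in> cball x r \<longrightarrow> ennreal m \<le> v y" "0 \<le> m" and r: "0 \<le> r" and t: "0 < t"
    and [measurable]: "v \<in> borel_measurable borel"
  shows "feynman_kac v t (\<lambda>_. 1) x \<le> ennreal (exp (- t * m) + sqrt 2 ^ DIM('a) * exp (- r\<^sup>2 / (4 * t)))"
    (is "_ \<le> ennreal ?q")
proof -
  interpret P: pair_sigma_finite M "lborel :: real measure" ..
  have mX [measurable]: "(\<lambda>p. X (max 0 (snd p)) (fst p)) \<in> borel_measurable (M \<Otimes>\<^sub>M lborel)"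
    by (rule borel_measurable_X_at) auto
  let ?w = "\<lambda>\<omega> s. exp_neg (ennreal t * v (x + X (max 0 s) \<omega>)) * indicator {0..t} s"
  have w [measurable]: "(\<lambda>(\<omega>, s). ?w \<omega> s) \<in> borel_measurable (M \<Otimes>\<^sub>M lborel)"
    unfolding split_beta' by measurable
  obtain N where N: "\<And>y. y \<notin> N \<Longrightarrow> y \<in> cball x r \<longrightarrow> ennreal m \<le> v y" and null: "N \<in> null_sets lborel"
    using m(1) by (rule AE_E3) auto
  have bd: "(\<integral>\<^sup>+\<omega>. ?w \<omega> s \<partial>M) \<le> ennreal ?q * indicator {0..t} s" if s0: "s \<noteq> 0" for s
  proof (cases "s \<in> {0..t}")
    case True
    then have s: "0 < s" "s \<le> t" using s0 by auto
    have [measurable]: "X s \<in> borel_measurable M" using s by (intro measurable_X) auto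
    have "(\<integral>\<^sup>+\<omega>. ?w \<omega> s \<partial>M) \<le> (\<integral>\<^sup>+\<omega>. ennreal (exp (- t * m)) + indicator {r<..} (norm (X s \<omega>)) \<partial>M)"
    proof (rule nn_integral_mono_AE, use AE_X_notin[OF null s(1), of x] in eventually_elim)
      case (elim \<omega>)
      show ?case
      proof (cases "norm (X s \<omega>) \<le> r")
        case True
        then have "x + X s \<omega> \<in> cball x r" by (simp add: dist_norm)
        with elim N have "ennreal m \<le> v (x + X s \<omega>)" by (auto simp del: mem_cball)
        then have "ennreal (t * m) \<le> ennreal t * v (x + X s \<omega>)"
          using t m by (simp add: ennreal_mult mult_left_mono)
        from exp_neg_antimono[OF this] have "exp_neg (ennreal t * v (x + X s \<omega>)) \<le> ennreal (exp (- t * m))"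
          using t m by (simp add: exp_neg_ennreal)
        then show ?thesis using s True by (simp add: max_def)
      next
        case False
        then show ?thesis
          using exp_neg_le_1[of "ennreal t * v (x + X (max 0 s) \<omega>)"] s
          by (simp add: add_increasing)
      qed
    qed
    also have "\<dots> = ennreal (exp (- t * m)) + (\<integral>\<^sup>+\<omega>. indicator {r<..} (norm (X s \<omega>)) \<partial>M)"
      by (subst nn_integral_add) (auto simp: emeasure_space_1)
    also have "\<dots> \<le> ennreal (exp (- t * m)) + ennreal (sqrt 2 ^ DIM('a) * exp (- r\<^sup>2 / (4 * s)))"
      by (intro add_left_mono tail_X s r)
    also have "\<dots> \<le> ennreal ?q"
    proof -
      have "r\<^sup>2 / (4 * t) \<le> r\<^sup>2 / (4 * s)" using s by (intro divide_left_mono) auto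
      then show ?thesis by (simp flip: ennreal_plus)
    qed
    finally show ?thesis using True by simp
  qed simp
  have "ennreal t * feynman_kac v t (\<lambda>_. 1) x
      = (\<integral>\<^sup>+\<omega>. ennreal t * exp_neg (\<integral>\<^sup>+s\<in>{0..t}. v (x + X (max 0 s) \<omega>) \<partial>lborel) \<partial>M)"
  proof -
    have [measurable]: "(\<lambda>\<omega>. \<integral>\<^sup>+s\<in>{0..t}. v (x + X s \<omega>) \<partial>lborel) \<in> borel_measurable M"
      by (rule borel_measurable_occupation) auto
    have "(\<integral>\<^sup>+s\<in>{0..t}. v (x + X (max 0 s) \<omega>) \<partial>lborel) = (\<integral>\<^sup>+s\<in>{0..t}. v (x + X s \<omega>) \<partial>lborel)" for \<omega>
      by (intro nn_integral_cong) (auto simp: indicator_def)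
    then show ?thesis by (simp add: feynman_kac_def nn_integral_cmult)
  qed
  also have "\<dots> \<le> (\<integral>\<^sup>+\<omega>. \<integral>\<^sup>+s. ?w \<omega> s \<partial>lborel \<partial>M)"
  proof (rule nn_integral_mono)
    fix \<omega> assume "\<omega> \<in> space M"
    then have [measurable]: "(\<lambda>s. X (max 0 s) \<omega>) \<in> borel_measurable borel"
      by (intro borel_measurable_X_at) auto
    then show "ennreal t * exp_neg (\<integral>\<^sup>+s\<in>{0..t}. v (x + X (max 0 s) \<omega>) \<partial>lborel) \<le> (\<integral>\<^sup>+s. ?w \<omega> s \<partial>lborel)"
      by (intro exp_neg_nn_integral_le t) measurable
  qed
  also have "\<dots> = (\<integral>\<^sup>+s. \<integral>\<^sup>+\<omega>. ?w \<omega> s \<partial>M \<partial>lborel)"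
    by (rule P.Fubini'[symmetric, OF w])
  also have "\<dots> \<le> (\<integral>\<^sup>+s. ennreal ?q * indicator {0..t} s \<partial>lborel)"
    by (rule nn_integral_mono_AE, use AE_lborel_singleton[of "0::real"] in eventually_elim) (rule bd)
  also have "\<dots> = ennreal t * ennreal ?q"
    by (subst nn_integral_cmult_indicator) (use t in \<open>auto simp: mult.commute simp del: ennreal_plus\<close>)
  finally show ?thesis using t
    by (subst (asm) ennreal_mult_le_mult_iff) auto
qed

text \<open>Dropping the indicator gives the first bound, dropping the weight the second;
  \<open>feynman_kac_superlevel_le\<close> interpolates between the two.\<close>

lemma feynman_kac_indicator_le:
  assumes A: "AE y in lborel. y \<in> cball x r \<longrightarrow> y \<notin> A" and r: "0 \<le> r" and t: "0 < t"
  shows "feynman_kac v t (indicator A) x \<le> min (feynman_kac v t (\<lambda>_. 1) x) (ennreal (sqrt 2 ^ DIM('a) * exp (- r\<^sup>2 / (4 * t))))"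
proof (rule min.boundedI)
  show "feynman_kac v t (indicator A) x \<le> feynman_kac v t (\<lambda>_. 1) x"
    using t by (intro feynman_kac_mono_AE) (auto simp: indicator_def)
  have "AE y in lborel. indicator A y \<le> (indicator (- cball x r) y :: ennreal)"
    using A by (auto simp: indicator_def elim!: eventually_mono)
  then have "feynman_kac v t (indicator A) x \<le> feynman_kac v t (indicator (- cball x r)) x"
    using t by (rule feynman_kac_mono_AE)
  also have "\<dots> \<le> (\<integral>\<^sup>+\<omega>. indicator (- cball x r) (x + X t \<omega>) \<partial>M)"
    by (rule feynman_kac_le)
  also have "\<dots> = (\<integral>\<^sup>+\<omega>. indicator {r<..} (norm (X t \<omega>)) \<partial>M)"
    by (intro nn_integral_cong) (auto simp: indicator_def dist_norm)
  also have "\<dots> \<le> ennreal (sqrt 2 ^ DIM('a) * exp (- r\<^sup>2 / (4 * t)))"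
    by (rule tail_X[OF t r])
  finally show "feynman_kac v t (indicator A) x \<le> ennreal (sqrt 2 ^ DIM('a) * exp (- r\<^sup>2 / (4 * t)))" .
qed

end

subsection \<open>Layer cake estimate for the semigroup\<close>

text \<open>The supremum may be infinite, and then \<open>A\<close> has to vanish. For
  \<open>A = \<alpha>\<close> positive, the hypothesis caps all \<open>r ^ n\<close> by the solution
  \<open>Q\<close> of \<open>B * exp (- k * Q) = \<alpha>\<close>, hence also the power of the
  supremum. It is used with \<open>n = 1\<close> for sublevel radii and \<open>n = 2\<close> for
  \<open>rho\<close>.\<close>

lemma le_exp_neg_SUP:
  assumes S: "S \<noteq> {}" "S \<subseteq> {0..}" and k: "0 < k" "0 < n"
    and le: "\<And>r. r \<in> S \<Longrightarrow> A \<le> ennreal (B * exp (- k * r ^ n))"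
  shows "A \<le> ennreal B * exp_neg (ennreal k * (SUP r\<in>S. ennreal r) ^ n)"
proof -
  obtain r0 where r0: "r0 \<in> S" using S by auto
  show ?thesis
  proof (cases A)
    case top
    then show ?thesis using le[OF r0] by (simp add: top_unique)
  next
    case (real \<alpha>)
    show ?thesis
    proof (cases "\<alpha> = 0")
      case False
      then have \<alpha>: "0 < \<alpha>" using real by simp
      have le': "\<alpha> \<le> B * exp (- k * r ^ n)" if "r \<in> S" for r
        using le[OF that] \<alpha> real by (simp add: ennreal_le_iff2)
      have B: "0 < B" using le'[OF r0] \<alpha> by (smt (verit) exp_gt_zero zero_less_mult_pos2)
      define Q where "Q = ln (B / \<alpha>) / k"
      have rQ: "r ^ n \<le> Q" if "r \<in> S" for r
      proof -
        have "exp (k * r ^ n) \<le> B / \<alpha>"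
          using le'[OF that] \<alpha> by (simp add: exp_minus field_simps)
        then have "k * r ^ n \<le> ln (B / \<alpha>)" using \<alpha> B by (simp add: ln_ge_iff)
        then show ?thesis using k by (simp add: Q_def field_simps)
      qed
      have r: "0 \<le> r0 ^ n" using r0 S by auto
      then have Q: "0 \<le> Q" using rQ[OF r0] by linarith
      have "(SUP r\<in>S. ennreal r) \<le> ennreal (root n Q)"
      proof (rule SUP_least)
        fix r assume rS: "r \<in> S"
        then have "0 \<le> r" using S by auto
        then have "r = root n (r ^ n)" using k by (simp add: real_root_power_cancel)
        also have "\<dots> \<le> root n Q" using rQ[OF rS] k by simp
        finally show "ennreal r \<le> ennreal (root n Q)" by (rule ennreal_leI)
      qed
      then have "(SUP r\<in>S. ennreal r) ^ n \<le> ennreal (root n Q) ^ n" by (rule power_mono) simp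
      also have "\<dots> = ennreal Q" using Q k by (simp add: ennreal_power)
      finally have "ennreal k * (SUP r\<in>S. ennreal r) ^ n \<le> ennreal k * ennreal Q" by (rule mult_left_mono) simp
      also have "\<dots> = ennreal (ln (B / \<alpha>))" using k Q by (simp add: Q_def flip: ennreal_mult)
      finally have "exp_neg (ennreal (ln (B / \<alpha>))) \<le> exp_neg (ennreal k * (SUP r\<in>S. ennreal r) ^ n)"
        by (rule exp_neg_antimono)
      moreover have "exp_neg (ennreal (ln (B / \<alpha>))) = ennreal (\<alpha> / B)"
      proof -
        have "0 \<le> ln (B / \<alpha>)" using Q k by (simp add: Q_def zero_le_divide_iff)
        then show ?thesis using \<alpha> B by (simp add: exp_neg_ennreal exp_minus)
      qed
      ultimately have "ennreal B * ennreal (\<alpha> / B) \<le> ennreal B * exp_neg (ennreal k * (SUP r\<in>S. ennreal r) ^ n)"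
        by (intro mult_left_mono) auto
      then show ?thesis using \<alpha> B real by (simp flip: ennreal_mult)
    qed (use real in simp)
  qed
qed

lemma borel_measurable_antimono_ennreal:
  fixes f :: "real \<Rightarrow> ennreal"
  assumes f: "antimono f" "\<And>x. f x \<noteq> \<top>"
  shows "f \<in> borel_measurable borel"
proof -
  have "mono (\<lambda>x. - enn2real (f x))"
    using f by (auto intro!: monoI enn2real_mono simp: less_top dest: antimonoD)
  then have "(\<lambda>x. - enn2real (f x)) \<in> borel_measurable borel" by (rule borel_measurable_mono)
  then have m: "(\<lambda>x. ennreal (- (- enn2real (f x)))) \<in> borel_measurable borel" by measurable
  have eq: "(\<lambda>x. ennreal (- (- enn2real (f x)))) = f"
    by (rule ext) (use f(2) in \<open>simp add: less_top\<close>)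
  show ?thesis using m unfolding eq .
qed

lemma min_le_weighted_geometric_mean:
  fixes x y :: real
  assumes "0 \<le> x" "0 \<le> y" "0 < \<theta>" "\<theta> < 1"
  shows "min x y \<le> x powr \<theta> * y powr (1 - \<theta>)"
proof -
  have "min x y = min x y powr \<theta> * min x y powr (1 - \<theta>)"
    using assms by (simp flip: powr_add)
  also have "\<dots> \<le> x powr \<theta> * y powr (1 - \<theta>)"
    using assms by (intro mult_mono powr_mono2) auto
  finally show ?thesis .
qed

lemma powr_le_exp:
  fixes z p :: real
  assumes "0 < z" "0 < p"
  shows "z powr p \<le> p powr p * exp z"
proof -
  have "z / p \<le> exp (z / p)" using exp_ge_add_one_self[of "z / p"] by linarith
  then have "z \<le> p * exp (z / p)" using assms by (simp add: field_simps)
  then have "z powr p \<le> (p * exp (z / p)) powr p" using assms by (intro powr_mono2) auto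
  also have "\<dots> = p powr p * exp z" using assms by (simp add: powr_mult) (simp add: powr_def)
  finally show ?thesis .
qed

text \<open>\<open>sigma_rad\<close> with the level decoupled from \<open>V x\<close>: where
  \<open>V x = 0\<close>, the level \<open>s * V x\<close> is useless and is replaced by one taken
  from a nearby point.\<close>

definition sublevel_radius :: "('a::euclidean_space \<Rightarrow> real) \<Rightarrow> 'a \<Rightarrow> real \<Rightarrow> ennreal" where
  "sublevel_radius V x u = (SUP r\<in>{r. 0 \<le> r \<and> (AE y in lebesgue. y \<in> cball x r \<longrightarrow> V y \<le> u)}. ennreal r)"

lemma sigma_rad_eq_sublevel_radius: "sigma_rad V x s = sublevel_radius V x (s * V x)"
  by (simp add: sigma_rad_def sublevel_radius_def)

lemma sublevel_radius_mono:
  assumes "u \<le> u'"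
  shows "sublevel_radius V x u \<le> sublevel_radius V x u'"
  unfolding sublevel_radius_def using assms
  by (intro SUP_subset_mono) (auto elim!: eventually_mono)

text \<open>The radius is a supremum defined through null sets, so measurability in \<open>s\<close>
  is obtained from monotonicity.\<close>

lemma borel_measurable_exp_neg_sublevel_radius:
  assumes "0 \<le> w"
  shows "(\<lambda>s. exp_neg (ennreal c * sublevel_radius V x (s * w))) \<in> borel_measurable borel"
proof (rule borel_measurable_antimono_ennreal)
  show "antimono (\<lambda>s. exp_neg (ennreal c * sublevel_radius V x (s * w)))"
    using assms
    by (intro antimonoI exp_neg_antimono mult_left_mono sublevel_radius_mono mult_right_mono) auto
  show "exp_neg z \<noteq> \<top>" for z by (simp add: exp_neg_def)
qed

text \<open>Points are null sets, so \<open>0\<close> is always an admissible radius and the suprema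
  in \<open>rho\<close> and \<open>sublevel_radius\<close> run over non-empty sets.\<close>

lemma AE_cball_0: "AE y in lebesgue. y \<in> cball (x :: 'a::euclidean_space) 0 \<longrightarrow> P y"
proof -
  have "AE y in lebesgue. y \<noteq> x" using AE_lborel_singleton[of x] by (simp only: AE_completion_iff)
  then show ?thesis by (rule eventually_mono) simp
qed

text \<open>The quantity behind \<open>K_fun\<close>, with a free reference level \<open>w\<close>
  in place of \<open>V x\<close> and the factor \<open>w powr a\<close> without truncation at
  \<open>1\<close>. The summand \<open>1\<close> accounts for values of the potential up to
  \<open>w\<close>.\<close>

definition sublevel_integral :: "real \<Rightarrow> real \<Rightarrow> ('a::euclidean_space \<Rightarrow> real) \<Rightarrow> 'a \<Rightarrow> real \<Rightarrow> ennreal" where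
  "sublevel_integral c a V x w = ennreal (w powr a) *
    (1 + (\<integral>\<^sup>+s\<in>{1..}. exp_neg (ennreal c * sublevel_radius V x (s * w)) * ennreal (s powr (a - 1)) \<partial>lborel))"

text \<open>Above \<open>w\<close>, \<open>y powr a\<close> equals \<open>w powr a\<close> times
  \<open>1\<close> plus the integral of \<open>a * s powr (a - 1)\<close> from \<open>1\<close> to
  \<open>y / w\<close>. Starting the layers at \<open>w\<close> instead of \<open>0\<close> matches
  the lower limit \<open>1\<close> in \<open>K_fun\<close>.\<close>

lemma powr_layer_cake:
  fixes a w y :: real
  assumes a: "0 < a" and w: "0 < w" and y: "0 \<le> y"
  shows "ennreal (y powr a) \<le> ennreal (w powr a) *
    (1 + (\<integral>\<^sup>+s\<in>{1..}. ennreal (a * s powr (a - 1)) * indicator {z. s * w < z} y \<partial>lborel))"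
proof (cases "y \<le> w")
  case True
  then have "ennreal (y powr a) \<le> ennreal (w powr a)" using a y by (intro ennreal_leI powr_mono2) auto
  also have "\<dots> \<le> ennreal (w powr a) * (1 + (\<integral>\<^sup>+s\<in>{1..}. ennreal (a * s powr (a - 1)) * indicator {z. s * w < z} y \<partial>lborel))"
    by (simp add: distrib_left)
  finally show ?thesis .
next
  case False
  define s0 where "s0 = y / w"
  have s0: "1 < s0" "y = s0 * w" using False w by (auto simp: s0_def field_simps)
  have "((\<lambda>s. a * s powr (a - 1)) has_integral (s0 powr a - 1 powr a)) {1..s0}"
    using s0 by (intro fundamental_theorem_of_calculus)
      (auto intro!: derivative_eq_intros simp flip: has_real_derivative_iff_has_vector_derivative)
  then have "(\<integral>\<^sup>+s\<in>{1..s0}. ennreal (a * s powr (a - 1)) \<partial>lborel) = ennreal (s0 powr a - 1)"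
    using a by (subst nn_integral_has_integral_lebesgue') auto
  moreover have "(\<integral>\<^sup>+s\<in>{1..s0}. ennreal (a * s powr (a - 1)) \<partial>lborel)
      = (\<integral>\<^sup>+s\<in>{1..}. ennreal (a * s powr (a - 1)) * indicator {z. s * w < z} y \<partial>lborel)"
    using AE_lborel_singleton[of s0]
    by (intro nn_integral_cong_AE) (use w in \<open>auto simp: s0(2) indicator_def elim!: eventually_mono\<close>)
  moreover have "ennreal (y powr a) = ennreal (w powr a) * (1 + ennreal (s0 powr a - 1))"
  proof -
    have "1 \<le> s0 powr a" using s0 a by (simp add: ge_one_powr_ge_zero)
    moreover have "y powr a = w powr a * s0 powr a" using s0 w by (simp add: powr_mult)
    ultimately show ?thesis by (simp flip: ennreal_mult ennreal_plus ennreal_1)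
  qed
  ultimately show ?thesis by simp
qed

context brownian_motion
begin

lemma feynman_kac_layer_cake:
  assumes a: "0 < a" and w: "0 < w" and t: "0 < t"
    and [measurable]: "V \<in> borel_measurable borel" "v \<in> borel_measurable borel" and V: "\<And>y. 0 \<le> V y"
  shows "feynman_kac v t (\<lambda>y. ennreal (V y powr a)) x \<le> ennreal (w powr a) * (feynman_kac v t (\<lambda>_. 1) x
    + (\<integral>\<^sup>+s\<in>{1..}. ennreal (a * s powr (a - 1)) * feynman_kac v t (indicator {y. s * w < V y}) x \<partial>lborel))"
proof -
  interpret P: pair_sigma_finite M "lborel :: real measure" ..
  have [measurable]: "X t \<in> borel_measurable M" using t by (intro measurable_X) auto
  have [measurable]: "(\<lambda>\<omega>. \<integral>\<^sup>+s\<in>{0..t}. v (x + X s \<omega>) \<partial>lborel) \<in> borel_measurable M"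
    by (rule borel_measurable_occupation) auto
  let ?Z = "\<lambda>\<omega>. exp_neg (\<integral>\<^sup>+s\<in>{0..t}. v (x + X s \<omega>) \<partial>lborel)"
  let ?k = "\<lambda>\<omega> s. ?Z \<omega> * (ennreal (a * s powr (a - 1)) * indicator {z. s * w < z} (V (x + X t \<omega>)) * indicator {1..} s)"
  have ind: "indicator {z. s * w < z} (V (x + X t \<omega>)) = (if s * w < V (x + X t \<omega>) then 1 else 0 :: ennreal)" for s \<omega>
    by simp
  have k [measurable]: "(\<lambda>(\<omega>, s). ?k \<omega> s) \<in> borel_measurable (M \<Otimes>\<^sub>M lborel)"
    unfolding split_beta' ind by measurable
  have k1 [measurable]: "(\<lambda>\<omega>. \<integral>\<^sup>+s. ?k \<omega> s \<partial>lborel) \<in> borel_measurable M"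
    using k by (rule lborel.borel_measurable_nn_integral)
  have "feynman_kac v t (\<lambda>y. ennreal (V y powr a)) x
      \<le> (\<integral>\<^sup>+\<omega>. ennreal (w powr a) * (?Z \<omega> + (\<integral>\<^sup>+s. ?k \<omega> s \<partial>lborel)) \<partial>M)"
    unfolding feynman_kac_def
  proof (rule nn_integral_mono)
    fix \<omega>
    have "?Z \<omega> * ennreal (V (x + X t \<omega>) powr a) \<le> ?Z \<omega> * (ennreal (w powr a) *
      (1 + (\<integral>\<^sup>+s\<in>{1..}. ennreal (a * s powr (a - 1)) * indicator {z. s * w < z} (V (x + X t \<omega>)) \<partial>lborel)))"
      by (intro mult_left_mono powr_layer_cake a w V) auto
    also have "\<dots> = ennreal (w powr a) * (?Z \<omega> + ?Z \<omega> * (\<integral>\<^sup>+s\<in>{1..}. ennreal (a * s powr (a - 1)) * indicator {z. s * w < z} (V (x + X t \<omega>)) \<partial>lborel))"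
      by (simp add: distrib_left mult_ac)
    also have "?Z \<omega> * (\<integral>\<^sup>+s\<in>{1..}. ennreal (a * s powr (a - 1)) * indicator {z. s * w < z} (V (x + X t \<omega>)) \<partial>lborel) = (\<integral>\<^sup>+s. ?k \<omega> s \<partial>lborel)"
      unfolding ind by (intro nn_integral_cmult[symmetric]) measurable
    finally show "?Z \<omega> * ennreal (V (x + X t \<omega>) powr a) \<le> ennreal (w powr a) * (?Z \<omega> + (\<integral>\<^sup>+s. ?k \<omega> s \<partial>lborel))" .
  qed
  also have "\<dots> = ennreal (w powr a) * (\<integral>\<^sup>+\<omega>. ?Z \<omega> + (\<integral>\<^sup>+s. ?k \<omega> s \<partial>lborel) \<partial>M)"
    by (rule nn_integral_cmult) measurable
  also have "(\<integral>\<^sup>+\<omega>. ?Z \<omega> + (\<integral>\<^sup>+s. ?k \<omega> s \<partial>lborel) \<partial>M) = feynman_kac v t (\<lambda>_. 1) x + (\<integral>\<^sup>+\<omega>. \<integral>\<^sup>+s. ?k \<omega> s \<partial>lborel \<partial>M)"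
    unfolding feynman_kac_def by (subst nn_integral_add) auto
  also have "(\<integral>\<^sup>+\<omega>. \<integral>\<^sup>+s. ?k \<omega> s \<partial>lborel \<partial>M) = (\<integral>\<^sup>+s. \<integral>\<^sup>+\<omega>. ?k \<omega> s \<partial>M \<partial>lborel)"
    by (rule P.Fubini'[symmetric, OF k])
  also have "\<dots> = (\<integral>\<^sup>+s\<in>{1..}. ennreal (a * s powr (a - 1)) * feynman_kac v t (indicator {y. s * w < V y}) x \<partial>lborel)"
  proof (rule nn_integral_cong)
    fix s :: real
    have "(\<integral>\<^sup>+\<omega>. ?k \<omega> s \<partial>M) = (\<integral>\<^sup>+\<omega>. ennreal (a * s powr (a - 1)) * indicator {1..} s *
        (?Z \<omega> * indicator {y. s * w < V y} (x + X t \<omega>)) \<partial>M)"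
      by (intro nn_integral_cong) (simp add: mult_ac indicator_def)
    also have "\<dots> = ennreal (a * s powr (a - 1)) * indicator {1..} s *
        (\<integral>\<^sup>+\<omega>. ?Z \<omega> * indicator {y. s * w < V y} (x + X t \<omega>) \<partial>M)"
      by (rule nn_integral_cmult) measurable
    finally show "(\<integral>\<^sup>+\<omega>. ?k \<omega> s \<partial>M) = ennreal (a * s powr (a - 1)) * feynman_kac v t (indicator {y. s * w < V y}) x * indicator {1..} s"
      by (simp add: feynman_kac_def mult_ac)
  qed
  finally show ?thesis .
qed

text \<open>\<open>q\<close> is a free bound, since exponential decay and the decay obtained from
  \<open>I_fun\<close> are both inserted later. Interpolation gives \<open>q powr \<theta>\<close>
  times the Gaussian tail to the power \<open>1 - \<theta>\<close>. The factor
  \<open>exp (\<theta> * \<delta> * t / 2)\<close> is the price of turning that tail into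
  \<open>exp (- c * r)\<close> uniformly in \<open>t\<close>: half of what
  \<open>q powr \<theta>\<close> offers when \<open>q\<close> decays like
  \<open>exp (- \<delta> * t)\<close>.\<close>

lemma feynman_kac_superlevel_le:
  assumes \<theta>: "0 < \<theta>" "\<theta> < 1" and c: "0 < c" "c \<le> (1 - \<theta>) / 4" "c \<le> \<theta> * \<delta> / 2" and t: "0 < t"
    and q: "0 \<le> q" "feynman_kac v t (\<lambda>_. 1) x \<le> ennreal q" and \<delta>: "0 < \<delta>"
  shows "feynman_kac v t (indicator {y. u < V y}) x
    \<le> ennreal (sqrt 2 ^ DIM('a) * (q powr \<theta> * exp (\<theta> * \<delta> * t / 2))) * exp_neg (ennreal c * sublevel_radius V x u)"
proof -
  let ?D = "sqrt 2 ^ DIM('a)"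
  have D: "1 \<le> ?D" by (rule one_le_power) simp
  have "feynman_kac v t (indicator {y. u < V y}) x
      \<le> ennreal (?D * (q powr \<theta> * exp (\<theta> * \<delta> * t / 2)) * exp (- c * r ^ 1))"
    if r: "0 \<le> r" "AE y in lebesgue. y \<in> cball x r \<longrightarrow> V y \<le> u" for r
  proof -
    let ?y = "?D * exp (- r\<^sup>2 / (4 * t))"
    have ae: "AE y in lborel. y \<in> cball x r \<longrightarrow> y \<notin> {y. u < V y}"
      using r(2) by (auto simp: AE_completion_iff not_less)
    have "feynman_kac v t (indicator {y. u < V y}) x \<le> min (ennreal q) (ennreal ?y)"
      using feynman_kac_indicator_le[OF ae r(1) t, of v] q(2) by (auto intro: order_trans)
    also have "\<dots> = ennreal (min q ?y)" using q by (simp add: min_def)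
    also have "\<dots> \<le> ennreal (q powr \<theta> * ?y powr (1 - \<theta>))"
      using \<theta> q by (intro ennreal_leI min_le_weighted_geometric_mean) auto
    also have "\<dots> \<le> ennreal (?D * (q powr \<theta> * exp (\<theta> * \<delta> * t / 2)) * exp (- c * r ^ 1))"
    proof (rule ennreal_leI)
      have "c * r \<le> \<theta> * \<delta> * t / 2 + (1 - \<theta>) * r\<^sup>2 / (4 * t)"
      proof (cases "t \<le> r")
        case True
        have "c * r \<le> (1 - \<theta>) / 4 * r" using c r by (intro mult_right_mono) auto
        also have "\<dots> \<le> (1 - \<theta>) / 4 * (r\<^sup>2 / t)"
          using True t \<theta> r by (intro mult_left_mono) (auto simp: field_simps power2_eq_square intro: mult_mono)
        also have "\<dots> = (1 - \<theta>) * r\<^sup>2 / (4 * t)" by simp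
        moreover have "0 \<le> \<theta> * \<delta> * t / 2" using \<theta> \<delta> t by simp
        ultimately show ?thesis by linarith
      next
        case False
        have "c * r \<le> \<theta> * \<delta> / 2 * r" using c r by (intro mult_right_mono) auto
        also have "\<dots> \<le> \<theta> * \<delta> / 2 * t" using False \<theta> \<delta> by (intro mult_left_mono) auto
        finally show ?thesis using \<theta> t by (simp add: add_increasing2)
      qed
      then have e: "exp (- (1 - \<theta>) * r\<^sup>2 / (4 * t)) \<le> exp (\<theta> * \<delta> * t / 2) * exp (- c * r ^ 1)"
      proof -
        have "- (1 - \<theta>) * r\<^sup>2 / (4 * t) = - ((1 - \<theta>) * r\<^sup>2 / (4 * t))"
          by (metis minus_divide_left minus_mult_left)
        then have "- (1 - \<theta>) * r\<^sup>2 / (4 * t) \<le> \<theta> * \<delta> * t / 2 + - c * r ^ 1"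
          using \<open>c * r \<le> _\<close> unfolding power_one_right by linarith
        then show ?thesis by (simp only: exp_add[symmetric] exp_le_cancel_iff)
      qed
      have "- r\<^sup>2 / (4 * t) * (1 - \<theta>) = - (1 - \<theta>) * r\<^sup>2 / (4 * t)"
        using t by (simp add: field_simps)
      then have "?y powr (1 - \<theta>) = ?D powr (1 - \<theta>) * exp (- (1 - \<theta>) * r\<^sup>2 / (4 * t))"
        by (simp only: powr_mult exp_powr_real)
      also have "\<dots> \<le> ?D powr 1 * (exp (\<theta> * \<delta> * t / 2) * exp (- c * r ^ 1))"
        using D \<theta> e by (intro mult_mono powr_mono) auto
      finally have "q powr \<theta> * ?y powr (1 - \<theta>) \<le> q powr \<theta> * (?D powr 1 * (exp (\<theta> * \<delta> * t / 2) * exp (- c * r ^ 1)))"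
        by (rule mult_left_mono) simp
      then show "q powr \<theta> * ?y powr (1 - \<theta>) \<le> ?D * (q powr \<theta> * exp (\<theta> * \<delta> * t / 2)) * exp (- c * r ^ 1)"
        by (simp add: mult_ac)
    qed
    finally show ?thesis .
  qed
  then have "feynman_kac v t (indicator {y. u < V y}) x
    \<le> ennreal (?D * (q powr \<theta> * exp (\<theta> * \<delta> * t / 2))) * exp_neg (ennreal c * (sublevel_radius V x u) ^ 1)"
    unfolding sublevel_radius_def using c AE_cball_0[of x "\<lambda>y. V y \<le> u"]
    by (intro le_exp_neg_SUP) (auto intro!: exI[of _ 0] simp del: mem_cball)
  then show ?thesis by simp
qed

lemma feynman_kac_powr_le:
  assumes a: "0 < a" and w: "0 < w" and \<theta>: "0 < \<theta>" "\<theta> < 1" and c: "0 < c" "c \<le> (1 - \<theta>) / 4" "c \<le> \<theta> * \<delta> / 2"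
    and t: "0 < t" and \<delta>: "0 < \<delta>" and q: "0 \<le> q" "feynman_kac v t (\<lambda>_. 1) x \<le> ennreal q"
    and [measurable]: "V \<in> borel_measurable borel" "v \<in> borel_measurable borel" and V: "\<And>y. 0 \<le> V y"
  shows "feynman_kac v t (\<lambda>y. ennreal (V y powr a)) x
    \<le> ennreal ((1 + a) * sqrt 2 ^ DIM('a) * (q powr \<theta> * exp (\<theta> * \<delta> * t / 2))) * sublevel_integral c a V x w"
proof -
  let ?D = "sqrt 2 ^ DIM('a)"
  let ?A = "q powr \<theta> * exp (\<theta> * \<delta> * t / 2)"
  let ?g = "\<lambda>s. exp_neg (ennreal c * sublevel_radius V x (s * w)) * ennreal (s powr (a - 1))"
  have D: "1 \<le> ?D" by (rule one_le_power) simp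
  have [measurable]: "(\<lambda>s. exp_neg (ennreal c * sublevel_radius V x (s * w))) \<in> borel_measurable borel"
    using w by (intro borel_measurable_exp_neg_sublevel_radius) auto
  \<comment> \<open>The part up to level \<open>w\<close> carries no tail; it is interpolated with
    the trivial bound \<open>1\<close> to get the same power \<open>q powr \<theta>\<close>.\<close>
  have "feynman_kac v t (\<lambda>_. 1) x \<le> ennreal (min q 1)"
    using q feynman_kac_1_le_1[of v t x] by (simp add: min_def)
  also have "\<dots> \<le> ennreal (q powr \<theta> * 1 powr (1 - \<theta>))"
    using q \<theta> by (intro ennreal_leI min_le_weighted_geometric_mean) auto
  also have "\<dots> \<le> ennreal ((1 + a) * ?D * ?A)"
  proof (rule ennreal_leI)
    have "1 * 1 \<le> (1 + a) * ?D" using a D by (intro mult_mono) auto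
    moreover have "0 \<le> \<theta> * \<delta> * t" using \<theta> \<delta> t by simp
    moreover from this have "q powr \<theta> * 1 \<le> ?A" by (intro mult_left_mono) auto
    ultimately have "1 * (q powr \<theta> * 1) \<le> (1 + a) * ?D * ?A" by (intro mult_mono) auto
    then show "q powr \<theta> * 1 powr (1 - \<theta>) \<le> (1 + a) * ?D * ?A" by simp
  qed
  finally have 1: "feynman_kac v t (\<lambda>_. 1) x \<le> ennreal ((1 + a) * ?D * ?A)" .
  have "(\<integral>\<^sup>+s\<in>{1..}. ennreal (a * s powr (a - 1)) * feynman_kac v t (indicator {y. s * w < V y}) x \<partial>lborel)
      \<le> (\<integral>\<^sup>+s. ennreal ((1 + a) * ?D * ?A) * (?g s * indicator {1..} s) \<partial>lborel)"
  proof (rule nn_integral_mono)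
    fix s :: real
    have "ennreal (a * s powr (a - 1)) * feynman_kac v t (indicator {y. s * w < V y}) x
        \<le> ennreal (a * s powr (a - 1)) * (ennreal (?D * ?A) * exp_neg (ennreal c * sublevel_radius V x (s * w)))"
      by (intro mult_left_mono feynman_kac_superlevel_le assms) auto
    also have "\<dots> = ennreal (a * (?D * ?A)) * ?g s"
      using a by (simp add: ennreal_mult' mult_ac)
    also have "\<dots> \<le> ennreal ((1 + a) * ?D * ?A) * ?g s"
      by (intro mult_right_mono ennreal_leI) (auto simp: algebra_simps)
    finally have "ennreal (a * s powr (a - 1)) * feynman_kac v t (indicator {y. s * w < V y}) x
        \<le> ennreal ((1 + a) * ?D * ?A) * ?g s" .
    from mult_right_mono[OF this, of "indicator {1..} s"]
    show "ennreal (a * s powr (a - 1)) * feynman_kac v t (indicator {y. s * w < V y}) x * indicator {1..} s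
        \<le> ennreal ((1 + a) * ?D * ?A) * (?g s * indicator {1..} s)" by (simp add: mult_ac)
  qed
  also have "\<dots> = ennreal ((1 + a) * ?D * ?A) * (\<integral>\<^sup>+s\<in>{1..}. ?g s \<partial>lborel)"
    by (rule nn_integral_cmult) measurable
  finally have 2: "(\<integral>\<^sup>+s\<in>{1..}. ennreal (a * s powr (a - 1)) * feynman_kac v t (indicator {y. s * w < V y}) x \<partial>lborel)
      \<le> ennreal ((1 + a) * ?D * ?A) * (\<integral>\<^sup>+s\<in>{1..}. ?g s \<partial>lborel)" .
  have "feynman_kac v t (\<lambda>y. ennreal (V y powr a)) x \<le> ennreal (w powr a) * (ennreal ((1 + a) * ?D * ?A)
      + ennreal ((1 + a) * ?D * ?A) * (\<integral>\<^sup>+s\<in>{1..}. ?g s \<partial>lborel))"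
    by (rule order_trans[OF feynman_kac_layer_cake[OF a w t]]) (use 1 2 V in \<open>auto intro!: mult_left_mono add_mono\<close>)
  also have "\<dots> = ennreal ((1 + a) * ?D * ?A) * sublevel_integral c a V x w"
    by (simp add: sublevel_integral_def distrib_left mult_ac)
  finally show ?thesis .
qed

end

subsection \<open>Decay of the semigroup\<close>

lemma nn_integral_powr_exp_finite:
  fixes a \<kappa> :: real
  assumes "0 < a" "0 < \<kappa>"
  shows "(\<integral>\<^sup>+t\<in>{0<..}. ennreal (t powr (a - 1) * exp (- \<kappa> * t)) \<partial>lborel) < \<top>"
proof -
  have "(\<integral>\<^sup>+t\<in>{0<..}. ennreal (t powr (a - 1) * exp (- \<kappa> * t)) \<partial>lborel)
      = ennreal \<bar>1 / \<kappa>\<bar> * (\<integral>\<^sup>+s. ennreal ((0 + 1 / \<kappa> * s) powr (a - 1) * exp (- \<kappa> * (0 + 1 / \<kappa> * s))) * indicator {0<..} (0 + 1 / \<kappa> * s) \<partial>lborel)"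
    by (rule nn_integral_real_affine) (use assms in auto)
  moreover have "(\<integral>\<^sup>+s. ennreal ((0 + 1 / \<kappa> * s) powr (a - 1) * exp (- \<kappa> * (0 + 1 / \<kappa> * s))) * indicator {0<..} (0 + 1 / \<kappa> * s) \<partial>lborel)
      \<le> (\<integral>\<^sup>+s. ennreal ((1 / \<kappa>) powr (a - 1)) * (ennreal (indicator {0..} s * s powr (a - 1) / exp s)) \<partial>lborel)"
  proof (rule nn_integral_mono)
    fix s :: real
    show "ennreal ((0 + 1 / \<kappa> * s) powr (a - 1) * exp (- \<kappa> * (0 + 1 / \<kappa> * s))) * indicator {0<..} (0 + 1 / \<kappa> * s)
        \<le> ennreal ((1 / \<kappa>) powr (a - 1)) * ennreal (indicator {0..} s * s powr (a - 1) / exp s)"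
    proof (cases "0 < s")
      case True
      have "(0 + 1 / \<kappa> * s) powr (a - 1) * exp (- \<kappa> * (0 + 1 / \<kappa> * s)) = (1 / \<kappa>) powr (a - 1) * (s powr (a - 1) / exp s)"
        unfolding add_0 powr_mult using assms by (simp add: exp_minus divide_inverse)
      moreover have "ennreal ((1 / \<kappa>) powr (a - 1) * (s powr (a - 1) / exp s))
          = ennreal ((1 / \<kappa>) powr (a - 1)) * ennreal (s powr (a - 1) / exp s)"
        by (rule ennreal_mult') (rule powr_ge_zero)
      moreover have "indicator {0..} s * s powr (a - 1) / exp s = s powr (a - 1) / exp s"
        using True by simp
      moreover have "z * indicator {0<..} (0 + 1 / \<kappa> * s) \<le> z" for z :: ennreal
        by (simp add: indicator_def)
      ultimately show ?thesis by presburger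
    next
      case False
      then have "\<not> 0 < 1 / \<kappa> * s" using assms by (simp add: zero_less_divide_iff)
      then show ?thesis by simp
    qed
  qed
  moreover have "(\<integral>\<^sup>+s. ennreal ((1 / \<kappa>) powr (a - 1)) * (ennreal (indicator {0..} s * s powr (a - 1) / exp s)) \<partial>lborel)
      = ennreal ((1 / \<kappa>) powr (a - 1)) * ennreal (Gamma a)"
    unfolding Gamma_conv_nn_integral_real[OF assms(1)] by (rule nn_integral_cmult) measurable
  ultimately have "(\<integral>\<^sup>+t\<in>{0<..}. ennreal (t powr (a - 1) * exp (- \<kappa> * t)) \<partial>lborel)
      \<le> ennreal \<bar>1 / \<kappa>\<bar> * (ennreal ((1 / \<kappa>) powr (a - 1)) * ennreal (Gamma a))"
    by (simp only:) (rule mult_left_mono, auto)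
  also have "\<dots> < \<top>" by (simp add: ennreal_mult_less_top)
  finally show ?thesis .
qed

lemma nn_integral_powr_min_finite:
  fixes a \<beta> :: real
  assumes "0 < a" "a < \<beta>"
  shows "(\<integral>\<^sup>+s\<in>{0<..}. ennreal (s powr (a - 1) * min 1 (s powr - \<beta>)) \<partial>lborel) < \<top>"
proof -
  have 1: "(\<integral>\<^sup>+s\<in>{0..1}. ennreal (s powr (a - 1)) \<partial>lborel) = ennreal (1 powr (a - 1 + 1) / (a - 1 + 1))"
    using assms by (intro nn_integral_has_integral_lebesgue' has_integral_powr_from_0) auto
  have 2: "(\<integral>\<^sup>+s\<in>{1..}. ennreal (s powr (a - 1 - \<beta>)) \<partial>lborel) = ennreal (- (1 powr (a - 1 - \<beta> + 1)) / (a - 1 - \<beta> + 1))"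
    using assms by (intro nn_integral_has_integral_lebesgue' has_integral_powr_to_inf) auto
  have "(\<integral>\<^sup>+s\<in>{0<..}. ennreal (s powr (a - 1) * min 1 (s powr - \<beta>)) \<partial>lborel)
      \<le> (\<integral>\<^sup>+s. ennreal (s powr (a - 1)) * indicator {0..1} s + ennreal (s powr (a - 1 - \<beta>)) * indicator {1..} s \<partial>lborel)"
  proof (rule nn_integral_mono)
    fix s :: real
    show "ennreal (s powr (a - 1) * min 1 (s powr - \<beta>)) * indicator {0<..} s
        \<le> ennreal (s powr (a - 1)) * indicator {0..1} s + ennreal (s powr (a - 1 - \<beta>)) * indicator {1..} s"
    proof (cases "s \<le> 1")
      case True
      have "s powr (a - 1) * min 1 (s powr - \<beta>) \<le> s powr (a - 1) * 1" by (intro mult_left_mono) auto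
      then show ?thesis using True by (auto simp: indicator_def intro: ennreal_leI add_increasing2)
    next
      case False
      have "s powr (a - 1) * min 1 (s powr - \<beta>) \<le> s powr (a - 1) * s powr - \<beta>" by (intro mult_left_mono) auto
      also have "\<dots> = s powr (a - 1 - \<beta>)" by (simp flip: powr_add)
      finally show ?thesis using False by (auto simp: indicator_def intro: ennreal_leI)
    qed
  qed
  also have "\<dots> = ennreal (1 powr (a - 1 + 1) / (a - 1 + 1)) + ennreal (- (1 powr (a - 1 - \<beta> + 1)) / (a - 1 - \<beta> + 1))"
    unfolding 1[symmetric] 2[symmetric] by (rule nn_integral_add) auto
  also have "\<dots> < \<top>" by simp
  finally show ?thesis .
qed

text \<open>The substitution \<open>s = t * v\<close> absorbs the factor \<open>v powr a\<close>, so
  the result is the same for all \<open>v\<close>; this makes the estimate for large potential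
  uniform.\<close>

lemma nn_integral_powr_min_scale:
  fixes a \<beta> v :: real
  assumes "0 < v"
  shows "(\<integral>\<^sup>+t\<in>{0<..}. ennreal (v powr a * (t powr (a - 1) * min 1 ((t * v) powr - \<beta>))) \<partial>lborel)
    = (\<integral>\<^sup>+s\<in>{0<..}. ennreal (s powr (a - 1) * min 1 (s powr - \<beta>)) \<partial>lborel)"
proof -
  have "(\<integral>\<^sup>+s\<in>{0<..}. ennreal (s powr (a - 1) * min 1 (s powr - \<beta>)) \<partial>lborel)
      = ennreal \<bar>v\<bar> * (\<integral>\<^sup>+t. ennreal ((0 + v * t) powr (a - 1) * min 1 ((0 + v * t) powr - \<beta>)) * indicator {0<..} (0 + v * t) \<partial>lborel)"
    by (rule nn_integral_real_affine) (use assms in auto)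
  also have "\<dots> = (\<integral>\<^sup>+t. ennreal \<bar>v\<bar> * (ennreal ((0 + v * t) powr (a - 1) * min 1 ((0 + v * t) powr - \<beta>)) * indicator {0<..} (0 + v * t)) \<partial>lborel)"
    by (rule nn_integral_cmult[symmetric]) measurable
  also have "\<dots> = (\<integral>\<^sup>+t\<in>{0<..}. ennreal (v powr a * (t powr (a - 1) * min 1 ((t * v) powr - \<beta>))) \<partial>lborel)"
  proof (rule nn_integral_cong)
    fix t :: real
    have "v * v powr (a - 1) = v powr a" using assms by (simp add: powr_mult_base)
    then have "v * ((v * t) powr (a - 1) * z) = v powr a * (t powr (a - 1) * z)" for z
      by (metis powr_mult mult.assoc)
    then have eq: "v * ((v * t) powr (a - 1) * z) = v powr a * (t powr (a - 1) * z)" for z .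
    have "ennreal \<bar>v\<bar> * ennreal ((0 + v * t) powr (a - 1) * min 1 ((0 + v * t) powr - \<beta>))
        = ennreal (v * ((v * t) powr (a - 1) * min 1 ((v * t) powr - \<beta>)))"
      using assms ennreal_mult'[of v "(v * t) powr (a - 1) * min 1 ((v * t) powr - \<beta>)"] by simp
    also have "\<dots> = ennreal (v powr a * (t powr (a - 1) * min 1 ((t * v) powr - \<beta>)))"
      unfolding eq mult.commute[of t v] ..
    finally have "ennreal \<bar>v\<bar> * ennreal ((0 + v * t) powr (a - 1) * min 1 ((0 + v * t) powr - \<beta>))
        = ennreal (v powr a * (t powr (a - 1) * min 1 ((t * v) powr - \<beta>)))" .
    moreover have "indicator {0<..} (0 + v * t) = (indicator {0<..} t :: ennreal)"
      using assms by (simp add: indicator_def zero_less_mult_iff)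
    ultimately show "ennreal \<bar>v\<bar> * (ennreal ((0 + v * t) powr (a - 1) * min 1 ((0 + v * t) powr - \<beta>)) * indicator {0<..} (0 + v * t))
        = ennreal (v powr a * (t powr (a - 1) * min 1 ((t * v) powr - \<beta>))) * indicator {0<..} t"
      by (simp only: mult.assoc[symmetric])
  qed
  finally show ?thesis ..
qed

section \<open>Comparison of sublevel radii at two nearby points\<close>

lemma sublevel_radius_triangle:
  assumes "dist x y \<le> R"
  shows "sublevel_radius V y u \<le> sublevel_radius V x u + ennreal R"
  unfolding sublevel_radius_def[of V y]
proof (rule SUP_least)
  fix r assume r: "r \<in> {r. 0 \<le> r \<and> (AE z in lebesgue. z \<in> cball y r \<longrightarrow> V z \<le> u)}"
  have R: "0 \<le> R" using assms zero_le_dist[of x y] by linarith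
  show "ennreal r \<le> sublevel_radius V x u + ennreal R"
  proof (cases "r \<le> R")
    case True
    then show ?thesis by (simp add: add_increasing ennreal_leI)
  next
    case False
    have "cball x (r - R) \<subseteq> cball y r"
    proof
      fix z assume "z \<in> cball x (r - R)"
      then show "z \<in> cball y r" using dist_triangle3[of y z x] assms by auto
    qed
    then have "AE z in lebesgue. z \<in> cball x (r - R) \<longrightarrow> V z \<le> u"
      using r by (auto elim!: eventually_mono)
    then have "ennreal (r - R) \<le> sublevel_radius V x u"
      unfolding sublevel_radius_def using False by (intro SUP_upper) auto
    then have "ennreal (r - R) + ennreal R \<le> sublevel_radius V x u + ennreal R" by (rule add_right_mono)
    then show ?thesis using False R by (simp flip: ennreal_plus)
  qed
qed

text \<open>Moving the centre by \<open>R\<close> costs the factor \<open>exp (c * R)\<close>. With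
  it, the information of \<open>K_fun\<close> at \<open>y\<close> becomes usable at a zero
  \<open>x\<close> of the potential.\<close>

lemma exp_neg_sublevel_radius_triangle:
  assumes "dist x y \<le> R" "0 \<le> c"
  shows "exp_neg (ennreal c * sublevel_radius V x u) \<le> ennreal (exp (c * R)) * exp_neg (ennreal c * sublevel_radius V y u)"
proof -
  have R: "0 \<le> R" using assms zero_le_dist[of x y] by linarith
  have "exp_neg (ennreal c * sublevel_radius V x u) * exp_neg (ennreal (c * R))
      = exp_neg (ennreal c * (sublevel_radius V x u + ennreal R))"
    using assms R by (simp add: exp_neg_add distrib_left ennreal_mult)
  also have "\<dots> \<le> exp_neg (ennreal c * sublevel_radius V y u)"
    by (intro exp_neg_antimono mult_left_mono sublevel_radius_triangle assms) simp
  finally have "ennreal (exp (c * R)) * (exp_neg (ennreal c * sublevel_radius V x u) * exp_neg (ennreal (c * R)))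
      \<le> ennreal (exp (c * R)) * exp_neg (ennreal c * sublevel_radius V y u)"
    by (rule mult_left_mono) simp
  moreover have "ennreal (exp (c * R)) * (z * exp_neg (ennreal (c * R))) = z" for z
  proof -
    have "ennreal (exp (c * R)) * exp_neg (ennreal (c * R)) = 1"
      using assms R by (simp add: exp_neg_ennreal flip: ennreal_mult exp_add)
    then show ?thesis by (metis mult.left_commute mult.right_neutral)
  qed
  ultimately show ?thesis by simp
qed

section \<open>Short-time decay of the semigroup from the bound on \<open>I_fun\<close>\<close>

lemma rho_antimono:
  assumes "0 \<le> V x" "0 < s" "s \<le> u"
  shows "rho V x s \<le> rho V x u"
  unfolding rho_def
proof (rule SUP_subset_mono)
  have "V x / u \<le> V x / s" using assms by (intro divide_left_mono) auto
  then show "{r. 0 \<le> r \<and> (AE y in lebesgue. y \<in> cball x r \<longrightarrow> V x / s \<le> V y)}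
      \<subseteq> {r. 0 \<le> r \<and> (AE y in lebesgue. y \<in> cball x r \<longrightarrow> V x / u \<le> V y)}"
    by (auto elim!: eventually_mono)
qed simp

lemma nn_integral_powr_Icc:
  fixes b u :: real
  assumes "0 < b" "1 \<le> u"
  shows "(\<integral>\<^sup>+s\<in>{1..u}. ennreal (s powr (b - 1)) \<partial>lborel) = ennreal ((u powr b - 1) / b)"
proof -
  have "((\<lambda>s. s powr (b - 1)) has_integral (u powr b / b - 1 powr b / b)) {1..u}"
    using assms by (intro fundamental_theorem_of_calculus)
      (auto intro!: derivative_eq_intros simp flip: has_real_derivative_iff_has_vector_derivative)
  then show ?thesis
    by (subst nn_integral_has_integral_lebesgue') (auto simp: diff_divide_distrib)
qed

text \<open>A Chebyshev argument: the exponential in \<open>I_fun\<close> decreases in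
  \<open>s\<close>, so its value at \<open>u\<close> times the integral of
  \<open>s powr (b - 1)\<close> over \<open>{1..u}\<close> is at most \<open>C\<close>.\<close>

lemma exp_neg_rho_le_of_I_fun:
  fixes V :: "'a::euclidean_space \<Rightarrow> real"
  assumes I: "I_fun b V x \<le> ennreal C" "0 \<le> C" and b: "0 < b" and u: "1 \<le> u" "u \<le> V x"
  shows "exp_neg ((rho V x u)\<^sup>2 / ennreal (4 * real DIM('a))) \<le> ennreal ((b * C + 1) * u powr - b)"
    (is "?\<psi> u \<le> _")
proof -
  have fin: "?\<psi> u \<le> 1" by (rule exp_neg_le_1)
  then obtain p where p: "?\<psi> u = ennreal p" "0 \<le> p" by (cases "?\<psi> u") (auto simp: top_unique)
  have p1: "p \<le> 1" using fin p by simp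
  have "ennreal p * ennreal ((u powr b - 1) / b) = (\<integral>\<^sup>+s. ennreal p * (ennreal (s powr (b - 1)) * indicator {1..u} s) \<partial>lborel)"
    unfolding nn_integral_powr_Icc[OF b u(1), symmetric] by (rule nn_integral_cmult[symmetric]) measurable
  also have "\<dots> \<le> I_fun b V x"
    unfolding I_fun_def
  proof (rule nn_integral_mono)
    fix s :: real
    show "ennreal p * (ennreal (s powr (b - 1)) * indicator {1..u} s) \<le> ennreal (s powr (b - 1)) * ?\<psi> s * indicator {1..max 1 (V x)} s"
    proof (cases "s \<in> {1..u}")
      case True
      then have "?\<psi> u \<le> ?\<psi> s"
        using u by (intro exp_neg_antimono divide_right_mono_ennreal power_mono rho_antimono) auto
      then have "ennreal (s powr (b - 1)) * ennreal p \<le> ennreal (s powr (b - 1)) * ?\<psi> s" unfolding p by (rule mult_left_mono) simp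
      then show ?thesis using True u by (auto simp: mult.commute)
    qed simp
  qed
  also have "\<dots> \<le> ennreal C" by fact
  finally have "p * ((u powr b - 1) / b) \<le> C"
    using p I b u by (subst (asm) ennreal_mult[symmetric]) (auto simp: ge_one_powr_ge_zero)
  \<comment> \<open>The summand \<open>p \<le> 1\<close> comes from the lower limit \<open>1\<close>
    of the integral; it becomes the \<open>+ 1\<close> in the constant.\<close>
  then have "p * u powr b \<le> b * C + p" using b by (simp add: field_simps)
  also have "\<dots> \<le> b * C + 1" using p1 by simp
  finally have "p \<le> (b * C + 1) * u powr - b" using u by (simp add: powr_minus field_simps)
  then show ?thesis unfolding p by (rule ennreal_leI)
qed

context brownian_motion
begin

text \<open>The lower bound \<open>V x / u\<close>, valid on each ball with a radius admissible for
  \<open>rho V x u\<close>, goes into \<open>feynman_kac_1_le_of_lower_bound\<close>. Since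
  \<open>t \<le> 1 \<le> DIM('a)\<close>, the tail is at most
  \<open>exp (- r\<^sup>2 / (4 * DIM('a)))\<close>, the exponential in \<open>I_fun\<close>.\<close>

lemma feynman_kac_le_rho:
  assumes t: "0 < t" "t \<le> 1" and u: "0 < u" and [measurable]: "V \<in> borel_measurable borel" and V: "0 \<le> V x"
  shows "feynman_kac (\<lambda>y. ennreal (V y)) t (\<lambda>_. 1) x \<le> ennreal (exp (- t * (V x / u)))
    + ennreal (sqrt 2 ^ DIM('a)) * exp_neg ((rho V x u)\<^sup>2 / ennreal (4 * real DIM('a)))"
proof -
  let ?e = "feynman_kac (\<lambda>y. ennreal (V y)) t (\<lambda>_. 1) x"
  let ?p = "ennreal (exp (- t * (V x / u)))"
  \<comment> \<open>Only the tail depends on \<open>r\<close>; the other exponential is subtracted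
    before passing to the supremum over \<open>r\<close>.\<close>
  have "?e - ?p \<le> ennreal (sqrt 2 ^ DIM('a) * exp (- (1 / (4 * real DIM('a))) * r\<^sup>2))"
    if r: "0 \<le> r" "AE y in lebesgue. y \<in> cball x r \<longrightarrow> V x / u \<le> V y" for r
  proof -
    have "AE y in lborel. y \<in> cball x r \<longrightarrow> ennreal (V x / u) \<le> ennreal (V y)"
      using r(2) unfolding AE_completion_iff by (rule eventually_mono) (auto intro: ennreal_leI)
    then have "?e \<le> ennreal (exp (- t * (V x / u)) + sqrt 2 ^ DIM('a) * exp (- r\<^sup>2 / (4 * t)))"
      by (rule feynman_kac_1_le_of_lower_bound) (use V u r t in auto)
    also have "\<dots> \<le> ennreal (exp (- t * (V x / u)) + sqrt 2 ^ DIM('a) * exp (- (1 / (4 * real DIM('a))) * r\<^sup>2))"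
    proof (intro ennreal_leI add_left_mono mult_left_mono)
      have "1 \<le> real DIM('a)" using DIM_positive[where 'a='a] by linarith
      then have "t \<le> real DIM('a)" using t by linarith
      then have "r\<^sup>2 / (4 * real DIM('a)) \<le> r\<^sup>2 / (4 * t)" using t by (intro divide_left_mono) auto
      then show "exp (- r\<^sup>2 / (4 * t)) \<le> exp (- (1 / (4 * real DIM('a))) * r\<^sup>2)" by simp
    qed simp
    also have "\<dots> = ?p + ennreal (sqrt 2 ^ DIM('a) * exp (- (1 / (4 * real DIM('a))) * r\<^sup>2))"
      by (simp add: ennreal_plus)
    finally show ?thesis by (simp add: ennreal_minus_le_iff)
  qed
  then have "?e - ?p \<le> ennreal (sqrt 2 ^ DIM('a)) * exp_neg (ennreal (1 / (4 * real DIM('a))) * (rho V x u)\<^sup>2)"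
    unfolding rho_def using AE_cball_0[of x "\<lambda>y. V x / u \<le> V y"]
    by (intro le_exp_neg_SUP) (auto intro!: exI[of _ 0] simp del: mem_cball)
  moreover have "ennreal (1 / (4 * real DIM('a))) * (rho V x u)\<^sup>2 = (rho V x u)\<^sup>2 / ennreal (4 * real DIM('a))"
    by (simp add: divide_ennreal_def inverse_ennreal inverse_eq_divide mult.commute)
  ultimately show ?thesis by (simp add: ennreal_minus_le_iff)
qed

text \<open>The free level is \<open>u = (t * V x) powr \<gamma>\<close>. Then
  \<open>exp (- t * (V x / u))\<close> decays faster than any power of \<open>t * V x\<close>, and
  the \<open>rho\<close> term decays like \<open>u powr - b\<close>, which costs the step from
  \<open>b\<close> to \<open>b * \<gamma>\<close>. The exponent \<open>p\<close> solves
  \<open>(1 - \<gamma>) * p = b * \<gamma>\<close>.\<close>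

lemma feynman_kac_le_of_I_fun:
  assumes t: "0 < t" "t \<le> 1" and b: "0 < b" and \<gamma>: "0 < \<gamma>" "\<gamma> < 1"
    and [measurable]: "V \<in> borel_measurable borel" and Vx: "1 \<le> V x"
    and I: "I_fun b V x \<le> ennreal C" "0 \<le> C"
  defines "p \<equiv> b * \<gamma> / (1 - \<gamma>)"
  shows "feynman_kac (\<lambda>y. ennreal (V y)) t (\<lambda>_. 1) x
    \<le> ennreal ((p powr p + sqrt 2 ^ DIM('a) * (b * C + 1)) * min 1 ((t * V x) powr - (b * \<gamma>)))"
    (is "_ \<le> ennreal (?C0 * _)")
proof -
  let ?D = "sqrt 2 ^ DIM('a)"
  have D: "1 \<le> ?D" by (rule one_le_power) simp
  have "1 * 1 \<le> ?D * (b * C + 1)" using D b I by (intro mult_mono) auto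
  then have C0: "1 \<le> ?C0" by (simp add: add_increasing)
  show ?thesis
  proof (cases "1 \<le> t * V x")
    case False
    then have "1 \<le> (t * V x) powr - (b * \<gamma>)"
      using t Vx b \<gamma> by (simp add: powr_minus one_le_inverse powr_le1)
    then have "ennreal 1 \<le> ennreal (?C0 * min 1 ((t * V x) powr - (b * \<gamma>)))"
      using C0 by (intro ennreal_leI) simp
    then show ?thesis unfolding ennreal_1 by (rule order_trans[OF feynman_kac_1_le_1])
  next
    case True
    define y where "y = t * V x"
    define u where "u = y powr \<gamma>"
    have y: "1 \<le> y" using True by (simp add: y_def)
    \<comment> \<open>\<open>u \<le> V x\<close> is the range in which \<open>I_fun\<close> is
      informative; here \<open>t \<le> 1\<close> enters.\<close>
    have "u \<le> y powr 1" unfolding u_def using y \<gamma> by (intro powr_mono) auto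
    also have "\<dots> \<le> V x" using t Vx y by (simp add: y_def mult_left_le_one_le)
    finally have u: "1 \<le> u" "u \<le> V x" using y \<gamma> by (simp_all add: u_def ge_one_powr_ge_zero)
    have p: "0 < p" using b \<gamma> by (simp add: p_def)
    have e1: "exp (- t * (V x / u)) \<le> p powr p * y powr - (b * \<gamma>)"
    proof -
      have yu: "t * (V x / u) = y powr (1 - \<gamma>)" using y by (simp add: u_def y_def powr_diff)
      have "(y powr (1 - \<gamma>)) powr p \<le> p powr p * exp (y powr (1 - \<gamma>))"
        using y p by (intro powr_le_exp) auto
      moreover have "(y powr (1 - \<gamma>)) powr p = y powr (b * \<gamma>)" using \<gamma> by (simp add: powr_powr p_def)
      ultimately have "exp (- (y powr (1 - \<gamma>))) \<le> p powr p * y powr - (b * \<gamma>)"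
        using y by (simp add: exp_minus powr_minus field_simps)
      then show ?thesis using yu by simp
    qed
    have e2: "u powr - b = y powr - (b * \<gamma>)" by (simp add: u_def powr_powr mult.commute)
    have "feynman_kac (\<lambda>y. ennreal (V y)) t (\<lambda>_. 1) x \<le> ennreal (exp (- t * (V x / u)))
        + ennreal ?D * exp_neg ((rho V x u)\<^sup>2 / ennreal (4 * real DIM('a)))"
      by (rule feynman_kac_le_rho) (use t u Vx in auto)
    also have "\<dots> \<le> ennreal (p powr p * y powr - (b * \<gamma>)) + ennreal ?D * ennreal ((b * C + 1) * u powr - b)"
      by (intro add_mono ennreal_leI e1 mult_left_mono exp_neg_rho_le_of_I_fun I b u) simp
    also have "\<dots> = ennreal (?C0 * y powr - (b * \<gamma>))"
      using b I(2) unfolding e2 by (simp add: algebra_simps flip: ennreal_plus ennreal_mult)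
    also have "\<dots> = ennreal (?C0 * min 1 ((t * V x) powr - (b * \<gamma>)))"
    proof -
      have "y powr - (b * \<gamma>) \<le> 1" using y b \<gamma> by (simp add: powr_minus inverse_le_1_iff ge_one_powr_ge_zero)
      then show ?thesis by (simp add: y_def)
    qed
    finally show ?thesis .
  qed
qed

lemma feynman_kac_const: "v \<in> borel_measurable borel \<Longrightarrow> 0 \<le> t \<Longrightarrow> feynman_kac v t (\<lambda>_. C) x = C * feynman_kac v t (\<lambda>_. 1) x"
proof -
  assume [measurable]: "v \<in> borel_measurable borel"
  have [measurable]: "(\<lambda>\<omega>. \<integral>\<^sup>+s\<in>{0..t}. v (x + X s \<omega>) \<partial>lborel) \<in> borel_measurable M"
    by (rule borel_measurable_occupation) auto
  show ?thesis unfolding feynman_kac_def by (simp add: nn_integral_cmult mult.commute[of _ C])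
qed

text \<open>For \<open>t > 1\<close> the first unit of time uses the bound that depends on
  \<open>V x\<close>, and the remaining time the uniform decay; the product keeps both.\<close>

lemma feynman_kac_decay_step:
  assumes t: "1 < t" and [measurable]: "v \<in> borel_measurable borel"
    and dec: "AE y in lborel. feynman_kac v (t - 1) (\<lambda>_. 1) y \<le> C"
  shows "feynman_kac v t (\<lambda>_. 1) x \<le> C * feynman_kac v 1 (\<lambda>_. 1) x"
proof -
  have "feynman_kac v t (\<lambda>_. 1) x = feynman_kac v 1 (feynman_kac v (t - 1) (\<lambda>_. 1)) x"
    using feynman_kac_semigroup[of 1 "t - 1" v "\<lambda>_. 1" x] t by simp
  also have "\<dots> \<le> feynman_kac v 1 (\<lambda>_. C) x"
    by (rule feynman_kac_mono_AE[OF dec]) simp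
  also have "\<dots> = C * feynman_kac v 1 (\<lambda>_. 1) x" by (rule feynman_kac_const) auto
  finally show ?thesis .
qed

text \<open>Exponential decay gives one null set for each time. Integer times need only countably
  many, and monotonicity in time covers the others at the cost of a factor
  \<open>exp \<delta>\<close>.\<close>

lemma feynman_kac_decay_all_times:
  assumes "exponential_decay M X V \<delta>" and \<delta>: "0 < \<delta>"
  obtains C where "1 \<le> C"
    "AE x in lborel. \<forall>t>0. feynman_kac (\<lambda>y. ennreal (V y)) t (\<lambda>_. 1) x \<le> ennreal (C * exp (- \<delta> * t))"
proof -
  let ?e = "\<lambda>t x. feynman_kac (\<lambda>y. ennreal (V y)) t (\<lambda>_. 1) x"
  obtain C where C: "0 < C" "\<And>t. 0 < t \<Longrightarrow> AE x in lborel. ?e t x \<le> ennreal (C * exp (- \<delta> * t))"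
    using assms(1) unfolding exponential_decay_def schroedinger_semigroup_eq_feynman_kac AE_completion_iff by auto
  define C' where "C' = max 1 C * exp \<delta>"
  have "AE x in lborel. \<forall>n::nat. ?e (real (Suc n)) x \<le> ennreal (C * exp (- \<delta> * real (Suc n)))"
    unfolding AE_all_countable using C(2) by (auto simp del: of_nat_Suc)
  then have "AE x in lborel. \<forall>t>0. ?e t x \<le> ennreal (C' * exp (- \<delta> * t))"
  proof (rule eventually_mono, safe)
    fix x and t :: real
    assume n: "\<forall>n::nat. ?e (real (Suc n)) x \<le> ennreal (C * exp (- \<delta> * real (Suc n)))" and t: "0 < t"
    show "?e t x \<le> ennreal (C' * exp (- \<delta> * t))"
    proof (cases "t < 1")
      case True
      have "1 * 1 \<le> max 1 C * exp (\<delta> + - \<delta> * t)"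
        using True \<delta> by (intro mult_mono) auto
      then have "ennreal 1 \<le> ennreal (C' * exp (- \<delta> * t))"
        unfolding C'_def by (intro ennreal_leI) (simp add: mult.assoc flip: exp_add)
      then show ?thesis unfolding ennreal_1 by (rule order_trans[OF feynman_kac_1_le_1])
    next
      case False
      define n where "n = nat \<lfloor>t\<rfloor> - 1"
      have nt: "real (Suc n) \<le> t" "t \<le> real (Suc n) + 1"
        using False unfolding n_def by linarith+
      have "?e t x \<le> ?e (real (Suc n)) x" using nt by (intro feynman_kac_antimono_time)
      also have "\<dots> \<le> ennreal (C * exp (- \<delta> * real (Suc n)))" using n by blast
      also have "\<dots> \<le> ennreal (C' * exp (- \<delta> * t))"
      proof (rule ennreal_leI)
        have "\<delta> * t \<le> \<delta> * (real (Suc n) + 1)" using nt \<delta> by (intro mult_left_mono) auto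
        then have "C * exp (- \<delta> * real (Suc n)) \<le> max 1 C * exp (\<delta> + - \<delta> * t)"
          using C(1) by (intro mult_mono) (auto simp: algebra_simps)
        then show "C * exp (- \<delta> * real (Suc n)) \<le> C' * exp (- \<delta> * t)"
          unfolding C'_def by (simp add: mult.assoc flip: exp_add)
      qed
      finally show ?thesis .
    qed
  qed
  moreover have "1 * 1 \<le> C'" unfolding C'_def using \<delta> by (intro mult_mono) auto
  ultimately show thesis using that by simp
qed

end

subsection \<open>The adjoint Riesz transform of the constant function\<close>

text \<open>Discard the countably many basic open sets that meet \<open>Z\<close> in a null set;
  each neighbourhood of a remaining point of \<open>Z\<close> meets \<open>Z\<close> in a non-null
  set. It is applied to the zero set of the potential.\<close>

lemma AE_in_support:
  fixes Z :: "'a::second_countable_topology set"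
  shows "AE x in M. x \<in> Z \<longrightarrow> (\<forall>U. open U \<longrightarrow> x \<in> U \<longrightarrow> \<not> (AE y in M. y \<in> U \<longrightarrow> y \<notin> Z))"
proof -
  obtain \<B> :: "'a set set" where \<B>: "countable \<B>" "topological_basis \<B>"
    using ex_countable_basis by auto
  let ?\<B> = "{B \<in> \<B>. AE y in M. y \<in> B \<longrightarrow> y \<notin> Z}"
  have "AE x in M. \<forall>B\<in>?\<B>. x \<in> B \<longrightarrow> x \<notin> Z"
    using countable_subset[OF _ \<B>(1), of ?\<B>] by (subst AE_ball_countable) auto
  then show ?thesis
  proof (rule eventually_mono, safe)
    fix x U assume x: "\<forall>B\<in>?\<B>. x \<in> B \<longrightarrow> x \<notin> Z" "x \<in> Z" and U: "open U" "x \<in> U"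
      and ae: "AE y in M. y \<in> U \<longrightarrow> y \<notin> Z"
    obtain B where B: "B \<in> \<B>" "x \<in> B" "B \<subseteq> U" using \<B>(2) U by (rule topological_basisE)
    have "AE y in M. y \<in> B \<longrightarrow> y \<notin> Z" using ae B(3) by (auto elim!: eventually_mono)
    then show False using x B by blast
  qed
qed

context brownian_motion
begin

text \<open>\<open>Gamma a\<close> times the adjoint of the Riesz transform applied to the constant
  \<open>1\<close>; the normalisation is put back in the final estimate.\<close>

definition dual_riesz :: "real \<Rightarrow> ('a \<Rightarrow> real) \<Rightarrow> 'a \<Rightarrow> ennreal" where
  "dual_riesz a V x = (\<integral>\<^sup>+t\<in>{0<..}. feynman_kac (\<lambda>y. ennreal (V y)) t (\<lambda>y. ennreal (V y powr a)) x *
    ennreal (t powr (a - 1)) \<partial>lborel)"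

text \<open>With \<open>q = C * exp (- \<delta> * t)\<close>, half of the decay in
  \<open>q powr \<theta>\<close> pays for the tails and the other half makes the time integral
  finite. The level \<open>w\<close> is \<open>V x\<close> for \<open>0 < V x \<le> 1\<close> and
  the value at a nearby point if \<open>V x = 0\<close>.\<close>

lemma dual_riesz_le_of_decay:
  assumes a: "0 < a" and w: "0 < w" and \<theta>: "0 < \<theta>" "\<theta> < 1" and c: "0 < c" "c \<le> (1 - \<theta>) / 4" "c \<le> \<theta> * \<delta> / 2"
    and \<delta>: "0 < \<delta>" and [measurable]: "V \<in> borel_measurable borel" and V: "\<And>y. 0 \<le> V y"
    and C: "0 \<le> C" "\<And>t. 0 < t \<Longrightarrow> feynman_kac (\<lambda>y. ennreal (V y)) t (\<lambda>_. 1) x \<le> ennreal (C * exp (- \<delta> * t))"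
    and H: "0 \<le> H" "sublevel_integral c a V x w \<le> ennreal H"
  shows "dual_riesz a V x \<le> ennreal ((1 + a) * sqrt 2 ^ DIM('a) * C powr \<theta> * H) *
    (\<integral>\<^sup>+t\<in>{0<..}. ennreal (t powr (a - 1) * exp (- (\<theta> * \<delta> / 2) * t)) \<partial>lborel)"
    (is "_ \<le> ennreal ?K * _")
proof -
  have "dual_riesz a V x \<le> (\<integral>\<^sup>+t. ennreal ?K * (ennreal (t powr (a - 1) * exp (- (\<theta> * \<delta> / 2) * t)) * indicator {0<..} t) \<partial>lborel)"
    unfolding dual_riesz_def
  proof (rule nn_integral_mono)
    fix t :: real
    let ?F = "feynman_kac (\<lambda>y. ennreal (V y)) t (\<lambda>y. ennreal (V y powr a)) x"
    show "?F * ennreal (t powr (a - 1)) * indicator {0<..} t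
        \<le> ennreal ?K * (ennreal (t powr (a - 1) * exp (- (\<theta> * \<delta> / 2) * t)) * indicator {0<..} t)"
    proof (cases "0 < t")
      case t: True
      let ?q = "C * exp (- \<delta> * t)"
      have e: "?q powr \<theta> * exp (\<theta> * \<delta> * t / 2) = C powr \<theta> * exp (- (\<theta> * \<delta> / 2) * t)"
      proof -
        have "- \<delta> * t * \<theta> + \<theta> * \<delta> * t / 2 = - (\<theta> * \<delta> / 2) * t" by (simp add: field_simps)
        then have "exp (- \<delta> * t * \<theta>) * exp (\<theta> * \<delta> * t / 2) = exp (- (\<theta> * \<delta> / 2) * t)"
          by (simp only: exp_add[symmetric])
        then show ?thesis by (simp only: powr_mult exp_powr_real mult.assoc)
      qed
      have "?F \<le> ennreal ((1 + a) * sqrt 2 ^ DIM('a) * (?q powr \<theta> * exp (\<theta> * \<delta> * t / 2))) * sublevel_integral c a V x w"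
        by (rule feynman_kac_powr_le[OF a w \<theta> c t \<delta>]) (use C t V in auto)
      also have "\<dots> \<le> ennreal ((1 + a) * sqrt 2 ^ DIM('a) * (?q powr \<theta> * exp (\<theta> * \<delta> * t / 2))) * ennreal H"
        by (intro mult_left_mono H) simp
      also have "\<dots> = ennreal (?K * exp (- (\<theta> * \<delta> / 2) * t))"
        unfolding e using a H by (subst ennreal_mult[symmetric]) (simp_all add: mult_ac)
      finally have "?F * ennreal (t powr (a - 1)) \<le> ennreal (?K * exp (- (\<theta> * \<delta> / 2) * t)) * ennreal (t powr (a - 1))"
        by (rule mult_right_mono) simp
      also have "\<dots> = ennreal ?K * ennreal (t powr (a - 1) * exp (- (\<theta> * \<delta> / 2) * t))"
        using a H by (subst (1 2) ennreal_mult[symmetric]) (simp_all add: mult_ac)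
      finally show ?thesis using t by simp
    qed simp
  qed
  also have "\<dots> = ennreal ?K * (\<integral>\<^sup>+t\<in>{0<..}. ennreal (t powr (a - 1) * exp (- (\<theta> * \<delta> / 2) * t)) \<partial>lborel)"
    by (rule nn_integral_cmult) measurable
  finally show ?thesis .
qed

text \<open>Here \<open>b\<close> is the exponent of the decay in \<open>t * V x\<close>, in the
  application the reduced one \<open>b * \<gamma>\<close>. For \<open>t \<le> 1\<close> scaling
  removes \<open>V x powr a\<close>; for \<open>t > 1\<close> the factor
  \<open>V x powr (a - \<theta> * b)\<close> is at most \<open>1\<close>.\<close>

lemma dual_riesz_le_of_large_potential:
  assumes a: "0 < a" and \<theta>: "0 < \<theta>" "\<theta> < 1" and c: "0 < c" "c \<le> (1 - \<theta>) / 4" "c \<le> \<theta> * \<delta> / 2"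
    and \<delta>: "0 < \<delta>" and [measurable]: "V \<in> borel_measurable borel" and V: "\<And>y. 0 \<le> V y" "1 \<le> V x"
    and \<beta>: "a \<le> \<theta> * b" and C: "0 \<le> C"
    and small: "\<And>t. 0 < t \<Longrightarrow> t \<le> 1 \<Longrightarrow> feynman_kac (\<lambda>y. ennreal (V y)) t (\<lambda>_. 1) x \<le> ennreal (C * min 1 ((t * V x) powr - b))"
    and large: "\<And>t. 1 < t \<Longrightarrow> feynman_kac (\<lambda>y. ennreal (V y)) t (\<lambda>_. 1) x \<le> ennreal (C * V x powr - b * exp (- \<delta> * t))"
    and H: "0 \<le> H" "sublevel_integral c a V x (V x) \<le> ennreal (V x powr a * H)"
  shows "dual_riesz a V x \<le> ennreal ((1 + a) * sqrt 2 ^ DIM('a) * C powr \<theta> * exp (\<theta> * \<delta> / 2) * H) *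
    ((\<integral>\<^sup>+t\<in>{0<..}. ennreal (t powr (a - 1) * min 1 (t powr - (\<theta> * b))) \<partial>lborel) +
     (\<integral>\<^sup>+t\<in>{0<..}. ennreal (t powr (a - 1) * exp (- (\<theta> * \<delta> / 2) * t)) \<partial>lborel))"
    (is "_ \<le> ennreal ?K * _")
proof -
  let ?v = "V x"
  let ?f = "\<lambda>t. ?v powr a * (t powr (a - 1) * min 1 ((t * ?v) powr - (\<theta> * b)))"
  let ?g = "\<lambda>t. t powr (a - 1) * exp (- (\<theta> * \<delta> / 2) * t)"
  have "dual_riesz a V x \<le> (\<integral>\<^sup>+t. ennreal ?K * (ennreal (?f t) * indicator {0<..} t + ennreal (?g t) * indicator {0<..} t) \<partial>lborel)"
    unfolding dual_riesz_def
  proof (rule nn_integral_mono)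
    fix t :: real
    let ?F = "feynman_kac (\<lambda>y. ennreal (V y)) t (\<lambda>y. ennreal (V y powr a)) x"
    show "?F * ennreal (t powr (a - 1)) * indicator {0<..} t
        \<le> ennreal ?K * (ennreal (?f t) * indicator {0<..} t + ennreal (?g t) * indicator {0<..} t)"
    proof (cases "0 < t")
      case t: True
      define q where "q = (if t \<le> 1 then C * min 1 ((t * ?v) powr - b) else C * ?v powr - b * exp (- \<delta> * t))"
      have q: "0 \<le> q" "feynman_kac (\<lambda>y. ennreal (V y)) t (\<lambda>_. 1) x \<le> ennreal q"
        using small[OF t] large[of t] C by (auto simp: q_def)
      have e: "q powr \<theta> * exp (\<theta> * \<delta> * t / 2) * ?v powr a
          \<le> C powr \<theta> * exp (\<theta> * \<delta> / 2) * (?v powr a * min 1 ((t * ?v) powr - (\<theta> * b)) + exp (- (\<theta> * \<delta> / 2) * t))"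
      proof (cases "t \<le> 1")
        case True
        have m: "min 1 ((t * ?v) powr - b) powr \<theta> \<le> min 1 ((t * ?v) powr - (\<theta> * b))"
        proof (rule min.boundedI)
          have "min 1 ((t * ?v) powr - b) powr \<theta> \<le> 1 powr \<theta>" using \<theta> by (intro powr_mono2) auto
          then show "min 1 ((t * ?v) powr - b) powr \<theta> \<le> 1" by simp
          have "min 1 ((t * ?v) powr - b) powr \<theta> \<le> ((t * ?v) powr - b) powr \<theta>" using \<theta> by (intro powr_mono2) auto
          then show "min 1 ((t * ?v) powr - b) powr \<theta> \<le> (t * ?v) powr - (\<theta> * b)" by (simp add: powr_powr mult.commute)
        qed
        have "q powr \<theta> * exp (\<theta> * \<delta> * t / 2) * ?v powr a
            = C powr \<theta> * (min 1 ((t * ?v) powr - b) powr \<theta> * exp (\<theta> * \<delta> * t / 2)) * ?v powr a"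
          using True C by (simp add: q_def powr_mult mult_ac)
        also have "\<dots> \<le> C powr \<theta> * (min 1 ((t * ?v) powr - (\<theta> * b)) * exp (\<theta> * \<delta> / 2)) * ?v powr a"
          using m True \<theta> \<delta> by (intro mult_mono mult_left_mono mult_right_mono) auto
        also have "\<dots> \<le> C powr \<theta> * exp (\<theta> * \<delta> / 2) * (?v powr a * min 1 ((t * ?v) powr - (\<theta> * b)) + exp (- (\<theta> * \<delta> / 2) * t))"
          by (simp add: algebra_simps)
        finally show ?thesis .
      next
        case False
        have ee: "exp (- \<delta> * t * \<theta>) * exp (\<theta> * \<delta> * t / 2) = exp (- (\<theta> * \<delta> / 2) * t)"
        proof -
          have "- \<delta> * t * \<theta> + \<theta> * \<delta> * t / 2 = - (\<theta> * \<delta> / 2) * t" by (simp add: field_simps)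
          then show ?thesis by (simp only: exp_add[symmetric])
        qed
        have "q powr \<theta> = C powr \<theta> * ?v powr - (\<theta> * b) * exp (- \<delta> * t * \<theta>)"
          using False by (simp only: q_def if_False powr_mult exp_powr_real powr_powr) (simp add: mult.commute)
        then have "q powr \<theta> * exp (\<theta> * \<delta> * t / 2) * ?v powr a
            = C powr \<theta> * (?v powr - (\<theta> * b) * ?v powr a) * exp (- (\<theta> * \<delta> / 2) * t)"
          unfolding ee[symmetric] by (simp only: mult_ac)
        also have "?v powr - (\<theta> * b) * ?v powr a = ?v powr (a - \<theta> * b)" by (simp flip: powr_add)
        also have "C powr \<theta> * ?v powr (a - \<theta> * b) * exp (- (\<theta> * \<delta> / 2) * t) \<le> C powr \<theta> * exp (\<theta> * \<delta> / 2) * exp (- (\<theta> * \<delta> / 2) * t)"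
        proof (intro mult_right_mono mult_left_mono)
          have "?v powr (a - \<theta> * b) \<le> ?v powr 0" using V \<beta> by (intro powr_mono) auto
          also have "\<dots> \<le> exp (\<theta> * \<delta> / 2)" using V \<theta> \<delta> by auto
          finally show "?v powr (a - \<theta> * b) \<le> exp (\<theta> * \<delta> / 2)" .
        qed auto
        also have "\<dots> \<le> C powr \<theta> * exp (\<theta> * \<delta> / 2) * (?v powr a * min 1 ((t * ?v) powr - (\<theta> * b)) + exp (- (\<theta> * \<delta> / 2) * t))"
          by (intro mult_left_mono) auto
        finally show ?thesis .
      qed
      have "?F \<le> ennreal ((1 + a) * sqrt 2 ^ DIM('a) * (q powr \<theta> * exp (\<theta> * \<delta> * t / 2))) * sublevel_integral c a V x ?v"
        by (rule feynman_kac_powr_le[OF a _ \<theta> c t \<delta> q]) (use V in auto)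
      also have "\<dots> \<le> ennreal ((1 + a) * sqrt 2 ^ DIM('a) * (q powr \<theta> * exp (\<theta> * \<delta> * t / 2))) * ennreal (?v powr a * H)"
        by (intro mult_left_mono H) simp
      also have "\<dots> = ennreal ((1 + a) * sqrt 2 ^ DIM('a) * H * (q powr \<theta> * exp (\<theta> * \<delta> * t / 2) * ?v powr a))"
        using a H by (subst ennreal_mult[symmetric]) (simp_all add: mult_ac)
      also have "\<dots> \<le> ennreal ((1 + a) * sqrt 2 ^ DIM('a) * H * (C powr \<theta> * exp (\<theta> * \<delta> / 2) * (?v powr a * min 1 ((t * ?v) powr - (\<theta> * b)) + exp (- (\<theta> * \<delta> / 2) * t))))"
        using e a H by (intro ennreal_leI mult_left_mono) auto
      also have "\<dots> = ennreal (?K * (?v powr a * min 1 ((t * ?v) powr - (\<theta> * b)) + exp (- (\<theta> * \<delta> / 2) * t)))"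
        by (simp only: mult_ac)
      finally have "?F * ennreal (t powr (a - 1)) \<le> ennreal (?K * (?v powr a * min 1 ((t * ?v) powr - (\<theta> * b)) + exp (- (\<theta> * \<delta> / 2) * t))) * ennreal (t powr (a - 1))"
        by (rule mult_right_mono) simp
      also have "\<dots> = ennreal (?K * ((?v powr a * min 1 ((t * ?v) powr - (\<theta> * b)) + exp (- (\<theta> * \<delta> / 2) * t)) * t powr (a - 1)))"
        by (subst ennreal_mult''[symmetric]) (simp_all only: mult.assoc powr_ge_zero)
      also have "\<dots> = ennreal ?K * ennreal ((?v powr a * min 1 ((t * ?v) powr - (\<theta> * b)) + exp (- (\<theta> * \<delta> / 2) * t)) * t powr (a - 1))"
        using a H by (intro ennreal_mult') auto
      also have "ennreal ((?v powr a * min 1 ((t * ?v) powr - (\<theta> * b)) + exp (- (\<theta> * \<delta> / 2) * t)) * t powr (a - 1)) = ennreal (?f t) + ennreal (?g t)"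
        by (subst ennreal_plus[symmetric]) (simp_all add: algebra_simps del: ennreal_plus)
      finally show ?thesis using t by simp
    qed simp
  qed
  also have "\<dots> = ennreal ?K * (\<integral>\<^sup>+t. ennreal (?f t) * indicator {0<..} t + ennreal (?g t) * indicator {0<..} t \<partial>lborel)"
    by (rule nn_integral_cmult) measurable
  also have "(\<integral>\<^sup>+t. ennreal (?f t) * indicator {0<..} t + ennreal (?g t) * indicator {0<..} t \<partial>lborel)
      = (\<integral>\<^sup>+t\<in>{0<..}. ennreal (?f t) \<partial>lborel) + (\<integral>\<^sup>+t\<in>{0<..}. ennreal (?g t) \<partial>lborel)"
    by (rule nn_integral_add) measurable
  also have "(\<integral>\<^sup>+t\<in>{0<..}. ennreal (?f t) \<partial>lborel) = (\<integral>\<^sup>+t\<in>{0<..}. ennreal (t powr (a - 1) * min 1 (t powr - (\<theta> * b))) \<partial>lborel)"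
    by (rule nn_integral_powr_min_scale) (use V in auto)
  finally show ?thesis .
qed

text \<open>With \<open>z\<close> the weight and \<open>y\<close> the value of
  \<open>V powr a\<close> at the endpoint, Young's inequality and \<open>z \<le> 1\<close> give
  \<open>z * y \<le> l / 2 * z + y\<^sup>2 / (2 * l)\<close>. The decay bounds the mean of the first
  summand, a Gaussian moment that of the second.\<close>

lemma dual_riesz_bounded_on_ball:
  assumes a: "0 < a" and \<eta>: "0 < \<eta>" and \<delta>: "0 < \<delta>" "2 * (a * \<eta>)\<^sup>2 < \<delta>" and C1: "0 < C1"
    and [measurable]: "V \<in> borel_measurable borel" and V: "\<And>y. 0 \<le> V y" "\<And>y. V y \<le> C1 * exp (\<eta> * norm y)"
    and C: "0 \<le> C"
  obtains H where "0 \<le> H" "\<And>x. norm x \<le> R \<Longrightarrow>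
    (\<And>t. 0 < t \<Longrightarrow> feynman_kac (\<lambda>y. ennreal (V y)) t (\<lambda>_. 1) x \<le> ennreal (C * exp (- \<delta> * t))) \<Longrightarrow>
    dual_riesz a V x \<le> ennreal H"
proof -
  have "2 * (a * \<eta>)\<^sup>2 / \<delta> < 1" using \<delta> by simp
  \<comment> \<open>\<open>\<kappa> < 1\<close> keeps the Gaussian moment finite, and
    \<open>2 * (a * \<eta>)\<^sup>2 / \<delta> < \<kappa>\<close> keeps \<open>m\<close> below
    \<open>\<delta> / 2\<close>.\<close>
  then obtain \<kappa> where \<kappa>: "2 * (a * \<eta>)\<^sup>2 / \<delta> < \<kappa>" "\<kappa> < 1" using dense by blast
  have \<kappa>0: "0 < \<kappa>" using \<kappa>(1) \<delta> a \<eta> by (smt (verit) divide_pos_pos zero_less_power mult_pos_pos)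
  define m where "m = (a * \<eta>)\<^sup>2 / \<kappa>"
  have m: "0 < \<delta> / 2 - m" using \<kappa>(1) \<kappa>0 \<delta> by (simp add: m_def field_simps)
  define B where "B = C1 powr a * exp (a * \<eta> * R)"
  define G where "G = (1 / sqrt (1 - \<kappa>)) ^ DIM('a)"
  define K where "K = (C + B\<^sup>2 * G) / 2"
  have G: "0 \<le> G" using \<kappa> by (simp add: G_def)
  have K: "0 \<le> K" using C G by (simp add: K_def)
  let ?I = "\<integral>\<^sup>+t\<in>{0<..}. ennreal (t powr (a - 1) * exp (- (\<delta> / 2 - m) * t)) \<partial>lborel"
  have fin: "?I < \<top>" using a m by (rule nn_integral_powr_exp_finite)
  have main: "dual_riesz a V x \<le> ennreal K * ?I"
    if x: "norm x \<le> R" and dec: "\<And>t. 0 < t \<Longrightarrow> feynman_kac (\<lambda>y. ennreal (V y)) t (\<lambda>_. 1) x \<le> ennreal (C * exp (- \<delta> * t))" for x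
  proof -
    have F: "feynman_kac (\<lambda>y. ennreal (V y)) t (\<lambda>y. ennreal (V y powr a)) x \<le> ennreal (K * exp (- (\<delta> / 2 - m) * t))"
      if t: "0 < t" for t
    proof -
      have [measurable]: "X t \<in> borel_measurable M" using t by (intro measurable_X) auto
      have [measurable]: "(\<lambda>\<omega>. \<integral>\<^sup>+s\<in>{0..t}. ennreal (V (x + X s \<omega>)) \<partial>lborel) \<in> borel_measurable M"
        by (rule borel_measurable_occupation) auto
      let ?Z = "\<lambda>\<omega>. exp_neg (\<integral>\<^sup>+s\<in>{0..t}. ennreal (V (x + X s \<omega>)) \<partial>lborel)"
      \<comment> \<open>This weight balances \<open>l * exp (- \<delta> * t)\<close> against
        \<open>exp (2 * m * t) / l\<close>: both become
        \<open>exp (- (\<delta> / 2 - m) * t)\<close>.\<close>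
      define l where "l = exp (\<delta> / 2 * t + m * t)"
      define L where "L = B\<^sup>2 * exp (2 * m * t) / (2 * l)"
      have l: "0 < l" by (simp add: l_def)
      have L: "0 \<le> L" using l by (simp add: L_def)
      have "feynman_kac (\<lambda>y. ennreal (V y)) t (\<lambda>y. ennreal (V y powr a)) x
          \<le> (\<integral>\<^sup>+\<omega>. ennreal (l / 2) * ?Z \<omega> + ennreal L * ennreal (exp (\<kappa> * (norm (X t \<omega>))\<^sup>2 / (2 * t))) \<partial>M)"
        unfolding feynman_kac_def
      proof (rule nn_integral_mono)
        fix \<omega>
        let ?n = "norm (X t \<omega>)"
        obtain z where z: "?Z \<omega> = ennreal z" "0 \<le> z" "z \<le> 1"
          using exp_neg_le_1[of "\<integral>\<^sup>+s\<in>{0..t}. ennreal (V (x + X s \<omega>)) \<partial>lborel"]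
          by (cases "?Z \<omega>") (auto simp: top_unique)
        have "V (x + X t \<omega>) \<le> C1 * exp (\<eta> * norm (x + X t \<omega>))" by (rule V)
        also have "\<dots> \<le> C1 * exp (\<eta> * (R + ?n))"
          using C1 \<eta> norm_triangle_ineq[of x "X t \<omega>"] x by (intro mult_left_mono) auto
        finally have "V (x + X t \<omega>) powr a \<le> (C1 * exp (\<eta> * (R + ?n))) powr a"
          using a V by (intro powr_mono2) auto
        also have "\<dots> = B * exp (a * \<eta> * ?n)"
          using C1 by (simp add: B_def powr_mult exp_powr_real algebra_simps exp_add)
        finally have Va: "V (x + X t \<omega>) powr a \<le> B * exp (a * \<eta> * ?n)" .
        define y where "y = V (x + X t \<omega>) powr a"
        have "y\<^sup>2 \<le> (B * exp (a * \<eta> * ?n))\<^sup>2" using Va by (intro power_mono) (auto simp: y_def)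
        also have "\<dots> = B\<^sup>2 * exp (2 * (a * \<eta> * ?n))" by (simp add: power_mult_distrib exp_double)
        also have "\<dots> \<le> B\<^sup>2 * exp (2 * m * t + \<kappa> * ?n\<^sup>2 / (2 * t))"
        proof -
          \<comment> \<open>Completing the square: the linear exponent
            \<open>2 * (a * \<eta> * ?n)\<close> is at most
            \<open>2 * m * t + \<kappa> * ?n\<^sup>2 / (2 * t)\<close>, which explains
            \<open>m = (a * \<eta>)\<^sup>2 / \<kappa>\<close>.\<close>
          have "0 \<le> (\<kappa> * ?n - 2 * t * (a * \<eta>))\<^sup>2 / (2 * t * \<kappa>)" using t \<kappa>0 by simp
          also have "\<dots> = \<kappa> * ?n\<^sup>2 / (2 * t) + 2 * m * t - 2 * (a * \<eta> * ?n)"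
            using t \<kappa>0 by (simp add: m_def field_simps power2_eq_square)
          finally show ?thesis by (intro mult_left_mono) auto
        qed
        finally have y2: "y\<^sup>2 / (2 * l) \<le> L * exp (\<kappa> * ?n\<^sup>2 / (2 * t))"
          using l by (simp add: L_def exp_add divide_right_mono mult_ac)
        have "z * y \<le> l / 2 * z + y\<^sup>2 / (2 * l)"
        proof -
          have "0 \<le> (l * z - y)\<^sup>2 / (2 * l)" using l by simp
          also have "\<dots> = l / 2 * z\<^sup>2 + y\<^sup>2 / (2 * l) - z * y"
            using l by (simp add: field_simps power2_eq_square)
          also have "l / 2 * z\<^sup>2 \<le> l / 2 * z"
            using z l by (intro mult_left_mono) (auto simp: power2_eq_square mult_left_le_one_le)
          finally show ?thesis by simp
        qed
        also have "\<dots> \<le> l / 2 * z + L * exp (\<kappa> * ?n\<^sup>2 / (2 * t))" using y2 by simp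
        finally have "ennreal (z * y) \<le> ennreal (l / 2 * z + L * exp (\<kappa> * ?n\<^sup>2 / (2 * t)))" by (rule ennreal_leI)
        moreover have "ennreal (z * y) = ennreal z * ennreal y" using z by (intro ennreal_mult') auto
        moreover have "ennreal (l / 2 * z) = ennreal (l / 2) * ennreal z" using l by (intro ennreal_mult') auto
        moreover have "ennreal (L * exp (\<kappa> * ?n\<^sup>2 / (2 * t))) = ennreal L * ennreal (exp (\<kappa> * ?n\<^sup>2 / (2 * t)))"
          using L by (intro ennreal_mult')
        moreover have "ennreal (l / 2 * z + L * exp (\<kappa> * ?n\<^sup>2 / (2 * t)))
            = ennreal (l / 2 * z) + ennreal (L * exp (\<kappa> * ?n\<^sup>2 / (2 * t)))"
          using z l L by (intro ennreal_plus) auto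
        ultimately show "?Z \<omega> * ennreal (V (x + X t \<omega>) powr a) \<le> ennreal (l / 2) * ?Z \<omega> + ennreal L * ennreal (exp (\<kappa> * ?n\<^sup>2 / (2 * t)))"
          unfolding z y_def[symmetric] by metis
      qed
      also have "\<dots> = ennreal (l / 2) * (\<integral>\<^sup>+\<omega>. ?Z \<omega> \<partial>M) + ennreal L * (\<integral>\<^sup>+\<omega>. ennreal (exp (\<kappa> * (norm (X t \<omega>))\<^sup>2 / (2 * t))) \<partial>M)"
        by (simp add: nn_integral_add nn_integral_cmult)
      also have "\<dots> \<le> ennreal (l / 2) * ennreal (C * exp (- \<delta> * t)) + ennreal L * ennreal G"
        unfolding nn_integral_exp_norm_sq[OF t \<kappa>(2)] G_def[symmetric]
        using dec[OF t] by (intro add_mono mult_left_mono) (auto simp: feynman_kac_def)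
      also have "\<dots> = ennreal (l / 2 * (C * exp (- \<delta> * t)) + L * G)"
      proof -
        have "ennreal (l / 2 * (C * exp (- \<delta> * t))) = ennreal (l / 2) * ennreal (C * exp (- \<delta> * t))"
          "ennreal (L * G) = ennreal L * ennreal G"
          using l L by (intro ennreal_mult'; simp)+
        then show ?thesis using C l L G by (subst ennreal_plus) auto
      qed
      also have "l / 2 * (C * exp (- \<delta> * t)) + L * G = K * exp (- (\<delta> / 2 - m) * t)"
      proof -
        have 1: "l * exp (- \<delta> * t) = exp (- (\<delta> / 2 - m) * t)"
          unfolding l_def exp_add[symmetric] by (simp add: field_simps)
        have 2: "exp (2 * m * t) / l = exp (- (\<delta> / 2 - m) * t)"
          unfolding l_def exp_diff[symmetric] by (simp add: field_simps)
        have "l / 2 * (C * exp (- \<delta> * t)) + L * G = C / 2 * (l * exp (- \<delta> * t)) + B\<^sup>2 * G / 2 * (exp (2 * m * t) / l)"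
          by (simp add: L_def algebra_simps)
        then show ?thesis unfolding 1 2 by (simp add: K_def algebra_simps add_divide_distrib)
      qed
      finally show ?thesis .
    qed
    have "dual_riesz a V x \<le> (\<integral>\<^sup>+t. ennreal K * (ennreal (t powr (a - 1) * exp (- (\<delta> / 2 - m) * t)) * indicator {0<..} t) \<partial>lborel)"
      unfolding dual_riesz_def
    proof (rule nn_integral_mono)
      fix t :: real
      let ?F = "feynman_kac (\<lambda>y. ennreal (V y)) t (\<lambda>y. ennreal (V y powr a)) x"
      show "?F * ennreal (t powr (a - 1)) * indicator {0<..} t
          \<le> ennreal K * (ennreal (t powr (a - 1) * exp (- (\<delta> / 2 - m) * t)) * indicator {0<..} t)"
      proof (cases "0 < t")
        case True
        have "?F * ennreal (t powr (a - 1)) \<le> ennreal (K * exp (- (\<delta> / 2 - m) * t)) * ennreal (t powr (a - 1))"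
          by (intro mult_right_mono F True) simp
        also have "\<dots> = ennreal K * ennreal (t powr (a - 1) * exp (- (\<delta> / 2 - m) * t))"
          using K by (subst (1 2) ennreal_mult[symmetric]) (simp_all add: mult_ac)
        finally show ?thesis using True by simp
      qed simp
    qed
    also have "\<dots> = ennreal K * ?I" by (rule nn_integral_cmult) measurable
    finally show ?thesis .
  qed
  have "ennreal K * ?I < \<top>" using fin by (simp add: ennreal_mult_less_top)
  then obtain H where H: "ennreal K * ?I = ennreal H" "0 \<le> H" by (cases "ennreal K * ?I") auto
  then show thesis using main that by (metis (lifting))
qed

text \<open>If \<open>V\<close> vanished a.e. on a large ball about \<open>x\<close>, paths staying
  in it up to a time \<open>T\<close> would keep weight \<open>1\<close>. The probability of staying
  does not depend on \<open>x\<close> and tends to \<open>1\<close> with the radius, while the decay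
  forces the total below or at \<open>1/2\<close>. So one radius serves for almost all
  \<open>x\<close>.\<close>

lemma exists_radius_potential_not_zero:
  assumes dec: "AE x in lborel. \<forall>t>0. feynman_kac (\<lambda>y. ennreal (V y)) t (\<lambda>_. 1) x \<le> ennreal (C * exp (- \<delta> * t))"
    and \<delta>: "0 < \<delta>" and C: "0 < C" and [measurable]: "V \<in> borel_measurable borel"
  obtains R where "0 \<le> R" "AE x in lborel. \<not> (AE y in lborel. y \<in> cball x R \<longrightarrow> V y = 0)"
proof -
  define T where "T = max 1 (ln (2 * C) / \<delta>)"
  have T: "0 < T" by (simp add: T_def)
  have "ln (2 * C) \<le> \<delta> * T" unfolding T_def using \<delta> by (simp add: field_simps max_def)
  then have "exp (ln (2 * C)) \<le> exp (\<delta> * T)" by simp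
  then have "2 * C \<le> exp (\<delta> * T)" using C by simp
  then have CT: "C * exp (- \<delta> * T) \<le> 1 / 2" by (simp add: exp_minus field_simps)
  \<comment> \<open>An infinite potential outside the ball: \<open>exp_neg\<close> of its occupation
    integral is \<open>1\<close> for paths staying inside and \<open>0\<close> for those that spend
    positive time outside, so the event of staying is handled without a supremum over the
    path.\<close>
  define k where "k n z = (if norm (z :: 'a) \<le> real n then 0 else \<top> :: ennreal)" for n :: nat and z
  have [measurable]: "k n \<in> borel_measurable borel" for n unfolding k_def[abs_def] by measurable
  have "(\<lambda>\<omega>. \<integral>\<^sup>+s\<in>{0..T}. k n (0 + X s \<omega>) \<partial>lborel) \<in> borel_measurable M" for n
    by (rule borel_measurable_occupation) auto
  then have [measurable]: "(\<lambda>\<omega>. \<integral>\<^sup>+s\<in>{0..T}. k n (X s \<omega>) \<partial>lborel) \<in> borel_measurable M" for n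
    by simp
  let ?u = "\<lambda>n \<omega>. exp_neg (\<integral>\<^sup>+s\<in>{0..T}. k n (0 + X s \<omega>) \<partial>lborel)"
  have "(\<lambda>n. \<integral>\<^sup>+\<omega>. ?u n \<omega> \<partial>M) \<longlonglongrightarrow> (\<integral>\<^sup>+\<omega>. 1 \<partial>M)"
  proof (rule nn_integral_dominated_convergence[where w="\<lambda>_. 1"])
    show "AE \<omega> in M. (\<lambda>n. ?u n \<omega>) \<longlonglongrightarrow> 1"
    proof (rule AE_I2)
      fix \<omega> assume "\<omega> \<in> space M"
      then have "continuous_on {0..T} (\<lambda>s. X s \<omega>)"
        by (intro continuous_on_subset[OF continuous_X]) auto
      then have "bounded ((\<lambda>s. X s \<omega>) ` {0..T})"
        by (intro compact_imp_bounded compact_continuous_image) auto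
      then obtain B where "\<forall>s\<in>{0..T}. norm (X s \<omega>) \<le> B" unfolding bounded_iff by auto
      then have B: "norm (X s \<omega>) \<le> B" if "s \<in> {0..T}" for s using that by blast
      have "?u n \<omega> = 1" if "nat \<lceil>B\<rceil> \<le> n" for n
      proof -
        have "B \<le> real n" using that by linarith
        then have "(\<integral>\<^sup>+s\<in>{0..T}. k n (0 + X s \<omega>) \<partial>lborel) = (\<integral>\<^sup>+s. 0 \<partial>(lborel :: real measure))"
          using B by (intro nn_integral_cong) (fastforce simp: k_def indicator_def)
        then show ?thesis by simp
      qed
      then show "(\<lambda>n. ?u n \<omega>) \<longlonglongrightarrow> 1"
        by (intro tendsto_eventually eventually_sequentiallyI[of "nat \<lceil>B\<rceil>"]) auto
    qed
  qed (auto simp: exp_neg_le_1 emeasure_space_1)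
  then have lim: "(\<lambda>n. \<integral>\<^sup>+\<omega>. ?u n \<omega> \<partial>M) \<longlonglongrightarrow> 1" by (simp add: emeasure_space_1)
  have "ennreal (1 / 2) < ennreal 1" by (rule ennreal_lessI) auto
  then have "\<forall>\<^sub>F n in sequentially. ennreal (1 / 2) < (\<integral>\<^sup>+\<omega>. ?u n \<omega> \<partial>M)"
    unfolding ennreal_1 by (rule order_tendstoD(1)[OF lim])
  then obtain n where n: "ennreal (1 / 2) < (\<integral>\<^sup>+\<omega>. ?u n \<omega> \<partial>M)"
    by (auto simp: eventually_sequentially)
  have "AE x in lborel. \<not> (AE y in lborel. y \<in> cball x (real n) \<longrightarrow> V y = 0)"
    using dec
  proof (rule eventually_mono, safe)
    fix x assume e: "\<forall>t>0. feynman_kac (\<lambda>y. ennreal (V y)) t (\<lambda>_. 1) x \<le> ennreal (C * exp (- \<delta> * t))"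
      and ae: "AE y in lborel. y \<in> cball x (real n) \<longrightarrow> V y = 0"
    obtain N where N: "\<And>y. y \<notin> N \<Longrightarrow> y \<in> cball x (real n) \<longrightarrow> V y = 0" and null: "N \<in> null_sets lborel"
    using ae by (rule AE_E3) auto
    have le: "ennreal (V (x + z)) \<le> k n (0 + z)" if "x + z \<notin> N" for z
    proof (cases "norm z \<le> real n")
      case True
      then have "x + z \<in> cball x (real n)" by (simp add: dist_norm)
      with that N have "V (x + z) = 0" by (auto simp del: mem_cball)
      then show ?thesis by simp
    qed (simp add: k_def)
    have "(\<integral>\<^sup>+\<omega>. ?u n \<omega> \<partial>M) \<le> feynman_kac (\<lambda>y. ennreal (V y)) T (\<lambda>_. 1) x"
      unfolding feynman_kac_def mult_1_right
    proof (rule nn_integral_mono_AE, use AE_occupation_notin[OF null, of x] in eventually_elim)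
      case (elim \<omega>)
      have "AE s in lborel. ennreal (V (x + X s \<omega>)) * indicator {0..T} s \<le> k n (0 + X s \<omega>) * indicator {0..T} s"
        using elim AE_lborel_singleton[of "0::real"]
      proof eventually_elim
        case (elim s)
        then show ?case using le[of "X s \<omega>"] by (cases "0 < s") (auto simp: indicator_def)
      qed
      then show ?case by (intro exp_neg_antimono nn_integral_mono_AE)
    qed
    also have "\<dots> \<le> ennreal (C * exp (- \<delta> * T))" using e T by blast
    also have "\<dots> \<le> ennreal (1 / 2)" by (rule ennreal_leI[OF CT])
    finally show False using n by simp
  qed
  then show thesis using that[of "real n"] by simp
qed

end

text \<open>A radius \<open>r > R\<close> would put \<open>x\<close> inside the open ball about
  \<open>y\<close> on which \<open>V\<close> is a.e. at least \<open>V y / s > 0\<close>; but the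
  zeros of \<open>V\<close> are not negligible near \<open>x\<close>.\<close>

lemma rho_le_dist_to_zero_set:
  assumes supp: "\<And>U. open U \<Longrightarrow> x \<in> U \<Longrightarrow> \<not> (AE z in lborel. z \<in> U \<longrightarrow> z \<notin> {z. V z = 0})"
    and y: "0 < V y" "dist x y \<le> R" and s: "0 < s"
  shows "rho V y s \<le> ennreal R"
  unfolding rho_def
proof (rule SUP_least)
  fix r assume r: "r \<in> {r. 0 \<le> r \<and> (AE z in lebesgue. z \<in> cball y r \<longrightarrow> V y / s \<le> V z)}"
  have "r \<le> R"
  proof (rule ccontr)
    assume "\<not> r \<le> R"
    moreover have "0 < V y / s" using y s by simp
    then have "AE z in lborel. z \<in> ball y r \<longrightarrow> z \<notin> {z. V z = 0}"
      using r by (auto simp: AE_completion_iff simp del: zero_less_divide_iff elim!: eventually_mono)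
    ultimately show False using supp[of "ball y r"] y by (auto simp: dist_commute)
  qed
  then show "ennreal r \<le> ennreal R" by (rule ennreal_leI)
qed

text \<open>\<open>y\<close> carries the information and \<open>x\<close> is the zero. Since
  \<open>rho V y s \<le> R\<close> for \<open>s \<ge> 1\<close>, the exponential in
  \<open>I_fun\<close> is at least \<open>exp (- R\<^sup>2 / (4 * DIM('a)))\<close>, and the bound
  on \<open>I_fun\<close> caps \<open>V y\<close> by \<open>W\<close>. Then \<open>K_fun\<close> at
  \<open>y\<close> is moved to \<open>x\<close> at the cost of \<open>exp (c * R)\<close>.\<close>

lemma sublevel_integral_at_zero_le:
  fixes V :: "'a::euclidean_space \<Rightarrow> real"
  assumes abc: "0 < a" "0 < b" "0 < c" and C: "0 \<le> C"
    and supp: "\<And>U. open U \<Longrightarrow> x \<in> U \<Longrightarrow> \<not> (AE z in lborel. z \<in> U \<longrightarrow> z \<notin> {z. V z = 0})"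
    and y: "0 < V y" "dist x y \<le> R" and K: "K_fun c a V y \<le> ennreal C" and I: "I_fun b V y \<le> ennreal C"
  defines "W \<equiv> (b * C * exp (R\<^sup>2 / (4 * real DIM('a))) + 1) powr (1 / b)"
  shows "sublevel_integral c a V x (V y) \<le> ennreal (W powr a + exp (c * R) * (max 1 (W powr a) * C))"
proof -
  let ?w = "V y"
  let ?E = "exp (R\<^sup>2 / (4 * real DIM('a)))"
  have R: "0 \<le> R" using y(2) zero_le_dist[of x y] by linarith
  have base: "1 \<le> b * C * ?E + 1" using abc C by simp
  have w: "?w \<le> W"
  proof (cases "?w \<le> 1")
    case True
    have "1 \<le> W" unfolding W_def using base abc by (intro ge_one_powr_ge_zero) auto
    then show ?thesis using True by simp
  next
    case False
    then have w1: "1 \<le> ?w" by simp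
    have low: "ennreal (1 / ?E) \<le> exp_neg ((rho V y s)\<^sup>2 / ennreal (4 * real DIM('a)))" if "1 \<le> s" for s
    proof -
      have "(rho V y s)\<^sup>2 / ennreal (4 * real DIM('a)) \<le> (ennreal R)\<^sup>2 / ennreal (4 * real DIM('a))"
        using that y by (intro divide_right_mono_ennreal power_mono rho_le_dist_to_zero_set[OF supp]) auto
      also have "\<dots> = ennreal (R\<^sup>2 / (4 * real DIM('a)))"
        using R by (simp add: ennreal_power divide_ennreal)
      finally have "exp_neg (ennreal (R\<^sup>2 / (4 * real DIM('a)))) \<le> exp_neg ((rho V y s)\<^sup>2 / ennreal (4 * real DIM('a)))"
        by (rule exp_neg_antimono)
      then show ?thesis by (simp add: exp_neg_ennreal exp_minus inverse_eq_divide)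
    qed
    have "ennreal (1 / ?E) * ennreal ((?w powr b - 1) / b)
        = (\<integral>\<^sup>+s. ennreal (1 / ?E) * (ennreal (s powr (b - 1)) * indicator {1..?w} s) \<partial>lborel)"
      unfolding nn_integral_powr_Icc[OF abc(2) w1, symmetric] by (rule nn_integral_cmult[symmetric]) measurable
    also have "\<dots> \<le> I_fun b V y"
      unfolding I_fun_def
    proof (rule nn_integral_mono)
      fix s :: real
      show "ennreal (1 / ?E) * (ennreal (s powr (b - 1)) * indicator {1..?w} s)
          \<le> ennreal (s powr (b - 1)) * exp_neg ((rho V y s)\<^sup>2 / ennreal (4 * real DIM('a))) * indicator {1..max 1 ?w} s"
      proof (cases "s \<in> {1..?w}")
        case True
        then have "ennreal (s powr (b - 1)) * ennreal (1 / ?E) \<le> ennreal (s powr (b - 1)) * exp_neg ((rho V y s)\<^sup>2 / ennreal (4 * real DIM('a)))"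
          by (intro mult_left_mono low) auto
        then show ?thesis using True w1 by (simp add: mult.commute max_def)
      qed simp
    qed
    also note I
    finally have "1 / ?E * ((?w powr b - 1) / b) \<le> C"
      using C abc w1 by (subst (asm) ennreal_mult'[symmetric]) auto
    then have "?w powr b \<le> b * C * ?E + 1" using abc by (simp add: field_simps)
    then have "(?w powr b) powr (1 / b) \<le> W" unfolding W_def using abc by (intro powr_mono2) auto
    then show ?thesis using y abc by (simp add: powr_powr)
  qed
  let ?g = "\<lambda>z s. exp_neg (ennreal c * sublevel_radius V z (s * ?w)) * ennreal (s powr (a - 1)) * indicator {1..} s"
  have [measurable]: "(\<lambda>s. exp_neg (ennreal c * sublevel_radius V z (s * ?w))) \<in> borel_measurable borel" for z
    using y by (intro borel_measurable_exp_neg_sublevel_radius) auto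
  have "(\<integral>\<^sup>+s. ?g x s \<partial>lborel) \<le> (\<integral>\<^sup>+s. ennreal (exp (c * R)) * ?g y s \<partial>lborel)"
  proof (rule nn_integral_mono)
    fix s :: real
    have "exp_neg (ennreal c * sublevel_radius V x (s * ?w)) \<le> ennreal (exp (c * R)) * exp_neg (ennreal c * sublevel_radius V y (s * ?w))"
      using y abc by (intro exp_neg_sublevel_radius_triangle) auto
    from mult_right_mono[OF this, of "ennreal (s powr (a - 1)) * indicator {1..} s"]
    show "?g x s \<le> ennreal (exp (c * R)) * ?g y s" by (simp add: mult.assoc)
  qed
  also have "\<dots> = ennreal (exp (c * R)) * (\<integral>\<^sup>+s. ?g y s \<partial>lborel)"
    by (rule nn_integral_cmult) measurable
  finally have Jx: "(\<integral>\<^sup>+s. ?g x s \<partial>lborel) \<le> ennreal (exp (c * R)) * (\<integral>\<^sup>+s. ?g y s \<partial>lborel)" .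
  have wW: "?w powr a \<le> W powr a" using w y abc by (intro powr_mono2) auto
  have "ennreal (?w powr a) * (\<integral>\<^sup>+s. ?g y s \<partial>lborel) = ennreal (max 1 (?w powr a)) * K_fun c a V y"
  proof -
    \<comment> \<open>\<open>K_fun\<close> contains only \<open>min 1 (?w powr a)\<close>; the
      complementary factor \<open>max 1 (?w powr a)\<close> is bounded because
      \<open>?w \<le> W\<close>.\<close>
    have "?w powr a = max 1 (?w powr a) * min 1 (?w powr a)" by (simp add: max_def min_def)
    then have "ennreal (?w powr a) = ennreal (max 1 (?w powr a)) * ennreal (min 1 (?w powr a))"
      by (metis ennreal_mult' max.coboundedI1 zero_le_one)
    then show ?thesis by (simp add: K_fun_def sigma_rad_eq_sublevel_radius mult.assoc)
  qed
  also have "\<dots> \<le> ennreal (max 1 (W powr a)) * ennreal C"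
    using wW by (intro mult_mono K ennreal_leI) auto
  finally have Jy: "ennreal (?w powr a) * (\<integral>\<^sup>+s. ?g y s \<partial>lborel) \<le> ennreal (max 1 (W powr a) * C)"
    using C by (subst ennreal_mult) auto
  have "sublevel_integral c a V x ?w = ennreal (?w powr a) + ennreal (?w powr a) * (\<integral>\<^sup>+s. ?g x s \<partial>lborel)"
    by (simp add: sublevel_integral_def distrib_left)
  also have "\<dots> \<le> ennreal (W powr a) + ennreal (?w powr a) * (ennreal (exp (c * R)) * (\<integral>\<^sup>+s. ?g y s \<partial>lborel))"
    by (intro add_mono ennreal_leI wW mult_left_mono Jx) simp
  also have "\<dots> = ennreal (W powr a) + ennreal (exp (c * R)) * (ennreal (?w powr a) * (\<integral>\<^sup>+s. ?g y s \<partial>lborel))"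
    by (simp only: mult.left_commute)
  also have "\<dots> \<le> ennreal (W powr a) + ennreal (exp (c * R)) * ennreal (max 1 (W powr a) * C)"
    by (intro add_mono mult_left_mono Jy) auto
  also have "\<dots> = ennreal (W powr a + exp (c * R) * (max 1 (W powr a) * C))"
    using C by (subst ennreal_mult'[symmetric], simp) (rule ennreal_plus[symmetric], auto)
  finally show ?thesis .
qed

lemma sublevel_integral_eq_K_fun:
  assumes "0 \<le> V x" "V x \<le> 1" "0 < a"
  shows "sublevel_integral c a V x (V x) = ennreal (V x powr a) + K_fun c a V x"
proof -
  have "min 1 (V x powr a) = V x powr a" using assms by (simp add: powr_le1)
  then show ?thesis
    by (simp add: sublevel_integral_def K_fun_def sigma_rad_eq_sublevel_radius distrib_left)
qed

lemma sublevel_integral_eq_K_fun_large: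
  assumes "1 \<le> V x" "0 < a"
  shows "sublevel_integral c a V x (V x) = ennreal (V x powr a) * (1 + K_fun c a V x)"
proof -
  have "min 1 (V x powr a) = 1" using assms by (simp add: ge_one_powr_ge_zero)
  then show ?thesis
    by (simp add: sublevel_integral_def K_fun_def sigma_rad_eq_sublevel_radius)
qed

lemma (in brownian_motion) dual_riesz_essentially_bounded:
  fixes V :: "'a \<Rightarrow> real"
  assumes [measurable]: "V \<in> borel_measurable borel" and V: "\<And>y. 0 \<le> V y" "\<And>y. V y \<le> C1 * exp (\<eta> * norm y)"
    and pos: "0 < \<eta>" "0 < C1" "0 < \<delta>" "0 < a" "a < b" "0 < C3"
    and decay: "exponential_decay M X V \<delta>" and small: "2 * (a * \<eta>)\<^sup>2 < \<delta>"
    and c: "c = min ((b - a) / (8 * b)) (\<delta> * a / (4 * b))" and F: "compact F"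
    and KI: "AE x in lborel. x \<notin> F \<longrightarrow> K_fun c a V x \<le> ennreal C3 \<and> I_fun b V x \<le> ennreal C3"
  obtains H where "0 \<le> H" "AE x in lborel. dual_riesz a V x \<le> ennreal H"
proof -
  let ?D = "sqrt 2 ^ DIM('a)"
  let ?e = "\<lambda>t. feynman_kac (\<lambda>y. ennreal (V y)) t (\<lambda>_. 1)"
  \<comment> \<open>Here \<open>(1 - \<theta>)/4 = (b - a)/(8b)\<close> is the first entry of \<open>c\<close>, and \<open>\<gamma> < 1\<close> is such that \<open>\<theta>b\<gamma> > a\<close>.\<close>
  define \<theta> where "\<theta> = (a + b) / (2 * b)"
  define \<gamma> where "\<gamma> = (3 * a + b) / (2 * (a + b))"
  have \<theta>: "0 < \<theta>" "\<theta> < 1" and \<gamma>: "0 < \<gamma>" "\<gamma> < 1"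
    using pos by (auto simp: \<theta>_def \<gamma>_def field_simps)
  have "(1 - \<theta>) / 4 = (b - a) / (8 * b)" using pos by (simp add: \<theta>_def field_simps)
  then have c1: "c \<le> (1 - \<theta>) / 4" by (simp only: c min.cobounded1)
  have "\<delta> * a / (4 * b) \<le> \<theta> * \<delta> / 2" using pos by (simp add: \<theta>_def field_simps)
  then have c2: "c \<le> \<theta> * \<delta> / 2" unfolding c by (rule min.coboundedI2)
  have c0: "0 < c" using pos by (simp add: c)
  \<comment> \<open>The midpoint between \<open>a\<close> and
    \<open>\<theta> * b = (a + b) / 2\<close>; the strict gap above \<open>a\<close> makes
    \<open>?I1\<close> finite.\<close>
  have "\<theta> * (b * \<gamma>) = (3 * a + b) / 4"
  proof -
    have "\<theta> * b = (a + b) / 2" using pos by (simp add: \<theta>_def)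
    moreover have "(a + b) / 2 * \<gamma> = (3 * a + b) / 4" using pos by (simp add: \<gamma>_def field_simps)
    ultimately show ?thesis by (metis mult.assoc)
  qed
  then have \<beta>: "a < \<theta> * (b * \<gamma>)" using pos by simp
  obtain C where C: "1 \<le> C" "AE x in lborel. \<forall>t>0. ?e t x \<le> ennreal (C * exp (- \<delta> * t))"
    using feynman_kac_decay_all_times[OF decay pos(3)] .
  obtain R where R: "0 \<le> R" "AE x in lborel. \<not> (AE y in lborel. y \<in> cball x R \<longrightarrow> V y = 0)"
    using exists_radius_potential_not_zero[OF C(2) pos(3)] C(1) by auto
  obtain RF where RF: "\<And>x. x \<in> F \<Longrightarrow> norm x \<le> RF"
    using compact_imp_bounded[OF F] by (auto simp: bounded_iff)
  \<comment> \<open>The radius is \<open>RF + R\<close>, not \<open>RF\<close>: outside this ball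
    every point within distance \<open>R\<close> of \<open>x\<close> avoids \<open>F\<close>, so the
    auxiliary \<open>y\<close> near a zero of \<open>V\<close> is subject to the hypotheses on
    \<open>K_fun\<close> and \<open>I_fun\<close>.\<close>
  obtain H1 where H1: "0 \<le> H1" "\<And>x. norm x \<le> RF + R \<Longrightarrow> (\<And>t. 0 < t \<Longrightarrow> ?e t x \<le> ennreal (C * exp (- \<delta> * t))) \<Longrightarrow>
      dual_riesz a V x \<le> ennreal H1"
    using dual_riesz_bounded_on_ball[OF pos(4,1,3) small pos(2) assms(1) V(1) V(2), of C "RF + R"] C(1) by auto
  define p where "p = b * \<gamma> / (1 - \<gamma>)"
  define C0 where "C0 = p powr p + ?D * (b * C3 + 1)"
  \<comment> \<open>One constant for both ranges of time: \<open>C * exp \<delta>\<close> is what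
    the decay costs when one unit of time is split off.\<close>
  define CL where "CL = C0 * (C * exp \<delta>)"
  have C0: "0 \<le> C0" using pos by (simp add: C0_def)
  have Ce: "1 \<le> C * exp \<delta>" using mult_mono[of 1 C 1 "exp \<delta>"] C(1) pos by simp
  have CL: "0 \<le> CL" "C0 \<le> CL" using C0 Ce mult_left_mono[OF Ce C0] by (auto simp: CL_def)
  define W where "W = (b * C3 * exp (R\<^sup>2 / (4 * real DIM('a))) + 1) powr (1 / b)"
  define HZ where "HZ = W powr a + exp (c * R) * (max 1 (W powr a) * C3)"
  have HZ: "0 \<le> HZ" using pos by (simp add: HZ_def)
  let ?I1 = "\<integral>\<^sup>+t\<in>{0<..}. ennreal (t powr (a - 1) * min 1 (t powr - (\<theta> * (b * \<gamma>)))) \<partial>lborel"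
  let ?I2 = "\<integral>\<^sup>+t\<in>{0<..}. ennreal (t powr (a - 1) * exp (- (\<theta> * \<delta> / 2) * t)) \<partial>lborel"
  have I1: "?I1 < \<top>" using pos(4) \<beta> by (rule nn_integral_powr_min_finite)
  have I2: "?I2 < \<top>" using pos \<theta> by (intro nn_integral_powr_exp_finite) auto
  let ?B2 = "ennreal ((1 + a) * ?D * C powr \<theta> * (1 + C3)) * ?I2"
  let ?B3 = "ennreal ((1 + a) * ?D * CL powr \<theta> * exp (\<theta> * \<delta> / 2) * (1 + C3)) * (?I1 + ?I2)"
  let ?B4 = "ennreal ((1 + a) * ?D * C powr \<theta> * HZ) * ?I2"
  let ?B = "ennreal H1 + ?B2 + ?B3 + ?B4"
  have fin: "?B < \<top>" using I1 I2 by (simp add: ennreal_mult_less_top)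
  have "AE x in lborel. dual_riesz a V x \<le> ?B"
    using C(2) R(2) KI AE_in_support[of "{z. V z = 0}" lborel]
  proof eventually_elim
    case (elim x)
    have dec: "?e t x \<le> ennreal (C * exp (- \<delta> * t))" if "0 < t" for t using elim(1) that by blast
    show ?case
    proof (cases "norm x \<le> RF + R")
      case True
      from H1(2)[OF True dec] show ?thesis by (simp add: add_increasing2 add.assoc)
    next
      case False
      then have xF: "x \<notin> F" using RF R(1) by fastforce
      consider "V x = 0" | "0 < V x" "V x \<le> 1" | "1 < V x" using V(1)[of x] by fastforce
      then show ?thesis
      proof cases
        case 1
        have supp: "\<not> (AE z in lborel. z \<in> U \<longrightarrow> z \<notin> {z. V z = 0})" if "open U" "x \<in> U" for U
          using elim(4) that 1 by auto
        obtain y where y: "dist x y \<le> R" "0 < V y" "K_fun c a V y \<le> ennreal C3" "I_fun b V y \<le> ennreal C3"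
        proof -
          \<comment> \<open>Without such a \<open>y\<close>, almost every point of the ball has
            \<open>V y = 0\<close>, against the choice of \<open>R\<close>. The a.e. bounds are part
            of the existence claim so that a single point has all the properties.\<close>
          have "\<exists>y. dist x y \<le> R \<and> 0 < V y \<and> (y \<notin> F \<longrightarrow> K_fun c a V y \<le> ennreal C3 \<and> I_fun b V y \<le> ennreal C3)"
          proof (rule ccontr)
            assume no: "\<not> ?thesis"
            have "AE y in lborel. y \<in> cball x R \<longrightarrow> V y = 0"
              using KI by (rule eventually_mono) (use no V(1) in \<open>force simp: less_le\<close>)
            with elim(2) show False by simp
          qed
          then obtain y where y: "dist x y \<le> R" "0 < V y" "y \<notin> F \<longrightarrow> K_fun c a V y \<le> ennreal C3 \<and> I_fun b V y \<le> ennreal C3"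
            by blast
          have "y \<notin> F"
          proof
            assume "y \<in> F"
            then have "norm x \<le> RF + R"
              using RF[of y] y(1) norm_triangle_sub[of x y] by (simp add: dist_norm)
            with False show False by simp
          qed
          with y that show thesis by blast
        qed
        have "sublevel_integral c a V x (V y) \<le> ennreal HZ"
          unfolding HZ_def W_def by (rule sublevel_integral_at_zero_le) (use pos c0 supp y in auto)
        then have "dual_riesz a V x \<le> ?B4"
          using C(1) HZ by (intro dual_riesz_le_of_decay[OF pos(4) y(2) \<theta> c0 c1 c2 pos(3) assms(1) V(1) _ dec]) auto
        then show ?thesis by (simp add: add_increasing)
      next
        case 2
        have "sublevel_integral c a V x (V x) \<le> ennreal (1 + C3)"
        proof -
          have "V x powr a \<le> 1" using 2 pos by (simp add: powr_le1)
          then have "ennreal (V x powr a) + K_fun c a V x \<le> ennreal 1 + ennreal C3"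
            using elim(3) xF by (intro add_mono ennreal_leI) auto
          then show ?thesis using 2 pos by (subst sublevel_integral_eq_K_fun) (auto simp: ennreal_plus)
        qed
        then have "dual_riesz a V x \<le> ?B2"
          using C(1) pos by (intro dual_riesz_le_of_decay[OF pos(4) 2(1) \<theta> c0 c1 c2 pos(3) assms(1) V(1) _ dec]) auto
        then have "dual_riesz a V x \<le> ?B2 + (ennreal H1 + ?B3 + ?B4)" by (rule add_increasing2[rotated]) simp
        then show ?thesis by (simp add: add_ac)
      next
        case 3
        then have Vx: "1 \<le> V x" by simp
        have sI: "sublevel_integral c a V x (V x) \<le> ennreal (V x powr a * (1 + C3))"
        proof -
          have "1 + K_fun c a V x \<le> ennreal 1 + ennreal C3" using elim(3) xF by (intro add_mono) auto
          also have "\<dots> = ennreal (1 + C3)" using pos by (simp add: ennreal_plus)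
          finally have "ennreal (V x powr a) * (1 + K_fun c a V x) \<le> ennreal (V x powr a) * ennreal (1 + C3)"
            by (rule mult_left_mono) simp
          then show ?thesis
            using Vx pos by (subst sublevel_integral_eq_K_fun_large) (auto simp: ennreal_mult' simp del: ennreal_plus)
        qed
        have sm: "?e t x \<le> ennreal (C0 * min 1 ((t * V x) powr - (b * \<gamma>)))" if "0 < t" "t \<le> 1" for t
          unfolding C0_def p_def using elim(3) xF pos
          by (intro feynman_kac_le_of_I_fun that \<gamma> assms(1) Vx) auto
        have smL: "?e t x \<le> ennreal (CL * min 1 ((t * V x) powr - (b * \<gamma>)))" if "0 < t" "t \<le> 1" for t
        proof (rule order_trans[OF sm[OF that]], rule ennreal_leI)
          show "C0 * min 1 ((t * V x) powr - (b * \<gamma>)) \<le> CL * min 1 ((t * V x) powr - (b * \<gamma>))"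
            using CL by (intro mult_right_mono) auto
        qed
        have lg: "?e t x \<le> ennreal (CL * V x powr - (b * \<gamma>) * exp (- \<delta> * t))" if t: "1 < t" for t
        proof -
          have "AE y in lborel. ?e (t - 1) y \<le> ennreal (C * exp (- \<delta> * (t - 1)))"
            using C(2) by (rule eventually_mono) (use t in auto)
          then have "?e t x \<le> ennreal (C * exp (- \<delta> * (t - 1))) * ?e 1 x"
            by (intro feynman_kac_decay_step t) auto
          also have "\<dots> \<le> ennreal (C * exp (- \<delta> * (t - 1))) * ennreal (C0 * V x powr - (b * \<gamma>))"
          proof (intro mult_left_mono)
            have "?e 1 x \<le> ennreal (C0 * min 1 ((1 * V x) powr - (b * \<gamma>)))" by (rule sm) auto
            also have "\<dots> \<le> ennreal (C0 * V x powr - (b * \<gamma>))"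
              using C0 by (intro ennreal_leI mult_left_mono) auto
            finally show "?e 1 x \<le> ennreal (C0 * V x powr - (b * \<gamma>))" .
          qed simp
          also have "\<dots> = ennreal (C * exp (- \<delta> * (t - 1)) * (C0 * V x powr - (b * \<gamma>)))"
            using C(1) by (intro ennreal_mult'[symmetric]) auto
          also have "exp (- \<delta> * (t - 1)) = exp \<delta> * exp (- \<delta> * t)"
            unfolding exp_add[symmetric] by (simp add: algebra_simps)
          also have "C * (exp \<delta> * exp (- \<delta> * t)) * (C0 * V x powr - (b * \<gamma>)) = CL * V x powr - (b * \<gamma>) * exp (- \<delta> * t)"
            unfolding CL_def by (simp only: mult_ac)
          finally show ?thesis .
        qed
        have "dual_riesz a V x \<le> ?B3"
          by (rule dual_riesz_le_of_large_potential[OF pos(4) \<theta> c0 c1 c2 pos(3) assms(1) V(1) Vx _ CL(1) smL lg _ sI])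
            (use \<beta> pos in auto)
        then have "dual_riesz a V x \<le> ?B3 + (ennreal H1 + ?B2 + ?B4)" by (rule add_increasing2[rotated]) simp
        then show ?thesis by (simp add: add_ac)
      qed
    qed
  qed
  moreover obtain H where "?B = ennreal H" "0 \<le> H" using fin by (cases ?B) auto
  ultimately show thesis using that by metis
qed

text \<open>Symmetry of the semigroup at each time, integrated against \<open>t powr (a - 1)\<close>
  with Tonelli's theorem. With \<open>g\<close> the power of the potential, it moves the estimate
  from the Riesz transform of \<open>f\<close> to \<open>dual_riesz\<close>.\<close>

lemma (in brownian_motion) dual_riesz_duality:
  assumes [measurable]: "v \<in> borel_measurable borel" "f \<in> borel_measurable borel" "g \<in> borel_measurable borel"
  shows "(\<integral>\<^sup>+x. g x * (\<integral>\<^sup>+t\<in>{0<..}. feynman_kac v t f x * ennreal (t powr (a - 1)) \<partial>lborel) \<partial>lborel)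
    = (\<integral>\<^sup>+x. f x * (\<integral>\<^sup>+t\<in>{0<..}. feynman_kac v t g x * ennreal (t powr (a - 1)) \<partial>lborel) \<partial>lborel)"
proof -
  let ?k = "\<lambda>f t x. feynman_kac v (max 0 t) f x * ennreal (t powr (a - 1)) * indicator {0<..} t"
  have k: "(\<lambda>(x, t). g x * ?k f t x) \<in> borel_measurable (lborel \<Otimes>\<^sub>M lborel)"
    if [measurable]: "f \<in> borel_measurable borel" "g \<in> borel_measurable borel" for f g
  proof -
    have [measurable]: "(\<lambda>p. feynman_kac v (max 0 (snd p)) f (fst p)) \<in> borel_measurable (lborel \<Otimes>\<^sub>M lborel)"
      by (rule borel_measurable_feynman_kac) auto
    show ?thesis unfolding split_beta' by measurable
  qed
  have iter: "(\<integral>\<^sup>+x. g x * (\<integral>\<^sup>+t\<in>{0<..}. feynman_kac v t f x * ennreal (t powr (a - 1)) \<partial>lborel) \<partial>lborel)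
      = (\<integral>\<^sup>+t. ennreal (t powr (a - 1)) * indicator {0<..} t * (\<integral>\<^sup>+x. g x * feynman_kac v (max 0 t) f x \<partial>lborel) \<partial>lborel)"
    if [measurable]: "f \<in> borel_measurable borel" "g \<in> borel_measurable borel" for f g
  proof -
    have kt [measurable]: "(\<lambda>t. feynman_kac v (max 0 t) f x) \<in> borel_measurable borel" for x
      by (rule borel_measurable_feynman_kac) auto
    have kx [measurable]: "(\<lambda>x. feynman_kac v (max 0 t) f x) \<in> borel_measurable borel" for t
      by (rule borel_measurable_feynman_kac) auto
    have "(\<integral>\<^sup>+x. g x * (\<integral>\<^sup>+t\<in>{0<..}. feynman_kac v t f x * ennreal (t powr (a - 1)) \<partial>lborel) \<partial>lborel)
        = (\<integral>\<^sup>+x. \<integral>\<^sup>+t. g x * ?k f t x \<partial>lborel \<partial>lborel)"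
    proof (rule nn_integral_cong)
      fix x
      have "(\<integral>\<^sup>+t\<in>{0<..}. feynman_kac v t f x * ennreal (t powr (a - 1)) \<partial>lborel) = (\<integral>\<^sup>+t. ?k f t x \<partial>lborel)"
        by (intro nn_integral_cong) (auto simp: indicator_def)
      then show "g x * (\<integral>\<^sup>+t\<in>{0<..}. feynman_kac v t f x * ennreal (t powr (a - 1)) \<partial>lborel) = (\<integral>\<^sup>+t. g x * ?k f t x \<partial>lborel)"
        by (simp add: nn_integral_cmult)
    qed
    also have "\<dots> = (\<integral>\<^sup>+t. \<integral>\<^sup>+x. g x * ?k f t x \<partial>lborel \<partial>lborel)"
      by (rule lborel_pair.Fubini'[symmetric, OF k]) measurable
    also have "\<dots> = (\<integral>\<^sup>+t. ennreal (t powr (a - 1)) * indicator {0<..} t * (\<integral>\<^sup>+x. g x * feynman_kac v (max 0 t) f x \<partial>lborel) \<partial>lborel)"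
    proof (rule nn_integral_cong)
      fix t
      have "(\<integral>\<^sup>+x. g x * ?k f t x \<partial>lborel) = (\<integral>\<^sup>+x. ennreal (t powr (a - 1)) * indicator {0<..} t * (g x * feynman_kac v (max 0 t) f x) \<partial>lborel)"
        by (intro nn_integral_cong) (simp only: mult_ac)
      then show "(\<integral>\<^sup>+x. g x * ?k f t x \<partial>lborel) = ennreal (t powr (a - 1)) * indicator {0<..} t * (\<integral>\<^sup>+x. g x * feynman_kac v (max 0 t) f x \<partial>lborel)"
        by (simp add: nn_integral_cmult)
    qed
    finally show ?thesis .
  qed
  show ?thesis
    unfolding iter[OF assms(2,3)] iter[OF assms(3,2)]
    by (intro nn_integral_cong arg_cong2[where f="(*)"] refl feynman_kac_symmetric) auto
qed

text \<open>\<open>rho\<close> uses the potential both a.e. and at the point \<open>x\<close>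
  itself, so equality at \<open>x\<close> is assumed besides equality a.e.; this holds for almost
  all \<open>x\<close>.\<close>

lemma rho_cong_AE:
  assumes "AE y in lborel. V y = V' y" "V x = V' x"
  shows "rho V x u = rho V' x u"
proof -
  have "(AE y in lebesgue. y \<in> cball x r \<longrightarrow> V x / u \<le> V y) \<longleftrightarrow> (AE y in lebesgue. y \<in> cball x r \<longrightarrow> V' x / u \<le> V' y)" for r
    unfolding AE_completion_iff assms(2) using assms(1) by (intro eventually_cong) auto
  then show ?thesis by (simp add: rho_def)
qed

lemma sigma_rad_cong_AE:
  assumes "AE y in lborel. V y = V' y" "V x = V' x"
  shows "sigma_rad V x u = sigma_rad V' x u"
proof -
  have "(AE y in lebesgue. y \<in> cball x r \<longrightarrow> V y \<le> u * V x) \<longleftrightarrow> (AE y in lebesgue. y \<in> cball x r \<longrightarrow> V' y \<le> u * V' x)" for r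
    unfolding AE_completion_iff assms(2) using assms(1) by (intro eventually_cong) auto
  then show ?thesis by (simp add: sigma_rad_def)
qed

subsection \<open>Passing to Borel representatives\<close>

theorem theorem5p4:
  fixes M :: "'w measure"
    and X :: "real \<Rightarrow> 'w \<Rightarrow> 'a::euclidean_space"
    and V :: "'a \<Rightarrow> real"
    and \<eta> \<delta> a b c C1 C3 :: real
    and F :: "'a set"
  assumes "brownian_motion M X"
    and "Linf_loc V"
    and "AE x in lebesgue. 0 \<le> V x"
    and "\<eta> > 0" and "C1 > 0"
    and "AE x in lebesgue. V x \<le> C1 * exp (\<eta> * norm x)"
    and "\<delta> > 0"
    and "exponential_decay M X V \<delta>"
    and "0 < a" and "a < \<delta> powr (1/2) * (2 * real DIM('a)) powr (- 1/2) * inverse \<eta>"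
    and "b > a"
    and "c = min ((b - a) / (8 * b)) (\<delta> * a / (4 * b))"
    and "compact F" and "C3 > 0"
    and "AE x in lebesgue. x \<notin> F \<longrightarrow> K_fun c a V x \<le> ennreal C3 \<and> I_fun b V x \<le> ennreal C3"
  shows "riesz_bounded_L1 M X V a"
proof -
  interpret brownian_motion M X by fact
  have "V \<in> borel_measurable lebesgue" using assms(2) by (simp add: Linf_loc_def)
  then obtain V0 where V0 [measurable]: "V0 \<in> borel_measurable borel" and V0_eq: "AE x in lborel. V x = V0 x"
    using completion_ex_borel_measurable_real[of V lborel] by auto
  \<comment> \<open>Truncation between \<open>0\<close> and the exponential bound makes both
    estimates hold at every point, and alters the Borel representative only on a null set.\<close>
  define V' where "V' y = max 0 (min (V0 y) (C1 * exp (\<eta> * norm y)))" for y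
  have V'm [measurable]: "V' \<in> borel_measurable borel" unfolding V'_def[abs_def] by measurable
  have V': "0 \<le> V' y" "V' y \<le> C1 * exp (\<eta> * norm y)" for y using assms(5) by (auto simp: V'_def)
  have eq: "AE x in lborel. V x = V' x"
    using V0_eq assms(3,6) unfolding AE_completion_iff
    by eventually_elim (auto simp: V'_def)
  have FK_eq: "schroedinger_semigroup M X V t f x = feynman_kac (\<lambda>y. ennreal (V' y)) t (\<lambda>y. ennreal (f' y)) x"
    if "0 < t" "AE y in lborel. f y = f' y" for t f f' x
  proof -
    have "AE y in lborel. ennreal (V y) = ennreal (V' y)" "AE y in lborel. ennreal (f y) = ennreal (f' y)"
      using eq that(2) by (eventually_elim, simp)+
    then show ?thesis
      unfolding schroedinger_semigroup_eq_feynman_kac by (rule feynman_kac_cong_AE) (rule that(1))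
  qed
  have decay: "exponential_decay M X V' \<delta>"
  proof -
    have same: "schroedinger_semigroup M X V' t (\<lambda>_. 1) x = schroedinger_semigroup M X V t (\<lambda>_. 1) x" if "0 < t" for t x
      unfolding FK_eq[OF that, of "\<lambda>_. 1" "\<lambda>_. 1", simplified] by (simp add: schroedinger_semigroup_eq_feynman_kac)
    obtain C where "0 < C" "\<And>t. 0 < t \<Longrightarrow> AE x in lebesgue. schroedinger_semigroup M X V t (\<lambda>_. 1) x \<le> ennreal (C * exp (- \<delta> * t))"
      using assms(8) unfolding exponential_decay_def by blast
    then show ?thesis unfolding exponential_decay_def by (intro exI[of _ C] conjI allI impI) (simp_all only: same)
  qed
  have KI: "AE x in lborel. x \<notin> F \<longrightarrow> K_fun c a V' x \<le> ennreal C3 \<and> I_fun b V' x \<le> ennreal C3"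
    using assms(15) eq unfolding AE_completion_iff
  proof eventually_elim
    case (elim x)
    then show ?case
      by (simp add: K_fun_def I_fun_def rho_cong_AE[OF eq elim(2)] sigma_rad_cong_AE[OF eq elim(2)])
  qed
  \<comment> \<open>Squaring the hypothesis on \<open>a\<close> gives
    \<open>2 * d * (a * \<eta>)\<^sup>2 < \<delta>\<close> with \<open>d\<close> the dimension;
    \<open>1 \<le> d\<close> then gives the form that the Young argument takes.\<close>
  have small: "2 * (a * \<eta>)\<^sup>2 < \<delta>"
  proof -
    let ?d = "real DIM('a)"
    have d: "1 \<le> ?d" using DIM_positive[where 'a='a] by linarith
    have "a * \<eta> < \<delta> powr (1/2) * (2 * ?d) powr (- 1/2)"
    proof -
      have "a * \<eta> < \<delta> powr (1/2) * (2 * ?d) powr (- 1/2) * inverse \<eta> * \<eta>"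
        by (rule mult_strict_right_mono) fact+
      also have "\<dots> = \<delta> powr (1/2) * (2 * ?d) powr (- 1/2)" using assms(4) by (simp add: mult.assoc)
      finally show ?thesis .
    qed
    then have "(a * \<eta>)\<^sup>2 < (\<delta> powr (1/2) * (2 * ?d) powr (- 1/2))\<^sup>2"
      using assms(4,9) by (intro power_strict_mono) auto
    also have "\<dots> = \<delta> / (2 * ?d)"
    proof -
      have "(2 * ?d) powr (- 1/2) = inverse ((2 * ?d) powr (1/2))"
        using powr_minus[of "2 * ?d" "1/2"] by (simp only: minus_divide_left)
      moreover have "(2 * ?d) powr (1/2) = sqrt (2 * ?d)" using d by (intro powr_half_sqrt) simp
      moreover have "\<delta> powr (1/2) = sqrt \<delta>" using assms(7) by (intro powr_half_sqrt) simp
      moreover have "(sqrt \<delta> * inverse (sqrt (2 * ?d)))\<^sup>2 = \<delta> * inverse (2 * ?d)"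
        unfolding power_mult_distrib power_inverse using assms(7) d by simp
      ultimately show ?thesis by (simp only: divide_inverse)
    qed
    finally have "2 * ?d * (a * \<eta>)\<^sup>2 < \<delta>" using d by (simp add: field_simps)
    moreover have "1 * (2 * (a * \<eta>)\<^sup>2) \<le> ?d * (2 * (a * \<eta>)\<^sup>2)" using d by (intro mult_right_mono) auto
    ultimately show ?thesis by (simp add: mult_ac)
  qed
  obtain H where H: "0 \<le> H" "AE x in lborel. dual_riesz a V' x \<le> ennreal H"
    using dual_riesz_essentially_bounded[OF V'm V' assms(4,5,7,9,11,14) decay small assms(12,13) KI] by blast
  have G: "0 < Gamma a" using assms(9) by (rule Gamma_real_pos)
  show ?thesis
    unfolding riesz_bounded_L1_def
  \<comment> \<open>The summand \<open>1\<close> keeps the constant positive if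
    \<open>H = 0\<close>.\<close>
  proof (intro exI[of _ "H / Gamma a + 1"] conjI allI impI)
    show "0 < H / Gamma a + 1" using H G by (simp add: add_nonneg_pos)
    fix f :: "'a \<Rightarrow> real"
    assume f: "simple_function lebesgue f \<and> (\<forall>x. 0 \<le> f x) \<and> (\<exists>K. compact K \<and> (\<forall>x. x \<notin> K \<longrightarrow> f x = 0))"
    then have "f \<in> borel_measurable lebesgue" by (auto intro: borel_measurable_simple_function)
    then obtain f' where f' [measurable]: "f' \<in> borel_measurable borel" and f'_eq: "AE x in lborel. f x = f' x"
      using completion_ex_borel_measurable_real[of f lborel] by auto
    let ?v = "\<lambda>y. ennreal (V' y)" and ?g = "\<lambda>y. ennreal (V' y powr a)" and ?f = "\<lambda>y. ennreal (f' y)"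
    let ?J = "\<lambda>x. \<integral>\<^sup>+t\<in>{0<..}. feynman_kac ?v t ?f x * ennreal (t powr (a - 1)) \<partial>lborel"
    have Jm [measurable]: "?J \<in> borel_measurable borel"
    proof -
      have [measurable]: "(\<lambda>p. feynman_kac ?v (max 0 (snd p)) ?f (fst p)) \<in> borel_measurable (borel \<Otimes>\<^sub>M lborel)"
        by (rule borel_measurable_feynman_kac) auto
      have "(\<lambda>x. \<integral>\<^sup>+t. feynman_kac ?v (max 0 t) ?f x * ennreal (t powr (a - 1)) * indicator {0<..} t \<partial>lborel) \<in> borel_measurable borel"
        by measurable
      also have "(\<lambda>x. \<integral>\<^sup>+t. feynman_kac ?v (max 0 t) ?f x * ennreal (t powr (a - 1)) * indicator {0<..} t \<partial>lborel) = ?J"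
        by (intro ext nn_integral_cong) (auto simp: indicator_def)
      finally show ?thesis .
    qed
    have "(\<integral>\<^sup>+x. riesz_transform M X V a f x \<partial>lebesgue) = (\<integral>\<^sup>+x. ennreal (1 / Gamma a) * (?g x * ?J x) \<partial>lborel)"
      unfolding nn_integral_completion
    proof (rule nn_integral_cong_AE, use eq in eventually_elim)
      case (elim x)
      have "(\<integral>\<^sup>+t\<in>{0<..}. schroedinger_semigroup M X V t f x * ennreal (t powr (a - 1)) \<partial>lborel) = ?J x"
        by (intro nn_integral_cong) (simp only: indicator_def, auto simp: FK_eq[OF _ f'_eq])
      then show ?case unfolding riesz_transform_def elim by (simp only: mult.left_commute)
    qed
    also have "\<dots> = ennreal (1 / Gamma a) * (\<integral>\<^sup>+x. ?g x * ?J x \<partial>lborel)"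
      by (rule nn_integral_cmult) measurable
    also have "(\<integral>\<^sup>+x. ?g x * ?J x \<partial>lborel) = (\<integral>\<^sup>+x. ?f x * dual_riesz a V' x \<partial>lborel)"
      unfolding dual_riesz_def by (rule dual_riesz_duality) measurable
    also have "ennreal (1 / Gamma a) * \<dots> \<le> ennreal (1 / Gamma a) * (\<integral>\<^sup>+x. ennreal H * ?f x \<partial>lborel)"
    proof (intro mult_left_mono nn_integral_mono_AE, use H(2) in eventually_elim)
      case (elim x)
      then show ?case by (subst mult.commute) (rule mult_right_mono, auto)
    qed simp
    also have "\<dots> = ennreal (1 / Gamma a) * (ennreal H * (\<integral>\<^sup>+x. ?f x \<partial>lborel))"
      by (subst nn_integral_cmult) auto
    also have "(\<integral>\<^sup>+x. ?f x \<partial>lborel) = (\<integral>\<^sup>+x. ennreal (f x) \<partial>lebesgue)"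
      unfolding nn_integral_completion using f'_eq by (intro nn_integral_cong_AE) (auto elim!: eventually_mono)
    also have "ennreal (1 / Gamma a) * (ennreal H * (\<integral>\<^sup>+x. ennreal (f x) \<partial>lebesgue)) = ennreal (H / Gamma a) * (\<integral>\<^sup>+x. ennreal (f x) \<partial>lebesgue)"
      using G H by (simp add: mult.assoc[symmetric] flip: ennreal_mult)
    also have "\<dots> \<le> ennreal (H / Gamma a + 1) * (\<integral>\<^sup>+x. ennreal (f x) \<partial>lebesgue)"
      by (intro mult_right_mono ennreal_leI) auto
    finally show "(\<integral>\<^sup>+x. riesz_transform M X V a f x \<partial>lebesgue) \<le> ennreal (H / Gamma a + 1) * (\<integral>\<^sup>+x. ennreal (f x) \<partial>lebesgue)" .
  qed
qed

end
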